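(* Let $r\ge 0$, let $d\ge 1$ be an integer, let $C=C([-r,0],\mathbb{R}^d)$ with the supremum norm, and let $L\colon[0,\infty)\to\mathcal{L}(C,\mathbb{R}^d)$ be continuous (with respect to the operator norm). Consider the linear delay differential equation $$x'(t)=L(t)x_t .\qquad (\ast)$$ Suppose that $$M:=\sup_{t\ge 0}\|L(t)\|<\infty .$$ If equation $(\ast)$ is shadowable, then it admits an exponential dichotomy.
   Context: Setting. $|\cdot|$ is any fixed norm on $\mathbb{R}^d$; $C=C([-r,0],\mathbb{R}^d)$ is the Banach space of continuous maps $\phi\colon[-r,0]\to\mathbb{R}^d$ with norm $\|\phi\|=\sup_{\theta\in[-r,0]}|\phi(\theta)|$; $\mathcal{L}(C,\mathbb{R}^d)$ is the space of bounded linear operators from $C$ to $\mathbb{R}^d$ with the operator norm. For a continuous $\mathbb{R}^d$-valued function $x$ defined on $[t-r,t]$, $x_t\in C$ is defined by $x_t(\theta)=x(t+\theta)$, $\theta\in[-r,0]$. Solutions. For $s\ge 0$, a solution of $(\ast)$ on $[s,\infty)$ is a continuous function $x\colon[s-r,\infty)\to\mathbb{R}^d$ which is differentiable on $[s,\infty)$ (right-hand derivative at $t=s$) and satisfies $x'(t)=L(t)x_t$ for all $t\ge s$. For every $s\ge0$ and $\phi\in C$ there is a unique solution $x$ on $[s,\infty)$ with $x_s=\phi$. For $t\ge s\ge 0$ the solution operator $T(t,s)\colon C\to C$ is defined by $T(t,s)\phi=x_t$, where $x$ is the unique solution on $[s,\infty)$ with $x_s=\phi$. Shadowable. Equation $(\ast)$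 is shadowable if for each $\varepsilon>0$ there exists $\delta>0$ such that for each continuous function $y\colon[-r,\infty)\to\mathbb{R}^d$ which is continuously differentiable on $[0,\infty)$ and satisfies $\sup_{t\ge 0}|y'(t)-L(t)y_t|\le\delta$, there exists a solution $x$ of $(\ast)$ on $[0,\infty)$ with $\sup_{t\ge 0}\|x_t-y_t\|\le\varepsilon$. Exponential dichotomy. Equation $(\ast)$ admits an exponential dichotomy if there exist a family $(P(t))_{t\ge 0}$ of projections on $C$ (bounded linear operators with $P(t)^2=P(t)$) and constants $D,\lambda>0$ such that: (1) for all $t\ge s\ge 0$, $P(t)T(t,s)=T(t,s)P(s)$, and the restriction $T(t,s)|_{\operatorname{Ker}P(s)}\colon\operatorname{Ker}P(s)\to\operatorname{Ker}P(t)$ is onto and invertible; (2) for all $t\ge s\ge 0$, $\|T(t,s)P(s)\|\le De^{-\lambda(t-s)}$; (3) for all $0\le t\le s$, $\|T(t,s)Q(s)\|\le De^{-\lambda(s-t)}$, where $Q(s)=\mathrm{Id}-P(s)$ and, for $0\le t\le s$, $T(t,s):=\bigl(T(s,t)|_{\operatorname{Ker}P(t)}\bigr)^{-1}\colon\operatorname{Ker}P(s)\to\operatorname{Ker}P(t)$. *)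

theory Defs
  imports "HOL-Analysis.Analysis"
begin

definition is_norm :: "('v::real_vector \<Rightarrow> real) \<Rightarrow> bool" where
  "is_norm N \<longleftrightarrow>
     (\<forall>x. 0 \<le> N x) \<and> (\<forall>x. N x = 0 \<longleftrightarrow> x = 0) \<and>
     (\<forall>x y. N (x + y) \<le> N x + N y) \<and> (\<forall>c x. N (c *\<^sub>R x) = \<bar>c\<bar> * N x)"

text \<open>
  The space \<open>C([-r,0], \<real>\<^sup>d)\<close>. A type cannot depend on \<open>r\<close>, so a continuous function on
  \<open>[-r,0]\<close> is represented by its unique extension to the real line that is constant on each
  side of the interval (see \<open>Cspace_ex1\<close>). This makes \<open>C([-r,0], \<real>\<^sup>d)\<close> a linear subspace of the
  library type of bounded continuous functions, from which it takes its vector operations.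
  Its norm is the supremum norm built from the given norm \<open>N\<close> on \<open>\<real>\<^sup>d\<close>, which need not be the
  Euclidean one. Maps defined on \<open>Cspace r\<close> are total functions whose values outside
  \<open>Cspace r\<close> are irrelevant.
\<close>

definition Cspace :: "real \<Rightarrow> (real \<Rightarrow>\<^sub>C (real^'d)) set" where
  "Cspace r = {\<phi>. apply_bcontfun \<phi> = ext_cont (apply_bcontfun \<phi>) (- r) 0}"

definition Cnorm :: "(real^'d \<Rightarrow> real) \<Rightarrow> real \<Rightarrow> (real \<Rightarrow>\<^sub>C (real^'d)) \<Rightarrow> real" where
  "Cnorm N r \<phi> = (SUP \<theta>\<in>{- r..0}. N (apply_bcontfun \<phi> \<theta>))"

text \<open>
  \<open>seg r x t\<close> is the segment \<open>x\<^sub>t\<close>, that is \<open>\<theta> \<mapsto> x (t + \<theta>)\<close> on \<open>[-r,0]\<close>; it is meaningful whenever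
  \<open>x\<close> is continuous on \<open>[t-r,t]\<close>.
\<close>

definition seg :: "real \<Rightarrow> (real \<Rightarrow> real^'d) \<Rightarrow> real \<Rightarrow> (real \<Rightarrow>\<^sub>C (real^'d))" where
  "seg r x t = Bcontfun (ext_cont (\<lambda>\<theta>. x (t + \<theta>)) (- r) 0)"

lemma apply_seg:
  fixes x :: "real \<Rightarrow> real^'d"
  assumes "0 \<le> r" "continuous_on {t - r..t} x"
  shows "apply_bcontfun (seg r x t) = ext_cont (\<lambda>\<theta>. x (t + \<theta>)) (- r) 0"
proof -
  have "continuous_on {- r..0} (\<lambda>\<theta>. x (t + \<theta>))"
    by (rule continuous_on_compose2[OF assms(2)]) (auto intro!: continuous_intros)
  then obtain g :: "real \<Rightarrow>\<^sub>C (real^'d)"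
    where g: "\<And>\<theta>. \<theta> \<in> cbox (- r) 0 \<Longrightarrow> apply_bcontfun g \<theta> = x (t + \<theta>)"
      "\<And>\<theta>. apply_bcontfun g \<theta> = x (t + clamp (- r) 0 \<theta>)"
    using continuous_on_cbox_bcontfunE[of "- r" 0 "\<lambda>\<theta>. x (t + \<theta>)"] by (metis box_real(2))
  have "ext_cont (\<lambda>\<theta>. x (t + \<theta>)) (- r) 0 = apply_bcontfun g"
    using g by (auto simp: ext_cont_def)
  then show ?thesis
    unfolding seg_def by (simp add: apply_bcontfun_inverse)
qed

lemma Cspace_ex1:
  fixes f :: "real \<Rightarrow> real^'d"
  assumes "0 \<le> r" "continuous_on {- r..0} f"
  shows "\<exists>!\<phi>. \<phi> \<in> Cspace r \<and> (\<forall>\<theta>\<in>{- r..0}. apply_bcontfun \<phi> \<theta> = f \<theta>)"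
proof -
  have cl: "clamp (- r) 0 \<theta> \<in> {- r..0}" for \<theta> :: real
    using clamp_in_interval[of "- r" 0 \<theta>] assms(1) by simp
  have id: "clamp (- r) 0 \<theta> = \<theta>" if "\<theta> \<in> {- r..0}" for \<theta> :: real
    using that by (simp add: clamp_cancel_cbox)
  have ap: "apply_bcontfun (seg r f 0) = ext_cont f (- r) 0"
    using apply_seg[of r 0 f] assms by simp
  show ?thesis
  proof (rule ex1I[of _ "seg r f 0"])
    show "seg r f 0 \<in> Cspace r \<and> (\<forall>\<theta>\<in>{- r..0}. apply_bcontfun (seg r f 0) \<theta> = f \<theta>)"
      by (simp add: Cspace_def ap ext_cont_def id id[OF cl])
  next
    fix \<phi> :: "real \<Rightarrow>\<^sub>C (real^'d)"
    assume *: "\<phi> \<in> Cspace r \<and> (\<forall>\<theta>\<in>{- r..0}. apply_bcontfun \<phi> \<theta> = f \<theta>)"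
    then have "apply_bcontfun \<phi> \<theta> = f (clamp (- r) 0 \<theta>)" for \<theta>
      using cl[of \<theta>] by (metis (mono_tags, lifting) Cspace_def ext_cont_def mem_Collect_eq)
    then show "\<phi> = seg r f 0"
      by (intro bcontfun_eqI) (simp add: ap ext_cont_def)
  qed
qed

definition bounded_linear_between ::
  "'v::real_vector set \<Rightarrow> ('v \<Rightarrow> real) \<Rightarrow> 'w::real_vector set \<Rightarrow> ('w \<Rightarrow> real) \<Rightarrow> ('v \<Rightarrow> 'w) \<Rightarrow> bool" where
  "bounded_linear_between V nV W nW A \<longleftrightarrow>
     (\<forall>u\<in>V. A u \<in> W) \<and>
     (\<forall>u\<in>V. \<forall>v\<in>V. A (u + v) = A u + A v) \<and>
     (\<forall>c. \<forall>u\<in>V. A (c *\<^sub>R u) = c *\<^sub>R A u) \<and>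
     (\<exists>K. \<forall>u\<in>V. nW (A u) \<le> K * nV u)"

text \<open>
  The operator norm of a linear map on \<open>V\<close> takes values in \<open>ennreal\<close>, so that it is \<open>\<infinity>\<close> exactly
  for unbounded maps.
\<close>

definition opnorm :: "'v set \<Rightarrow> ('v \<Rightarrow> real) \<Rightarrow> ('w \<Rightarrow> real) \<Rightarrow> ('v \<Rightarrow> 'w) \<Rightarrow> ennreal" where
  "opnorm V nV nW A = (SUP u\<in>{u \<in> V. nV u \<le> 1}. ennreal (nW (A u)))"

definition opnorm_continuous_on ::
  "real set \<Rightarrow> 'v set \<Rightarrow> ('v \<Rightarrow> real) \<Rightarrow> ('w::ab_group_add \<Rightarrow> real) \<Rightarrow> (real \<Rightarrow> 'v \<Rightarrow> 'w) \<Rightarrow> bool" where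
  "opnorm_continuous_on I V nV nW A \<longleftrightarrow>
     (\<forall>t\<in>I. \<forall>\<epsilon>>0. \<exists>\<delta>>0. \<forall>s\<in>I. \<bar>s - t\<bar> < \<delta> \<longrightarrow> opnorm V nV nW (\<lambda>u. A s u - A t u) < ennreal \<epsilon>)"

text \<open>
  A function on \<open>[s-r,\<infinity>)\<close> is a total function of which only the values on \<open>[s-r,\<infinity>)\<close> are used.
  The derivative within \<open>[s,\<infinity>)\<close> is two-sided for \<open>t > s\<close> and right-hand at \<open>t = s\<close>.
\<close>

definition is_solution ::
  "real \<Rightarrow> (real \<Rightarrow> (real \<Rightarrow>\<^sub>C (real^'d)) \<Rightarrow> real^'d) \<Rightarrow> real \<Rightarrow> (real \<Rightarrow> real^'d) \<Rightarrow> bool" where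
  "is_solution r L s x \<longleftrightarrow>
     continuous_on {s - r..} x \<and>
     (\<forall>t\<ge>s. (x has_vector_derivative L t (seg r x t)) (at t within {s..}))"

text \<open>
  \<open>solution_op r L t s\<close> is \<open>T(t,s)\<close> for \<open>t \<ge> s\<close>. The description is over the segment \<open>x\<^sub>t\<close> rather
  than over \<open>x\<close>, because \<open>x\<close> is unique only on \<open>[s-r,\<infinity>)\<close>.
\<close>

definition solution_op ::
  "real \<Rightarrow> (real \<Rightarrow> (real \<Rightarrow>\<^sub>C (real^'d)) \<Rightarrow> real^'d) \<Rightarrow> real \<Rightarrow> real \<Rightarrow>
   (real \<Rightarrow>\<^sub>C (real^'d)) \<Rightarrow> (real \<Rightarrow>\<^sub>C (real^'d))" where
  "solution_op r L t s \<phi> = (THE \<psi>. \<exists>x. is_solution r L s x \<and> seg r x s = \<phi> \<and> seg r x t = \<psi>)"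

definition shadowable ::
  "(real^'d \<Rightarrow> real) \<Rightarrow> real \<Rightarrow> (real \<Rightarrow> (real \<Rightarrow>\<^sub>C (real^'d)) \<Rightarrow> real^'d) \<Rightarrow> bool" where
  "shadowable N r L \<longleftrightarrow>
     (\<forall>\<epsilon>>0. \<exists>\<delta>>0. \<forall>y y'.
        continuous_on {- r..} y \<and>
        (\<forall>t\<ge>0. (y has_vector_derivative y' t) (at t within {0..})) \<and>
        continuous_on {0..} y' \<and>
        (\<forall>t\<ge>0. N (y' t - L t (seg r y t)) \<le> \<delta>) \<longrightarrow>
        (\<exists>x. is_solution r L 0 x \<and> (\<forall>t\<ge>0. Cnorm N r (seg r x t - seg r y t) \<le> \<epsilon>)))"

definition Cker :: "real \<Rightarrow> ((real \<Rightarrow>\<^sub>C (real^'d)) \<Rightarrow> (real \<Rightarrow>\<^sub>C (real^'d))) \<Rightarrow> (real \<Rightarrow>\<^sub>C (real^'d)) set" where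
  "Cker r A = {\<phi> \<in> Cspace r. A \<phi> = 0}"

text \<open>
  In the last clause, for \<open>0 \<le> t \<le> s\<close>, the operator \<open>T(t,s)\<close> is the inverse of the restriction of
  \<open>T(s,t)\<close> to \<open>Ker P(t)\<close>.
\<close>

definition exponential_dichotomy ::
  "(real^'d \<Rightarrow> real) \<Rightarrow> real \<Rightarrow> (real \<Rightarrow> (real \<Rightarrow>\<^sub>C (real^'d)) \<Rightarrow> real^'d) \<Rightarrow> bool" where
  "exponential_dichotomy N r L \<longleftrightarrow>
     (\<exists>(P :: real \<Rightarrow> (real \<Rightarrow>\<^sub>C (real^'d)) \<Rightarrow> (real \<Rightarrow>\<^sub>C (real^'d))) D \<mu>. 0 < D \<and> 0 < \<mu> \<and>
        (\<forall>t\<ge>0. bounded_linear_between (Cspace r) (Cnorm N r) (Cspace r) (Cnorm N r) (P t) \<and>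
               (\<forall>\<phi>\<in>Cspace r. P t (P t \<phi>) = P t \<phi>)) \<and>
        (\<forall>s t. 0 \<le> s \<and> s \<le> t \<longrightarrow>
           (\<forall>\<phi>\<in>Cspace r. P t (solution_op r L t s \<phi>) = solution_op r L t s (P s \<phi>)) \<and>
           bij_betw (solution_op r L t s) (Cker r (P s)) (Cker r (P t))) \<and>
        (\<forall>s t. 0 \<le> s \<and> s \<le> t \<longrightarrow>
           opnorm (Cspace r) (Cnorm N r) (Cnorm N r) (\<lambda>\<phi>. solution_op r L t s (P s \<phi>))
             \<le> ennreal (D * exp (- \<mu> * (t - s)))) \<and>
        (\<forall>s t. 0 \<le> t \<and> t \<le> s \<longrightarrow>
           opnorm (Cspace r) (Cnorm N r) (Cnorm N r)
               (\<lambda>\<phi>. inv_into (Cker r (P t)) (solution_op r L s t) (\<phi> - P s \<phi>))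
             \<le> ennreal (D * exp (- \<mu> * (s - t)))))"

end

theory Submission
  imports Defs "HOL-Complex_Analysis.Great_Picard"
begin

text \<open>
  Why shadowing forces a dichotomy. If \<open>u\<close> is a solution and \<open>h\<close> a scalar \<open>C\<^sup>1\<close> function with slope at most
  \<open>1\<close>, then \<open>h * u\<close> is an approximate solution whose defect is bounded by \<open>u\<close> on the set where \<open>h\<close> varies,
  no matter how large \<open>h\<close> becomes (\<open>pseudo_solution_multiple\<close>). Shadowing such products by true solutions,
  at a distance proportional to the defect, yields everything else.

  \<^item> A solution switched on shortly after time \<open>s\<close> is shadowed by a solution on \<open>[0,\<infinity>)\<close>. So every state at
  time \<open>s\<close> is the sum of a state reached from time \<open>0\<close> and a state with a bounded orbit, with bounds
  independent of \<open>s\<close> (\<open>splitting\<close>).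

  \<^item> Taking \<open>s = r\<close> and using that \<open>T r 0\<close> is compact, the states at time \<open>0\<close> with a bounded orbit have
  finite codimension and admit a bounded projection. The argument (\<open>spanning_of_net\<close>,
  \<open>complement_of_spanning\<close>) carries bounds for the orbits along, removes redundant vectors from a finite
  spanning set, and obtains boundedness of the coefficients from their uniqueness. Let \<open>U\<close> be the resulting complement.

  \<^item> Let \<open>S s\<close> be the space of states at time \<open>s\<close> with a bounded orbit. The splitting shows that \<open>S s\<close> and
  \<open>T s 0 U\<close> are complementary; the solution operators respect this decomposition, are
  injective on the second summand, and the projections are bounded uniformly in \<open>s\<close>.

  \<^item> A bounded approximate solution that starts in \<open>U\<close> is bounded by a multiple of its defect
  (\<open>pseudo_solution_bound\<close>), since bounded solutions have no component in \<open>U\<close>. Applied to \<open>h * u\<close> with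
  a slowly rising or descending \<open>h\<close> of large height \<open>n\<close>, this bounds \<open>n * u\<close> by a constant independent of
  \<open>n\<close>, so that solutions in \<open>S s\<close> are halved after a fixed time, and solutions in \<open>T s 0 U\<close> backwards in time
  (\<open>stable_decay\<close>, \<open>unstable_decay\<close>). Exponential rates follow by iteration.
\<close>

section \<open>Segments and their supremum norm\<close>

lemma Cspace_iff_clamp: "\<phi> \<in> Cspace r \<longleftrightarrow> (\<forall>\<theta>. apply_bcontfun \<phi> \<theta> = apply_bcontfun \<phi> (clamp (- r) 0 \<theta>))"
  unfolding Cspace_def ext_cont_def by (auto simp: fun_eq_iff)

lemma subspace_Cspace: "subspace (Cspace r :: (real \<Rightarrow>\<^sub>C (real^'d)) set)"
proof (rule subspaceI)
  show "0 \<in> Cspace r" by (simp add: Cspace_iff_clamp)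
next
  fix \<phi> \<psi> :: "real \<Rightarrow>\<^sub>C (real^'d)" assume "\<phi> \<in> Cspace r" "\<psi> \<in> Cspace r"
  then show "\<phi> + \<psi> \<in> Cspace r" unfolding Cspace_iff_clamp plus_bcontfun.rep_eq by metis
next
  fix c and \<phi> :: "real \<Rightarrow>\<^sub>C (real^'d)" assume "\<phi> \<in> Cspace r"
  then show "c *\<^sub>R \<phi> \<in> Cspace r" unfolding Cspace_iff_clamp scaleR_bcontfun.rep_eq by metis
qed

lemmas Cspace_simps [simp] = subspace_0[OF subspace_Cspace]
lemmas Cspace_intros [intro] = subspace_add[OF subspace_Cspace] subspace_diff[OF subspace_Cspace]
  subspace_scale[OF subspace_Cspace] subspace_neg[OF subspace_Cspace]

lemma clamp_mem:
  assumes "0 \<le> r" shows "clamp (- r) 0 \<theta> \<in> {- r..0::real}"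
  using clamp_in_interval[of "- r" 0 \<theta>] assms by simp

text \<open>
  The elements of \<open>Cspace r\<close> are constant on each side of \<open>[-r,0]\<close>, so the norm of the type of bounded
  continuous functions is, on \<open>Cspace r\<close>, the supremum over \<open>[-r,0]\<close> alone.
\<close>

lemma Cspace_norm_le:
  assumes "0 \<le> r" "\<phi> \<in> Cspace r" "\<And>\<theta>. \<theta> \<in> {- r..0} \<Longrightarrow> norm (apply_bcontfun \<phi> \<theta>) \<le> c"
  shows "norm \<phi> \<le> c"
proof (rule norm_bound)
  fix \<theta>
  have "apply_bcontfun \<phi> \<theta> = apply_bcontfun \<phi> (clamp (- r) 0 \<theta>)"
    using assms(2) unfolding Cspace_iff_clamp by blast
  then show "norm (apply_bcontfun \<phi> \<theta>) \<le> c"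
    using assms(3)[OF clamp_mem[OF assms(1)]] by simp
qed

lemma Cspace_eqI:
  assumes "0 \<le> r" "\<phi> \<in> Cspace r" "\<psi> \<in> Cspace r"
    "\<And>\<theta>. \<theta> \<in> {- r..0} \<Longrightarrow> apply_bcontfun \<phi> \<theta> = apply_bcontfun \<psi> \<theta>"
  shows "\<phi> = \<psi>"
proof -
  have "norm (\<phi> - \<psi>) \<le> 0"
    by (rule Cspace_norm_le[OF assms(1)]) (use assms in auto)
  then show ?thesis by simp
qed

context
  fixes r :: real
  assumes r: "0 \<le> r"
begin

lemma seg_in_Cspace:
  fixes x :: "real \<Rightarrow> real^'d"
  assumes "continuous_on {t - r..t} x" shows "seg r x t \<in> Cspace r"
  unfolding Cspace_iff_clamp apply_seg[OF r assms] ext_cont_def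
  using clamp_mem[OF r] clamp_cancel_cbox[of _ "- r" 0] by (metis box_real(2))

lemma seg_apply:
  fixes x :: "real \<Rightarrow> real^'d"
  assumes "continuous_on {t - r..t} x" "\<theta> \<in> {- r..0}"
  shows "apply_bcontfun (seg r x t) \<theta> = x (t + \<theta>)"
  using assms by (simp add: apply_seg[OF r] ext_cont_def clamp_cancel_cbox)

lemma seg_norm_le:
  fixes x :: "real \<Rightarrow> real^'d"
  assumes "continuous_on {t - r..t} x" "\<And>\<tau>. \<tau> \<in> {t - r..t} \<Longrightarrow> norm (x \<tau>) \<le> c"
  shows "norm (seg r x t) \<le> c"
  by (rule Cspace_norm_le[OF r seg_in_Cspace]) (use assms in \<open>auto simp: seg_apply\<close>)

lemma norm_le_seg:
  fixes x :: "real \<Rightarrow> real^'d"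
  assumes "continuous_on {t - r..t} x" "\<tau> \<in> {t - r..t}"
  shows "norm (x \<tau>) \<le> norm (seg r x t)"
  using norm_bounded[of "seg r x t" "\<tau> - t"] seg_apply[OF assms(1), of "\<tau> - t"] assms(2) by auto

lemma seg_cong:
  assumes "\<And>\<tau>. \<tau> \<in> {t - r..t} \<Longrightarrow> x \<tau> = y \<tau>" shows "seg r x t = seg r y t"
  unfolding seg_def ext_cont_def
  by (rule arg_cong[where f=Bcontfun], rule ext) (use clamp_mem[OF r] in \<open>auto intro!: assms\<close>)

lemma seg_eq_0:
  assumes "\<And>\<tau>. \<tau> \<in> {t - r..t} \<Longrightarrow> x \<tau> = 0" shows "seg r x t = 0"
  using seg_cong[of t x "\<lambda>_. 0"] seg_norm_le[of t "\<lambda>_. 0" 0] assms by simp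

lemma seg_add:
  fixes x y :: "real \<Rightarrow> real^'d"
  assumes "continuous_on {t - r..t} x" "continuous_on {t - r..t} y"
  shows "seg r (\<lambda>\<tau>. x \<tau> + y \<tau>) t = seg r x t + seg r y t"
  by (rule Cspace_eqI[OF r])
    (use assms in \<open>auto simp: seg_apply continuous_on_add intro!: seg_in_Cspace subspace_add[OF subspace_Cspace]\<close>)

lemma seg_scaleR:
  fixes x :: "real \<Rightarrow> real^'d"
  assumes "continuous_on {t - r..t} x"
  shows "seg r (\<lambda>\<tau>. c *\<^sub>R x \<tau>) t = c *\<^sub>R seg r x t"
  by (rule Cspace_eqI[OF r])
    (use assms in \<open>auto simp: seg_apply continuous_on_scaleR intro!: seg_in_Cspace subspace_scale[OF subspace_Cspace]\<close>)

lemma seg_diff: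
  fixes x y :: "real \<Rightarrow> real^'d"
  assumes "continuous_on {t - r..t} x" "continuous_on {t - r..t} y"
  shows "seg r (\<lambda>\<tau>. x \<tau> - y \<tau>) t = seg r x t - seg r y t"
  by (rule Cspace_eqI[OF r])
    (use assms in \<open>auto simp: seg_apply continuous_on_diff intro!: seg_in_Cspace subspace_diff[OF subspace_Cspace]\<close>)

text \<open>
  Two segments at nearby times compare values of \<open>x\<close> at nearby points of one compact interval, where
  \<open>x\<close> is uniformly continuous.
\<close>

lemma continuous_on_seg:
  fixes x :: "real \<Rightarrow> real^'d"
  assumes "continuous_on {s - r..} x"
  shows "continuous_on {s..} (seg r x)"
  unfolding continuous_on_iff
proof (intro ballI allI impI)
  fix t e :: real assume t: "t \<in> {s..}" and e: "0 < e"
  have "uniformly_continuous_on {s - r..t + 1} x"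
    by (rule compact_uniformly_continuous) (auto intro: continuous_on_subset[OF assms])
  then obtain d where d: "d > 0"
    "\<And>a b. a \<in> {s - r..t + 1} \<Longrightarrow> b \<in> {s - r..t + 1} \<Longrightarrow> dist b a < d \<Longrightarrow> dist (x b) (x a) < e / 2"
    unfolding uniformly_continuous_on_def using e by (metis half_gt_zero)
  show "\<exists>d>0. \<forall>u\<in>{s..}. dist u t < d \<longrightarrow> dist (seg r x u) (seg r x t) < e"
  proof (intro exI[of _ "min d 1"] conjI ballI impI)
    show "0 < min d 1" using d by simp
    fix u assume u: "u \<in> {s..}" "dist u t < min d 1"
    have c: "continuous_on {t - r..t} x" "continuous_on {u - r..u} x"
      using t u by (auto intro: continuous_on_subset[OF assms])
    have "norm (seg r x u - seg r x t) \<le> e / 2"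
    proof (rule Cspace_norm_le[OF r])
      show "seg r x u - seg r x t \<in> Cspace r" using seg_in_Cspace c by auto
      fix \<theta> assume \<theta>: "\<theta> \<in> {- r..0}"
      have "dist (x (u + \<theta>)) (x (t + \<theta>)) < e / 2"
        by (rule d(2)) (use t u \<theta> in \<open>auto simp: dist_real_def\<close>)
      then show "norm (apply_bcontfun (seg r x u - seg r x t) \<theta>) \<le> e / 2"
        using c \<theta> by (simp add: seg_apply dist_norm)
    qed
    then show "dist (seg r x u) (seg r x t) < e" using e by (simp add: dist_norm)
  qed
qed

end

section \<open>Solutions and solution operators\<close>

lemma integral_has_vector_derivative_atLeast:
  fixes f :: "real \<Rightarrow> 'a::banach"
  assumes "continuous_on {s..} f" "s \<le> t"
  shows "((\<lambda>u. integral {s..u} f) has_vector_derivative f t) (at t within {s..})"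
proof -
  have "((\<lambda>u. integral {s..u} f) has_vector_derivative f t) (at t within {s..t + 1})"
    by (rule integral_has_vector_derivative) (use assms in \<open>auto intro: continuous_on_subset\<close>)
  moreover have "at t within {s..t + 1} = at t within {s..}"
    by (rule at_within_nhd[of t "{..<t + 1}"]) auto
  ultimately show ?thesis by simp
qed

text \<open>
  The equation \<open>x' t = L t x\<^sub>t\<close> with the Euclidean norm on \<open>\<real>\<^sup>d\<close>. All norms on \<open>\<real>\<^sup>d\<close> are equivalent and
  the assertions about dichotomies and shadowing only change their constants under equivalence, so the
  dynamics is studied for this norm only.
\<close>

locale dde =
  fixes r M :: real and L :: "real \<Rightarrow> (real \<Rightarrow>\<^sub>C (real^'d)) \<Rightarrow> real^'d"
  assumes r: "0 \<le> r" and M: "0 \<le> M"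
    and L_add: "\<And>t \<phi> \<psi>. \<lbrakk>0 \<le> t; \<phi> \<in> Cspace r; \<psi> \<in> Cspace r\<rbrakk> \<Longrightarrow> L t (\<phi> + \<psi>) = L t \<phi> + L t \<psi>"
    and L_scale: "\<And>t c \<phi>. \<lbrakk>0 \<le> t; \<phi> \<in> Cspace r\<rbrakk> \<Longrightarrow> L t (c *\<^sub>R \<phi>) = c *\<^sub>R L t \<phi>"
    and L_bound: "\<And>t \<phi>. \<lbrakk>0 \<le> t; \<phi> \<in> Cspace r\<rbrakk> \<Longrightarrow> norm (L t \<phi>) \<le> M * norm \<phi>"
    and L_cont: "\<And>t \<epsilon>. \<lbrakk>0 \<le> t; 0 < \<epsilon>\<rbrakk> \<Longrightarrow>
      \<exists>\<delta>>0. \<forall>s\<ge>0. \<bar>s - t\<bar> < \<delta> \<longrightarrow> (\<forall>\<phi>\<in>Cspace r. norm (L s \<phi> - L t \<phi>) \<le> \<epsilon> * norm \<phi>)"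
begin

lemma L_diff:
  assumes "0 \<le> t" "\<phi> \<in> Cspace r" "\<psi> \<in> Cspace r"
  shows "L t (\<phi> - \<psi>) = L t \<phi> - L t \<psi>"
  using L_add[of t \<phi> "(-1) *\<^sub>R \<psi>"] L_scale[of t \<psi> "-1"] assms subspace_neg[OF subspace_Cspace, of \<psi> r]
  by simp

text \<open>
  Continuity of \<open>L\<close> in the operator norm acts on the fixed segment at time \<open>t\<close>, and the uniform bound
  \<open>M\<close> on the increment of the segment.
\<close>

lemma continuous_on_L_seg:
  assumes "0 \<le> s" and x: "continuous_on {s - r..} x"
  shows "continuous_on {s..} (\<lambda>t. L t (seg r x t))"
  unfolding continuous_on_iff
proof (intro ballI allI impI)
  fix t e :: real assume t: "t \<in> {s..}" and e: "0 < e"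
  define \<psi> where "\<psi> = seg r x t"
  have X: "seg r x u \<in> Cspace r" if "u \<ge> s" for u
    using that by (intro seg_in_Cspace[OF r] continuous_on_subset[OF x]) auto
  have "0 < e / (2 * (M + 1))" using e M by simp
  then obtain d1 where d1: "d1 > 0"
    "\<And>u. u \<in> {s..} \<Longrightarrow> dist u t < d1 \<Longrightarrow> dist (seg r x u) \<psi> < e / (2 * (M + 1))"
    using continuous_on_seg[OF r x] t unfolding continuous_on_iff \<psi>_def by metis
  have "0 < e / (2 * (norm \<psi> + 1))" using e by (simp add: add_nonneg_pos)
  then obtain d2 where d2: "d2 > 0"
    "\<And>u \<phi>. u \<ge> 0 \<Longrightarrow> \<bar>u - t\<bar> < d2 \<Longrightarrow> \<phi> \<in> Cspace r \<Longrightarrow> norm (L u \<phi> - L t \<phi>) \<le> e / (2 * (norm \<psi> + 1)) * norm \<phi>"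
    using L_cont[of t "e / (2 * (norm \<psi> + 1))"] t \<open>0 \<le> s\<close> by auto
  show "\<exists>d>0. \<forall>u\<in>{s..}. dist u t < d \<longrightarrow> dist (L u (seg r x u)) (L t (seg r x t)) < e"
  proof (intro exI[of _ "min d1 d2"] conjI ballI impI)
    show "0 < min d1 d2" using d1 d2 by simp
    fix u assume u: "u \<in> {s..}" "dist u t < min d1 d2"
    have "norm (L u (seg r x u - \<psi>)) \<le> M * norm (seg r x u - \<psi>)"
      by (rule L_bound) (use u t \<open>0 \<le> s\<close> X in \<open>auto simp: \<psi>_def\<close>)
    also have "\<dots> \<le> M * (e / (2 * (M + 1)))"
      using d1(2)[of u] u M by (intro mult_left_mono) (auto simp: dist_norm)
    also have "\<dots> < e / 2" using e M by (simp add: field_simps)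
    finally have 1: "norm (L u (seg r x u) - L u \<psi>) < e / 2"
      using L_diff[of u "seg r x u" \<psi>] X[of u] X[of t] u t \<open>0 \<le> s\<close> by (simp add: \<psi>_def)
    have "norm (L u \<psi> - L t \<psi>) \<le> e / (2 * (norm \<psi> + 1)) * norm \<psi>"
      using d2(2)[of u \<psi>] X[of t] u t \<open>0 \<le> s\<close> by (simp add: \<psi>_def dist_real_def)
    also have "\<dots> \<le> e / 2" using e by (simp add: divide_simps add_nonneg_pos)
    finally show "dist (L u (seg r x u)) (L t (seg r x t)) < e"
      using 1 norm_triangle_lt[of "L u (seg r x u) - L u \<psi>" "L u \<psi> - L t \<psi>" e]
      by (simp add: dist_norm \<psi>_def)
  qed
qed

text \<open>
  In the norm weighted by \<open>exp (- rate * (t - s))\<close>, integrating \<open>L\<close> along a function shrinks it by the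
  factor \<open>M / rate < 1/2\<close>. The same estimate therefore yields a growth bound (the weighted supremum of
  a solution can be absorbed) and global existence in a single contraction on the whole half-line.
\<close>

definition rate :: real where "rate = 2 * M + 1"

lemma rate_pos: "0 < rate" and M_le_rate: "M \<le> rate / 2"
  using M by (auto simp: rate_def)

lemma weighted_increment_le:
  fixes x :: "real \<Rightarrow> 'a::real_normed_vector"
  assumes "s \<le> t" "0 \<le> c" "continuous_on {s..t} x"
    and "\<And>\<tau>. \<lbrakk>s < \<tau>; \<tau> < t\<rbrakk> \<Longrightarrow> (x has_vector_derivative f \<tau>) (at \<tau>)"
    and "\<And>\<tau>. \<lbrakk>s < \<tau>; \<tau> < t\<rbrakk> \<Longrightarrow> norm (f \<tau>) \<le> M * (c * exp (rate * (\<tau> - s)))"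
  shows "norm (x t - x s) \<le> c / 2 * exp (rate * (t - s))"
proof (cases "s = t")
  case False
  have "norm (x t - x s) \<le> c / 2 * exp (rate * (t - s)) - c / 2 * exp (rate * (s - s))"
  proof (rule differentiable_bound_general[where f' = f and \<phi>' = "\<lambda>\<tau>. c / 2 * (rate * exp (rate * (\<tau> - s)))"])
    show "s < t" using False assms(1) by simp
    fix \<tau> assume \<tau>: "s < \<tau>" "\<tau> < t"
    show "((\<lambda>\<tau>. c / 2 * exp (rate * (\<tau> - s))) has_vector_derivative c / 2 * (rate * exp (rate * (\<tau> - s)))) (at \<tau>)"
      by (auto intro!: derivative_eq_intros simp: has_real_derivative_iff_has_vector_derivative[symmetric])
    have "M * (c * exp (rate * (\<tau> - s))) \<le> rate / 2 * (c * exp (rate * (\<tau> - s)))"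
      using M_le_rate assms(2) by (intro mult_right_mono) auto
    then show "norm (f \<tau>) \<le> c / 2 * (rate * exp (rate * (\<tau> - s)))"
      using assms(5)[OF \<tau>] by (simp add: mult_ac)
  qed (use assms in \<open>auto intro!: continuous_intros\<close>)
  then show ?thesis using assms(2) by simp
qed (use assms in simp)

lemma is_solution_continuous: "is_solution r L s x \<Longrightarrow> s \<le> t \<Longrightarrow> continuous_on {t - r..u} x"
  unfolding is_solution_def by (auto intro: continuous_on_subset)

lemma is_solution_seg_in: "is_solution r L s x \<Longrightarrow> s \<le> t \<Longrightarrow> seg r x t \<in> Cspace r"
  by (rule seg_in_Cspace[OF r is_solution_continuous])

lemma is_solution_deriv_at:
  assumes "is_solution r L s x" "s < t"
  shows "(x has_vector_derivative L t (seg r x t)) (at t)"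
proof -
  have "(x has_vector_derivative L t (seg r x t)) (at t within {s..})"
    using assms unfolding is_solution_def by simp
  moreover have "at t within {s..} = at t"
    using assms(2) by (intro at_within_interior) (simp add: interior_Ici)
  ultimately show ?thesis by simp
qed

definition growth :: "real \<Rightarrow> real" where "growth u = 2 * exp (rate * u)"

lemma growth_pos: "0 < growth u" by (simp add: growth_def)

lemma growth_mono: "u \<le> v \<Longrightarrow> growth u \<le> growth v"
  using rate_pos by (simp add: growth_def)

text \<open>
  Let the weighted norm of \<open>x\<close> on \<open>[s-r,t]\<close> attain its maximum \<open>m\<close> at \<open>t'\<close>. If \<open>t' > s\<close>, the increment of
  \<open>x\<close> from \<open>s\<close> to \<open>t'\<close> accounts for at most \<open>m/2\<close>, which leaves \<open>m \<le> 2 * norm (seg r x s)\<close>.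
\<close>

lemma is_solution_growth:
  assumes x: "is_solution r L s x" and "0 \<le> s" "s \<le> t"
  shows "norm (seg r x t) \<le> growth (t - s) * norm (seg r x s)"
proof -
  define w where "w \<tau> = exp (- rate * max 0 (\<tau> - s)) * norm (x \<tau>)" for \<tau>
  have c: "continuous_on {s - r..t} x" using is_solution_continuous[OF x] by blast
  then have "continuous_on {s - r..t} w" unfolding w_def by (auto intro!: continuous_intros)
  then obtain t' where t': "t' \<in> {s - r..t}" and max: "\<And>\<tau>. \<tau> \<in> {s - r..t} \<Longrightarrow> w \<tau> \<le> w t'"
    using continuous_attains_sup[of "{s - r..t}" w] r assms by force
  define m where "m = w t'"
  have m0: "0 \<le> m" by (simp add: m_def w_def)
  have bound: "norm (seg r x u) \<le> m * exp (rate * (u - s))" if u: "u \<in> {s..t}" for u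
  proof (rule seg_norm_le[OF r])
    show "continuous_on {u - r..u} x" using u by (auto intro: continuous_on_subset[OF c])
    fix \<tau> assume \<tau>: "\<tau> \<in> {u - r..u}"
    have "norm (x \<tau>) = w \<tau> * exp (rate * max 0 (\<tau> - s))"
      by (simp add: w_def exp_minus field_simps)
    also have "\<dots> \<le> m * exp (rate * (u - s))"
      using max[of \<tau>] \<tau> u rate_pos m0 unfolding m_def by (intro mult_mono) auto
    finally show "norm (x \<tau>) \<le> m * exp (rate * (u - s))" .
  qed
  have "m \<le> 2 * norm (seg r x s)"
  proof (cases "t' \<le> s")
    case True
    then have "m = norm (x t')" by (simp add: m_def w_def)
    also have "\<dots> \<le> norm (seg r x s)"
      using True t' assms(3) by (intro norm_le_seg[OF r]) (auto intro: continuous_on_subset[OF c])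
    finally show ?thesis using norm_ge_zero[of "seg r x s"] by linarith
  next
    case False
    have "norm (x t' - x s) \<le> m / 2 * exp (rate * (t' - s))"
    proof (rule weighted_increment_le)
      show "continuous_on {s..t'} x" using t' r by (auto intro: continuous_on_subset[OF c])
      fix \<tau> assume \<tau>: "s < \<tau>" "\<tau> < t'"
      show "(x has_vector_derivative L \<tau> (seg r x \<tau>)) (at \<tau>)" using is_solution_deriv_at[OF x \<tau>(1)] .
      have "norm (L \<tau> (seg r x \<tau>)) \<le> M * norm (seg r x \<tau>)"
        using L_bound is_solution_seg_in[OF x] \<tau> \<open>0 \<le> s\<close> by simp
      also have "\<dots> \<le> M * (m * exp (rate * (\<tau> - s)))"
        using bound[of \<tau>] \<tau> t' M by (intro mult_left_mono) auto
      finally show "norm (L \<tau> (seg r x \<tau>)) \<le> M * (m * exp (rate * (\<tau> - s)))" .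
    qed (use False m0 in auto)
    moreover have "norm (x s) \<le> norm (seg r x s)"
      using r assms by (intro norm_le_seg[OF r]) (auto intro: continuous_on_subset[OF c])
    moreover have "norm (x t') \<le> norm (x t' - x s) + norm (x s)"
      using norm_triangle_ineq[of "x t' - x s" "x s"] by simp
    ultimately have "norm (x t') \<le> norm (seg r x s) + m / 2 * exp (rate * (t' - s))" by linarith
    moreover have "norm (seg r x s) \<le> norm (seg r x s) * exp (rate * (t' - s))"
      using False rate_pos mult_left_mono[of 1 "exp (rate * (t' - s))" "norm (seg r x s)"] by simp
    ultimately have "norm (x t') \<le> (norm (seg r x s) + m / 2) * exp (rate * (t' - s))"
      by (simp add: algebra_simps)
    moreover have "norm (x t') = m * exp (rate * (t' - s))"
      using False by (simp add: m_def w_def exp_minus divide_simps)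
    ultimately show ?thesis by simp
  qed
  then have "m * exp (rate * (t - s)) \<le> 2 * norm (seg r x s) * exp (rate * (t - s))"
    by (intro mult_right_mono) auto
  moreover have "norm (seg r x t) \<le> m * exp (rate * (t - s))"
    using bound[of t] assms(3) by simp
  moreover have "growth (t - s) * norm (seg r x s) = 2 * norm (seg r x s) * exp (rate * (t - s))"
    by (simp add: growth_def)
  ultimately show ?thesis by linarith
qed

lemma is_solution_restrict:
  assumes "is_solution r L s x" "s \<le> u" shows "is_solution r L u x"
  using assms unfolding is_solution_def
  by (auto intro: continuous_on_subset has_vector_derivative_within_subset[of x _ _ "{s..}" "{u..}"])

lemma is_solution_lincomb:
  assumes "is_solution r L s x" "is_solution r L s y" "0 \<le> s"
  shows "is_solution r L s (\<lambda>t. a *\<^sub>R x t + b *\<^sub>R y t)"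
  unfolding is_solution_def
proof (intro conjI allI impI)
  show "continuous_on {s - r..} (\<lambda>t. a *\<^sub>R x t + b *\<^sub>R y t)"
    using assms unfolding is_solution_def by (auto intro!: continuous_intros)
next
  fix t assume t: "s \<le> t"
  have c: "continuous_on {t - r..t} x" "continuous_on {t - r..t} y"
    using is_solution_continuous assms t by blast+
  have X: "seg r x t \<in> Cspace r" "seg r y t \<in> Cspace r"
    using is_solution_seg_in assms t by blast+
  have "L t (seg r (\<lambda>t. a *\<^sub>R x t + b *\<^sub>R y t) t) = a *\<^sub>R L t (seg r x t) + b *\<^sub>R L t (seg r y t)"
    using c X t \<open>0 \<le> s\<close>
    by (simp add: seg_add[OF r] seg_scaleR[OF r] continuous_on_scaleR L_add L_scale subspace_scale[OF subspace_Cspace])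
  then show "((\<lambda>t. a *\<^sub>R x t + b *\<^sub>R y t) has_vector_derivative L t (seg r (\<lambda>t. a *\<^sub>R x t + b *\<^sub>R y t) t)) (at t within {s..})"
    using assms t unfolding is_solution_def by (auto intro!: derivative_eq_intros)
qed

lemma seg_lincomb:
  assumes "is_solution r L s x" "is_solution r L s y" "s \<le> t"
  shows "seg r (\<lambda>t. a *\<^sub>R x t + b *\<^sub>R y t) t = a *\<^sub>R seg r x t + b *\<^sub>R seg r y t"
  using is_solution_continuous assms
  by (simp add: seg_add[OF r] seg_scaleR[OF r] continuous_on_scaleR)

lemma is_solution_unique:
  assumes "is_solution r L s x" "is_solution r L s y" "0 \<le> s" "s \<le> t" "seg r x s = seg r y s"
  shows "seg r x t = seg r y t"
proof -
  have "norm (seg r x t - seg r y t) \<le> growth (t - s) * norm (seg r x s - seg r y s)"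
    using is_solution_growth[OF is_solution_lincomb[OF assms(1-3)] assms(3,4), of 1 "-1"]
      seg_lincomb[OF assms(1,2), of _ 1 "-1"] assms(4) by simp
  then show ?thesis using assms(5) by simp
qed

text \<open>
  The unknown \<open>x = p + e * w\<close> consists of the initial segment \<open>p\<close>, continued by its last value, and a
  correction with growth weight \<open>e\<close> and a bounded continuous factor \<open>w\<close> on the whole line; \<open>w\<close> ranges
  over a complete space, and the integral equation is a contraction in \<open>w\<close>.
\<close>

lemma ex_solution:
  assumes "0 \<le> s" and \<phi>: "\<phi> \<in> Cspace r"
  shows "\<exists>x. is_solution r L s x \<and> seg r x s = \<phi>"
proof -
  define p where "p t = apply_bcontfun \<phi> (t - s)" for t
  define e where "e t = exp (rate * max 0 (t - s))" for t
  define x where "x w t = p t + e t *\<^sub>R apply_bcontfun w t" for w :: "real \<Rightarrow>\<^sub>C (real^'d)" and t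
  define F where "F w t = L t (seg r (x w) t)" for w t
  define J where "J w t = integral {s..t} (F w)" for w t
  have p_cont: "continuous_on A p" for A
    unfolding p_def by (rule continuous_on_compose2[of UNIV]) (auto intro!: continuous_intros)
  have e_cont: "continuous_on A e" for A
    unfolding e_def by (intro continuous_intros)
  have x_cont: "continuous_on A (x w)" for A w
    unfolding x_def by (intro continuous_intros p_cont e_cont) simp
  have F_cont: "continuous_on {s..} (F w)" for w
    unfolding F_def by (rule continuous_on_L_seg[OF assms(1) x_cont])
  have J_deriv: "(J w has_vector_derivative F w t) (at t within {s..})" if "s \<le> t" for w t
    unfolding J_def by (rule integral_has_vector_derivative_atLeast[OF F_cont that])
  have J_cont: "continuous_on {s..} (J w)" for w
    using J_deriv by (auto intro!: continuous_on_vector_derivative)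
  have J_deriv': "(J w has_vector_derivative F w t) (at t)" if "s < t" for w t
    using J_deriv[of t w] that at_within_interior[of t "{s..}"] by (simp add: interior_Ici)
  have Js: "J w s = 0" for w by (simp add: J_def)
  have seg_le: "norm (seg r (\<lambda>\<tau>. e \<tau> *\<^sub>R apply_bcontfun w \<tau>) t) \<le> norm w * exp (rate * (t - s))" if "s \<le> t" for w :: "real \<Rightarrow>\<^sub>C (real^'d)" and t
  proof (rule seg_norm_le[OF r])
    show "continuous_on {t - r..t} (\<lambda>\<tau>. e \<tau> *\<^sub>R apply_bcontfun w \<tau>)"
      by (intro continuous_intros e_cont) simp
    fix \<tau> assume "\<tau> \<in> {t - r..t}"
    then have "e \<tau> \<le> exp (rate * (t - s))" using that rate_pos by (simp add: e_def)
    then have "e \<tau> * norm (apply_bcontfun w \<tau>) \<le> exp (rate * (t - s)) * norm w"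
      by (intro mult_mono norm_bounded) auto
    then show "norm (e \<tau> *\<^sub>R apply_bcontfun w \<tau>) \<le> norm w * exp (rate * (t - s))"
      by (simp add: e_def mult.commute)
  qed
  have J_Lip: "norm (J w1 t - J w2 t) \<le> norm (w1 - w2) / 2 * exp (rate * (t - s))" if "s \<le> t" for w1 w2 t
  proof -
    have "norm ((J w1 t - J w2 t) - (J w1 s - J w2 s)) \<le> norm (w1 - w2) / 2 * exp (rate * (t - s))"
    proof (rule weighted_increment_le[where x = "\<lambda>t. J w1 t - J w2 t"])
      show "continuous_on {s..t} (\<lambda>t. J w1 t - J w2 t)"
        by (intro continuous_intros continuous_on_subset[OF J_cont]) auto
      fix \<tau> assume \<tau>: "s < \<tau>" "\<tau> < t"
      show "((\<lambda>t. J w1 t - J w2 t) has_vector_derivative F w1 \<tau> - F w2 \<tau>) (at \<tau>)"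
        by (intro derivative_intros J_deriv' \<tau>)
      have X: "seg r (x w) \<tau> \<in> Cspace r" for w by (rule seg_in_Cspace[OF r x_cont])
      have "F w1 \<tau> - F w2 \<tau> = L \<tau> (seg r (x w1) \<tau> - seg r (x w2) \<tau>)"
        using L_diff[OF _ X X] \<tau> assms(1) by (simp add: F_def)
      also have "seg r (x w1) \<tau> - seg r (x w2) \<tau> = seg r (\<lambda>t. x w1 t - x w2 t) \<tau>"
        by (rule seg_diff[OF r x_cont x_cont, symmetric])
      also have "\<dots> = seg r (\<lambda>\<tau>. e \<tau> *\<^sub>R apply_bcontfun (w1 - w2) \<tau>) \<tau>"
        by (simp add: x_def algebra_simps)
      finally have "F w1 \<tau> - F w2 \<tau> = L \<tau> (seg r (\<lambda>\<tau>. e \<tau> *\<^sub>R apply_bcontfun (w1 - w2) \<tau>) \<tau>)" .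
      moreover have "continuous_on {\<tau> - r..\<tau>} (\<lambda>\<tau>. e \<tau> *\<^sub>R apply_bcontfun (w1 - w2) \<tau>)"
        by (intro continuous_intros e_cont continuous_on_apply_bcontfun)
      ultimately have "norm (F w1 \<tau> - F w2 \<tau>) \<le> M * norm (seg r (\<lambda>\<tau>. e \<tau> *\<^sub>R apply_bcontfun (w1 - w2) \<tau>) \<tau>)"
        using L_bound[OF _ seg_in_Cspace[OF r], of \<tau> \<tau>] \<tau> assms(1) by (metis less_imp_le order_trans)
      also have "\<dots> \<le> M * (norm (w1 - w2) * exp (rate * (\<tau> - s)))"
        using mult_left_mono[OF seg_le[of \<tau> "w1 - w2"] M] \<tau> by simp
      finally show "norm (F w1 \<tau> - F w2 \<tau>) \<le> M * (norm (w1 - w2) * exp (rate * (\<tau> - s)))" .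
    qed (use that in auto)
    then show ?thesis by (simp add: Js)
  qed
  have F0: "norm (F 0 \<tau>) \<le> M * (norm \<phi> * exp (rate * (\<tau> - s)))" if "s \<le> \<tau>" for \<tau>
  proof -
    have "norm (seg r (x 0) \<tau>) \<le> norm \<phi>"
      by (rule seg_norm_le[OF r x_cont]) (simp add: x_def p_def norm_bounded)
    also have "\<dots> \<le> norm \<phi> * exp (rate * (\<tau> - s))"
      using that rate_pos mult_left_mono[of 1 "exp (rate * (\<tau> - s))" "norm \<phi>"] by simp
    finally have "M * norm (seg r (x 0) \<tau>) \<le> M * (norm \<phi> * exp (rate * (\<tau> - s)))"
      using M by (intro mult_left_mono)
    moreover have "norm (F 0 \<tau>) \<le> M * norm (seg r (x 0) \<tau>)"
      unfolding F_def using that assms(1) by (intro L_bound seg_in_Cspace[OF r x_cont]) auto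
    ultimately show ?thesis by linarith
  qed
  have J0: "norm (J 0 t) \<le> norm \<phi> / 2 * exp (rate * (t - s))" if "s \<le> t" for t
    using weighted_increment_le[of s t "norm \<phi>" "J 0" "F 0"] that F0 J_deriv'
      continuous_on_subset[OF J_cont, of "{s..t}"] by (auto simp: Js)
  define \<Psi> where "\<Psi> w = Bcontfun (\<lambda>t. J w (max s t) /\<^sub>R e t)" for w
  have e_pos: "e t > 0" for t by (simp add: e_def)
  have \<Psi>: "apply_bcontfun (\<Psi> w) t = J w (max s t) /\<^sub>R e t" for w t
  proof -
    have "(\<lambda>t. J w (max s t) /\<^sub>R e t) \<in> bcontfun"
    proof (rule bcontfun_normI)
      have "continuous_on UNIV (\<lambda>t. J w (max s t))"
        by (rule continuous_on_compose2[OF J_cont]) (auto intro!: continuous_intros)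
      moreover have "e t \<noteq> 0" for t using e_pos[of t] by simp
      ultimately show "continuous_on UNIV (\<lambda>t. J w (max s t) /\<^sub>R e t)"
        by (intro continuous_intros e_cont) auto
      fix t
      have "norm (J w (max s t)) \<le> norm (J w (max s t) - J 0 (max s t)) + norm (J 0 (max s t))"
        using norm_triangle_ineq[of "J w (max s t) - J 0 (max s t)" "J 0 (max s t)"] by simp
      also have "\<dots> \<le> (norm w / 2 + norm \<phi> / 2) * e t"
        using J_Lip[of "max s t" w 0] J0[of "max s t"]
        by (auto simp: e_def max_def algebra_simps split: if_splits)
      finally show "norm (J w (max s t) /\<^sub>R e t) \<le> norm w / 2 + norm \<phi> / 2"
        using e_pos[of t] by (simp add: field_simps)
    qed
    then show ?thesis unfolding \<Psi>_def by (simp add: Bcontfun_inverse)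
  qed
  have "\<exists>!w. \<Psi> w = w"
  proof (rule banach_fix_type[of "1/2"], safe)
    fix w1 w2
    show "dist (\<Psi> w1) (\<Psi> w2) \<le> 1/2 * dist w1 w2"
    proof (rule dist_bound)
      fix t
      have "norm (J w1 (max s t) - J w2 (max s t)) \<le> norm (w1 - w2) / 2 * e t"
        using J_Lip[of "max s t" w1 w2] by (auto simp: e_def max_def split: if_splits)
      then show "dist (apply_bcontfun (\<Psi> w1) t) (apply_bcontfun (\<Psi> w2) t) \<le> 1/2 * dist w1 w2"
        using e_pos[of t] unfolding \<Psi> dist_norm scaleR_diff_right[symmetric] norm_scaleR
        by (simp add: field_simps)
    qed
  qed auto
  then obtain w where w: "\<Psi> w = w" by blast
  have xw: "x w t = p t + J w (max s t)" for t
    using \<Psi>[of w t] e_pos[of t] unfolding w x_def by simp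
  have pt: "p t = apply_bcontfun \<phi> 0" if "s \<le> t" for t
  proof -
    have "clamp (- r) 0 (t - s) = 0"
      using that r by (auto simp: clamp_def sum.neutral)
    then show ?thesis using \<phi> unfolding p_def Cspace_iff_clamp by metis
  qed
  have "is_solution r L s (x w)"
    unfolding is_solution_def
  proof (intro conjI x_cont allI impI)
    fix t assume t: "s \<le> t"
    have "((\<lambda>t. apply_bcontfun \<phi> 0 + J w t) has_vector_derivative F w t) (at t within {s..})"
      using J_deriv[OF t] by (auto intro!: derivative_eq_intros)
    then show "(x w has_vector_derivative L t (seg r (x w) t)) (at t within {s..})"
      unfolding F_def
      by (rule has_vector_derivative_transform[rotated 2]) (use t in \<open>auto simp: xw pt max_def\<close>)
  qed
  moreover have "seg r (x w) s = \<phi>"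
    by (rule Cspace_eqI[OF r seg_in_Cspace[OF r x_cont] \<phi>]) (simp add: seg_apply[OF r x_cont] xw p_def max.absorb1 Js)
  ultimately show ?thesis by blast
qed

abbreviation T :: "real \<Rightarrow> real \<Rightarrow> (real \<Rightarrow>\<^sub>C (real^'d)) \<Rightarrow> (real \<Rightarrow>\<^sub>C (real^'d))" where
  "T \<equiv> solution_op r L"

lemma T_eq:
  assumes "is_solution r L s x" "0 \<le> s" "s \<le> t"
  shows "T t s (seg r x s) = seg r x t"
  unfolding solution_op_def
  by (rule the_equality) (use is_solution_unique assms in blast)+

lemma solution_through:
  assumes "0 \<le> s" "\<phi> \<in> Cspace r"
  obtains x where "is_solution r L s x" "seg r x s = \<phi>" "\<And>t. s \<le> t \<Longrightarrow> T t s \<phi> = seg r x t"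
  using ex_solution[OF assms] T_eq assms(1) by metis

context
  fixes s :: real
  assumes s: "0 \<le> s"
begin

lemma T_in [intro]: "s \<le> t \<Longrightarrow> \<phi> \<in> Cspace r \<Longrightarrow> T t s \<phi> \<in> Cspace r"
  by (metis s solution_through is_solution_seg_in)

lemma T_refl: "\<phi> \<in> Cspace r \<Longrightarrow> T s s \<phi> = \<phi>"
  by (metis s solution_through order_refl)

lemma T_bound: "s \<le> t \<Longrightarrow> \<phi> \<in> Cspace r \<Longrightarrow> norm (T t s \<phi>) \<le> growth (t - s) * norm \<phi>"
  by (metis s solution_through is_solution_growth)

lemma T_lincomb:
  assumes "s \<le> t" "\<phi> \<in> Cspace r" "\<psi> \<in> Cspace r"
  shows "T t s (a *\<^sub>R \<phi> + b *\<^sub>R \<psi>) = a *\<^sub>R T t s \<phi> + b *\<^sub>R T t s \<psi>"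
proof -
  obtain x where x: "is_solution r L s x" "seg r x s = \<phi>" "\<And>t. s \<le> t \<Longrightarrow> T t s \<phi> = seg r x t"
    using solution_through[OF s assms(2)] by blast
  obtain y where y: "is_solution r L s y" "seg r y s = \<psi>" "\<And>t. s \<le> t \<Longrightarrow> T t s \<psi> = seg r y t"
    using solution_through[OF s assms(3)] by blast
  show ?thesis
    using T_eq[OF is_solution_lincomb[OF x(1) y(1) s] s assms(1), of a b]
    by (simp add: seg_lincomb[OF x(1) y(1)] x y assms)
qed

lemma T_add: "s \<le> t \<Longrightarrow> \<phi> \<in> Cspace r \<Longrightarrow> \<psi> \<in> Cspace r \<Longrightarrow> T t s (\<phi> + \<psi>) = T t s \<phi> + T t s \<psi>"
  using T_lincomb[of t \<phi> \<psi> 1 1] by simp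

lemma T_diff: "s \<le> t \<Longrightarrow> \<phi> \<in> Cspace r \<Longrightarrow> \<psi> \<in> Cspace r \<Longrightarrow> T t s (\<phi> - \<psi>) = T t s \<phi> - T t s \<psi>"
  using T_lincomb[of t \<phi> \<psi> 1 "-1"] by simp

lemma T_scale: "s \<le> t \<Longrightarrow> \<phi> \<in> Cspace r \<Longrightarrow> T t s (c *\<^sub>R \<phi>) = c *\<^sub>R T t s \<phi>"
  using T_lincomb[of t \<phi> \<phi> c 0] by simp

lemma T_comp: "s \<le> u \<Longrightarrow> u \<le> t \<Longrightarrow> \<phi> \<in> Cspace r \<Longrightarrow> T t u (T u s \<phi>) = T t s \<phi>"
  by (smt (verit) s solution_through T_eq is_solution_restrict)

end

end

section \<open>Complements of the space of bounded orbits\<close>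

definition bdd_orbit :: "('i \<Rightarrow> 'v \<Rightarrow> 'w::real_normed_vector) \<Rightarrow> 'i set \<Rightarrow> real \<Rightarrow> 'v \<Rightarrow> bool" where
  "bdd_orbit A I c v \<longleftrightarrow> (\<forall>i\<in>I. norm (A i v) \<le> c)"

text \<open>
  For a family of bounded operators \<open>A i\<close>, the vectors with a bounded orbit form a subspace
  whose natural norm, the supremum of the orbit, may be stronger than the given one. A complement of
  this subspace with a \<^emph>\<open>bounded\<close> projection is therefore obtained only together with quantitative
  information: the orbit bounds are carried along in every step.
\<close>

locale operator_family =
  fixes X :: "'v::real_normed_vector set" and A :: "'i \<Rightarrow> 'v \<Rightarrow> 'w::real_normed_vector" and I :: "'i set"
  assumes X: "subspace X"
    and A_add: "\<And>i u v. \<lbrakk>i \<in> I; u \<in> X; v \<in> X\<rbrakk> \<Longrightarrow> A i (u + v) = A i u + A i v"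
    and A_scale: "\<And>i c v. \<lbrakk>i \<in> I; v \<in> X\<rbrakk> \<Longrightarrow> A i (c *\<^sub>R v) = c *\<^sub>R A i v"
    and A_bound: "\<And>i. i \<in> I \<Longrightarrow> \<exists>K. \<forall>v\<in>X. norm (A i v) \<le> K * norm v"
begin

abbreviation bnd where "bnd \<equiv> bdd_orbit A I"

lemma X_simps: "0 \<in> X" "\<And>u v. u \<in> X \<Longrightarrow> v \<in> X \<Longrightarrow> u + v \<in> X" "\<And>u v. u \<in> X \<Longrightarrow> v \<in> X \<Longrightarrow> u - v \<in> X"
  "\<And>c v. v \<in> X \<Longrightarrow> c *\<^sub>R v \<in> X"
  using X by (auto simp: subspace_0 subspace_add subspace_diff subspace_scale)

lemma lincomb_in_X: "W \<subseteq> X \<Longrightarrow> (\<Sum>w\<in>W. d w *\<^sub>R w) \<in> X"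
  by (intro subspace_sum[OF X] subspace_scale[OF X]) auto

lemma bnd_add: "bnd a u \<Longrightarrow> bnd b v \<Longrightarrow> u \<in> X \<Longrightarrow> v \<in> X \<Longrightarrow> bnd (a + b) (u + v)"
  unfolding bdd_orbit_def by (auto simp: A_add intro: norm_triangle_mono)

lemma bnd_scale: "bnd a v \<Longrightarrow> v \<in> X \<Longrightarrow> bnd (\<bar>c\<bar> * a) (c *\<^sub>R v)"
  unfolding bdd_orbit_def by (auto simp: A_scale intro: mult_left_mono)

lemma bnd_diff: "bnd a u \<Longrightarrow> bnd b v \<Longrightarrow> u \<in> X \<Longrightarrow> v \<in> X \<Longrightarrow> bnd (a + b) (u - v)"
  using bnd_add[of a u b "(-1) *\<^sub>R v"] bnd_scale[of b v "-1"] X_simps(4)[of v "-1"] by simp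

lemma bnd_mono: "bnd a v \<Longrightarrow> a \<le> b \<Longrightarrow> bnd b v"
  unfolding bdd_orbit_def by force

lemma bnd_0: "0 \<le> c \<Longrightarrow> bnd c 0"
  unfolding bdd_orbit_def using A_scale[of _ 0 0] X_simps(1) by simp

text \<open>
  The finite set \<open>W\<close> spans the space modulo the vectors with bounded orbit, with control of both the
  coefficients and the orbit of the remainder.
\<close>

definition spanning :: "'v set \<Rightarrow> real \<Rightarrow> bool" where
  "spanning W k \<longleftrightarrow> finite W \<and> W \<subseteq> X \<and> 0 \<le> k \<and>
     (\<forall>v\<in>X. \<exists>d. (\<forall>w\<in>W. \<bar>d w\<bar> \<le> k * norm v) \<and> bnd (k * norm v) (v - (\<Sum>w\<in>W. d w *\<^sub>R w)))"

lemma spanningI: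
  assumes "finite W" "W \<subseteq> X" "0 \<le> k"
    and "\<And>v. v \<in> X \<Longrightarrow> norm v \<le> 1 \<Longrightarrow> \<exists>d. (\<forall>w\<in>W. \<bar>d w\<bar> \<le> k) \<and> bnd k (v - (\<Sum>w\<in>W. d w *\<^sub>R w))"
  shows "spanning W k"
  unfolding spanning_def
proof (intro conjI ballI assms)
  fix v assume v: "v \<in> X"
  show "\<exists>d. (\<forall>w\<in>W. \<bar>d w\<bar> \<le> k * norm v) \<and> bnd (k * norm v) (v - (\<Sum>w\<in>W. d w *\<^sub>R w))"
  proof (cases "v = 0")
    case True
    then show ?thesis by (intro exI[of _ "\<lambda>_. 0"]) (simp add: bnd_0)
  next
    case False
    obtain d where d: "\<And>w. w \<in> W \<Longrightarrow> \<bar>d w\<bar> \<le> k" "bnd k (v /\<^sub>R norm v - (\<Sum>w\<in>W. d w *\<^sub>R w))"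
      using assms(4)[of "v /\<^sub>R norm v"] v False X_simps(4) by auto
    have "bnd (\<bar>norm v\<bar> * k) (norm v *\<^sub>R (v /\<^sub>R norm v - (\<Sum>w\<in>W. d w *\<^sub>R w)))"
      by (intro bnd_scale d X_simps v lincomb_in_X assms)
    also have "norm v *\<^sub>R (v /\<^sub>R norm v - (\<Sum>w\<in>W. d w *\<^sub>R w)) = v - (\<Sum>w\<in>W. (norm v * d w) *\<^sub>R w)"
      using False by (simp add: scaleR_diff_right scaleR_sum_right)
    finally show ?thesis
      using d(1) by (intro exI[of _ "\<lambda>w. norm v * d w"]) (auto simp: abs_mult mult.commute[of k] intro: mult_left_mono)
  qed
qed

text \<open>
  Write \<open>v = w + a + v'\<close> with \<open>norm v' \<le> 1/2\<close>, rescale \<open>v'\<close> to the unit ball and repeat. The coefficients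
  and orbit bounds collected in this way are dominated by geometric series, and the remainder
  tends to \<open>0\<close>, also after application of any single operator \<open>A i\<close>.
\<close>

lemma spanning_of_net:
  assumes W: "finite W" "W \<subseteq> X" and c: "0 \<le> c"
    and net: "\<And>v. v \<in> X \<Longrightarrow> norm v \<le> 1 \<Longrightarrow> \<exists>w\<in>W. \<exists>a\<in>X. bnd c a \<and> norm (v - w - a) \<le> 1 / 2"
  shows "spanning W (2 * c + 2)"
proof (rule spanningI[OF W])
  fix v0 assume v0: "v0 \<in> X" "norm v0 \<le> 1"
  obtain w a where wa: "\<And>v. v \<in> X \<Longrightarrow> norm v \<le> 1 \<Longrightarrow> w v \<in> W \<and> a v \<in> X \<and> bnd c (a v) \<and> norm (v - w v - a v) \<le> 1 / 2"
    using net by metis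
  define v where "v = rec_nat v0 (\<lambda>_ u. 2 *\<^sub>R (u - w u - a u))"
  have v_simps: "v 0 = v0" "v (Suc n) = 2 *\<^sub>R (v n - w (v n) - a (v n))" for n
    by (simp_all add: v_def)
  have v: "v n \<in> X \<and> norm (v n) \<le> 1" for n
  proof (induction n)
    case (Suc n)
    then show ?case using wa[of "v n"] W by (auto simp: v_simps intro!: X_simps)
  qed (use v0 in \<open>simp add: v_simps\<close>)
  note wan = wa[OF conjunct1[OF v] conjunct2[OF v]]
  \<comment> \<open>\<open>b u k\<close> is the contribution of the step \<open>k\<close> to the coefficient of \<open>u\<close>\<close>
  define b where "b u k = (if w (v k) = u then (1 / 2) ^ k else 0 :: real)" for u k
  have b_le: "norm (b u k) \<le> (1 / 2) ^ k" and b0: "0 \<le> b u k" for u k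
    by (auto simp: b_def)
  have b_summable: "summable (b u)" for u
    by (rule summable_comparison_test'[OF summable_geometric b_le]) simp
  define D where "D u n = (\<Sum>k<n. b u k)" for u n
  have rep: "\<exists>a\<in>X. bnd (2 * c * (1 - (1 / 2) ^ n)) a \<and> v0 = (\<Sum>u\<in>W. D u n *\<^sub>R u) + a + (1 / 2) ^ n *\<^sub>R v n" for n
  proof (induction n)
    case 0
    then show ?case by (intro bexI[of _ 0]) (auto simp: D_def v_simps bnd_0 X_simps)
  next
    case (Suc n)
    then obtain a' where a': "a' \<in> X" "bnd (2 * c * (1 - (1 / 2) ^ n)) a'"
      "v0 = (\<Sum>u\<in>W. D u n *\<^sub>R u) + a' + (1 / 2) ^ n *\<^sub>R v n" by blast
    have "(\<Sum>u\<in>W. b u n *\<^sub>R u) = (\<Sum>u\<in>W. if u = w (v n) then (1 / 2) ^ n *\<^sub>R u else 0)"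
      by (intro sum.cong) (auto simp: b_def)
    also have "\<dots> = (1 / 2) ^ n *\<^sub>R w (v n)"
      using wan[of n] W(1) by (simp add: sum.delta')
    finally have 1: "(\<Sum>u\<in>W. D u (Suc n) *\<^sub>R u) = (\<Sum>u\<in>W. D u n *\<^sub>R u) + (1 / 2) ^ n *\<^sub>R w (v n)"
      by (simp add: D_def scaleR_add_left sum.distrib)
    have half: "(1 / 2) ^ Suc n *\<^sub>R v (Suc n) = (1 / 2) ^ n *\<^sub>R (v n - w (v n) - a (v n))"
      unfolding v_simps(2) scaleR_scaleR by simp
    have "(1 / 2) ^ n *\<^sub>R v n = (1 / 2) ^ n *\<^sub>R w (v n) + (1 / 2) ^ n *\<^sub>R a (v n) + (1 / 2) ^ Suc n *\<^sub>R v (Suc n)"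
      unfolding half by (simp add: scaleR_diff_right)
    then have "v0 = (\<Sum>u\<in>W. D u (Suc n) *\<^sub>R u) + (a' + (1 / 2) ^ n *\<^sub>R a (v n)) + (1 / 2) ^ Suc n *\<^sub>R v (Suc n)"
      using a'(3) 1 by (simp add: add_ac)
    moreover have "bnd (2 * c * (1 - (1 / 2) ^ n) + \<bar>(1 / 2) ^ n\<bar> * c) (a' + (1 / 2) ^ n *\<^sub>R a (v n))"
      using wan[of n] a' by (intro bnd_add bnd_scale X_simps) auto
    then have "bnd (2 * c * (1 - (1 / 2) ^ Suc n)) (a' + (1 / 2) ^ n *\<^sub>R a (v n))"
      by (rule bnd_mono) (simp add: algebra_simps)
    moreover have "a' + (1 / 2) ^ n *\<^sub>R a (v n) \<in> X" using wan[of n] a' by (intro X_simps) auto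
    ultimately show ?case by blast
  qed
  define d where "d u = suminf (b u)" for u
  have D_lim: "(\<lambda>n. D u n) \<longlonglongrightarrow> d u" for u
    unfolding D_def d_def using b_summable by (rule summable_LIMSEQ)
  have d_le: "\<bar>d u\<bar> \<le> 2 * c + 2" for u
  proof -
    have "0 \<le> d u" unfolding d_def by (rule suminf_nonneg[OF b_summable b0])
    moreover have "d u \<le> (\<Sum>k. (1 / 2) ^ k)"
      unfolding d_def by (rule suminf_le[OF _ b_summable summable_geometric]) (auto simp: b_def)
    moreover have "(\<Sum>k. (1 / 2 :: real) ^ k) = 2" by (simp add: suminf_geometric)
    ultimately show ?thesis using c by linarith
  qed
  have "bnd (2 * c + 2) (v0 - (\<Sum>u\<in>W. d u *\<^sub>R u))"
    unfolding bdd_orbit_def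
  proof
    fix i assume i: "i \<in> I"
    obtain K where K: "\<And>v. v \<in> X \<Longrightarrow> norm (A i v) \<le> K * norm v" using A_bound[OF i] by blast
    define s where "s n = v0 - (\<Sum>u\<in>W. D u n *\<^sub>R u) - (1 / 2) ^ n *\<^sub>R v n" for n
    have sX: "s n \<in> X" for n unfolding s_def using v v0 by (intro X_simps lincomb_in_X W) auto
    have dX: "v0 - (\<Sum>u\<in>W. d u *\<^sub>R u) \<in> X" using v0 by (intro X_simps lincomb_in_X W)
    have A_diff: "A i (u - w) = A i u - A i w" if "u \<in> X" "w \<in> X" for u w
      using A_add[OF i that(1), of "(-1) *\<^sub>R w"] A_scale[OF i that(2), of "-1"] X_simps(4)[OF that(2), of "-1"] by simp
    have s_bound: "norm (A i (s n)) \<le> 2 * c" for n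
    proof -
      obtain a where a: "a \<in> X" "bnd (2 * c * (1 - (1 / 2) ^ n)) a" "v0 = (\<Sum>u\<in>W. D u n *\<^sub>R u) + a + (1 / 2) ^ n *\<^sub>R v n"
        using rep by blast
      have "s n = a" using a(3) by (simp add: s_def)
      moreover have "2 * c * (1 - (1 / 2) ^ n) \<le> 2 * c * 1" using c by (intro mult_left_mono) auto
      ultimately show ?thesis using a(2) i unfolding bdd_orbit_def by force
    qed
    have "(\<lambda>n. (1 / 2) ^ n *\<^sub>R v n) \<longlonglongrightarrow> 0"
    proof (rule tendsto_norm_zero_cancel, rule tendsto_sandwich[OF _ _ tendsto_const])
      show "(\<lambda>n. (1 / 2 :: real) ^ n) \<longlonglongrightarrow> 0" by (rule LIMSEQ_power_zero) simp
      show "\<forall>\<^sub>F n in sequentially. norm ((1 / 2) ^ n *\<^sub>R v n) \<le> (1 / 2) ^ n"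
        using v by (intro always_eventually) (auto intro: mult_left_le)
    qed simp
    then have "s \<longlonglongrightarrow> v0 - (\<Sum>u\<in>W. d u *\<^sub>R u) - 0"
      unfolding s_def by (intro tendsto_diff tendsto_const tendsto_sum tendsto_scaleR D_lim)
    then have "(\<lambda>n. norm (s n - (v0 - (\<Sum>u\<in>W. d u *\<^sub>R u)))) \<longlonglongrightarrow> 0"
      by (intro tendsto_norm_zero) (simp add: LIM_zero)
    then have lim: "(\<lambda>n. 2 * c + K * norm (s n - (v0 - (\<Sum>u\<in>W. d u *\<^sub>R u)))) \<longlonglongrightarrow> 2 * c + K * 0"
      by (intro tendsto_intros)
    have "norm (A i (v0 - (\<Sum>u\<in>W. d u *\<^sub>R u))) \<le> 2 * c + K * norm (s n - (v0 - (\<Sum>u\<in>W. d u *\<^sub>R u)))" for n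
    proof -
      have "norm (A i (s n) - A i (v0 - (\<Sum>u\<in>W. d u *\<^sub>R u))) \<le> K * norm (s n - (v0 - (\<Sum>u\<in>W. d u *\<^sub>R u)))"
        using K[of "s n - (v0 - (\<Sum>u\<in>W. d u *\<^sub>R u))"] A_diff[OF sX dX] X_simps(3)[OF sX dX] by simp
      then show ?thesis using s_bound[of n] norm_triangle_ineq2[of "A i (v0 - (\<Sum>u\<in>W. d u *\<^sub>R u))" "A i (s n)"]
        by (simp add: norm_minus_commute)
    qed
    then have "norm (A i (v0 - (\<Sum>u\<in>W. d u *\<^sub>R u))) \<le> 2 * c + K * 0"
      by (intro LIMSEQ_le_const[OF lim]) auto
    then show "norm (A i (v0 - (\<Sum>u\<in>W. d u *\<^sub>R u))) \<le> 2 * c + 2" by simp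
  qed
  then show "\<exists>d. (\<forall>w\<in>W. \<bar>d w\<bar> \<le> 2 * c + 2) \<and> bnd (2 * c + 2) (v0 - (\<Sum>w\<in>W. d w *\<^sub>R w))"
    using d_le by blast
qed (use c in auto)

text \<open>
  A nontrivial combination of \<open>W\<close> with a bounded orbit makes one of its members redundant: it is
  replaced by the others, at the cost of a larger constant.
\<close>

lemma spanning_remove:
  assumes sp: "spanning W k" and w0: "w0 \<in> W" "d0 w0 \<noteq> 0"
    and rel: "bnd b (\<Sum>w\<in>W. d0 w *\<^sub>R w)"
  shows "\<exists>k'. spanning (W - {w0}) k'"
proof -
  have W: "finite W" "W \<subseteq> X" "0 \<le> k" using sp by (auto simp: spanning_def)
  define e where "e w = d0 w / d0 w0" for w
  define B where "B = \<bar>b\<bar> / \<bar>d0 w0\<bar>"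
  have B0: "0 \<le> B" by (simp add: B_def)
  define E where "E = (\<Sum>w\<in>W. \<bar>e w\<bar>)"
  have E: "\<bar>e w\<bar> \<le> E" "0 \<le> E" if "w \<in> W" for w
    using that W by (auto simp: E_def intro!: member_le_sum sum_nonneg)
  have E0: "0 \<le> E" by (simp add: E_def sum_nonneg)
  have relX: "(\<Sum>w\<in>W. e w *\<^sub>R w) \<in> X" by (rule lincomb_in_X[OF W(2)])
  have "bnd (\<bar>1 / d0 w0\<bar> * \<bar>b\<bar>) ((1 / d0 w0) *\<^sub>R (\<Sum>w\<in>W. d0 w *\<^sub>R w))"
    by (intro bnd_scale lincomb_in_X W bnd_mono[OF rel]) auto
  then have rel': "bnd B (\<Sum>w\<in>W. e w *\<^sub>R w)" by (simp add: B_def e_def scaleR_sum_right)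
  have "spanning (W - {w0}) (k + k * E + k * B)"
  proof (rule spanningI)
    show "0 \<le> k + k * E + k * B" using W(3) E0 by (simp add: B_def)
    fix v assume v: "v \<in> X" "norm v \<le> 1"
    obtain d where d: "\<And>w. w \<in> W \<Longrightarrow> \<bar>d w\<bar> \<le> k * norm v" "bnd (k * norm v) (v - (\<Sum>w\<in>W. d w *\<^sub>R w))"
      using sp v unfolding spanning_def by blast
    have kv: "k * norm v \<le> k" using W(3) v by (simp add: mult_left_le)
    define d' where "d' w = d w - d w0 * e w" for w
    have d'0: "d' w0 = 0" using w0 by (simp add: d'_def e_def)
    have "(\<Sum>w\<in>W - {w0}. d' w *\<^sub>R w) = (\<Sum>w\<in>W. d' w *\<^sub>R w)"
      using W(1) w0(1) d'0 by (simp add: sum.remove)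
    also have "\<dots> = (\<Sum>w\<in>W. d w *\<^sub>R w) - d w0 *\<^sub>R (\<Sum>w\<in>W. e w *\<^sub>R w)"
      by (simp add: d'_def scaleR_diff_left sum_subtractf scaleR_sum_right)
    finally have eq: "v - (\<Sum>w\<in>W - {w0}. d' w *\<^sub>R w) = (v - (\<Sum>w\<in>W. d w *\<^sub>R w)) + d w0 *\<^sub>R (\<Sum>w\<in>W. e w *\<^sub>R w)"
      by simp
    have dw0: "\<bar>d w0\<bar> \<le> k" using d(1)[OF w0(1)] kv by simp
    have "bnd (k * norm v + \<bar>d w0\<bar> * B) (v - (\<Sum>w\<in>W - {w0}. d' w *\<^sub>R w))"
      unfolding eq by (intro bnd_add bnd_scale d rel' X_simps v lincomb_in_X W relX)
    moreover have "k * norm v + \<bar>d w0\<bar> * B \<le> k + k * E + k * B"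
      using kv mult_right_mono[OF dw0, of B] mult_nonneg_nonneg[OF W(3) E0] B0 by linarith
    ultimately have 1: "bnd (k + k * E + k * B) (v - (\<Sum>w\<in>W - {w0}. d' w *\<^sub>R w))" by (rule bnd_mono)
    have 2: "\<bar>d' w\<bar> \<le> k + k * E + k * B" if "w \<in> W" for w
    proof -
      have "\<bar>d' w\<bar> \<le> \<bar>d w\<bar> + \<bar>d w0\<bar> * \<bar>e w\<bar>"
        unfolding d'_def abs_mult[symmetric] by (rule abs_triangle_ineq4)
      also have "\<dots> \<le> k + k * E"
        using d(1)[OF that] kv dw0 E(1)[OF that] W(3) by (intro add_mono mult_mono) auto
      also have "\<dots> \<le> k + k * E + k * B" using W(3) by (simp add: B_def)
      finally show ?thesis .
    qed
    show "\<exists>d. (\<forall>w\<in>W - {w0}. \<bar>d w\<bar> \<le> k + k * E + k * B) \<and> bnd (k + k * E + k * B) (v - (\<Sum>w\<in>W - {w0}. d w *\<^sub>R w))"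
      using 1 2 by blast
  qed (use W in auto)
  then show ?thesis by blast
qed

lemma spanning_minimal:
  assumes "spanning W0 k0"
  shows "\<exists>W k. spanning W k \<and> (\<forall>d b. bnd b (\<Sum>w\<in>W. d w *\<^sub>R w) \<longrightarrow> (\<forall>w\<in>W. d w = 0))"
proof -
  obtain W where W: "\<exists>k. spanning W k" and min: "\<And>W'. \<exists>k. spanning W' k \<Longrightarrow> card W \<le> card W'"
    using ex_has_least_nat[of "\<lambda>W. \<exists>k. spanning W k" W0 card] assms by blast
  have "d w = 0" if "bnd b (\<Sum>w\<in>W. d w *\<^sub>R w)" "w \<in> W" for d b w
  proof (rule ccontr)
    assume "d w \<noteq> 0"
    then have "card W \<le> card (W - {w})" using spanning_remove that W min by blast
    moreover have "card (W - {w}) < card W"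
      using W that(2) by (intro card_Diff1_less) (auto simp: spanning_def)
    ultimately show False by simp
  qed
  then show ?thesis using W by blast
qed

text \<open>
  For a spanning set without such redundancy the coefficients of a vector are unique. This makes
  them linear in the vector, and bounded, since some choice of them is bounded by definition.
\<close>

theorem complement_of_spanning:
  assumes "spanning W0 k0"
  shows "\<exists>Q K. 0 \<le> K \<and> (\<forall>v\<in>X. Q v \<in> X \<and> norm (Q v) \<le> K * norm v \<and> bnd (K * norm v) (v - Q v)) \<and>
    (\<forall>u\<in>X. \<forall>v\<in>X. \<forall>a b. Q (a *\<^sub>R u + b *\<^sub>R v) = a *\<^sub>R Q u + b *\<^sub>R Q v) \<and>
    (\<forall>v\<in>X. \<forall>b. bnd b v \<longrightarrow> Q v = 0)"
proof -
  obtain W k where sp: "spanning W k"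
    and ind: "\<And>d b w. bnd b (\<Sum>w\<in>W. d w *\<^sub>R w) \<Longrightarrow> w \<in> W \<Longrightarrow> d w = 0"
    using spanning_minimal[OF assms] by blast
  have W: "finite W" "W \<subseteq> X" "0 \<le> k" using sp by (auto simp: spanning_def)
  have "\<forall>v. \<exists>d. v \<in> X \<longrightarrow> (\<forall>w\<in>W. \<bar>d w\<bar> \<le> k * norm v) \<and> bnd (k * norm v) (v - (\<Sum>w\<in>W. d w *\<^sub>R w))"
    using sp unfolding spanning_def by blast
  then obtain d where d: "\<And>v w. v \<in> X \<Longrightarrow> w \<in> W \<Longrightarrow> \<bar>d v w\<bar> \<le> k * norm v"
    "\<And>v. v \<in> X \<Longrightarrow> bnd (k * norm v) (v - (\<Sum>w\<in>W. d v w *\<^sub>R w))"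
    by metis
  define Q where "Q v = (\<Sum>w\<in>W. d v w *\<^sub>R w)" for v
  have QX: "Q v \<in> X" for v unfolding Q_def by (rule lincomb_in_X[OF W(2)])
  have Q_unique: "Q v = (\<Sum>w\<in>W. e w *\<^sub>R w)" if "v \<in> X" "bnd b (v - (\<Sum>w\<in>W. e w *\<^sub>R w))" for v e b
  proof -
    have "bnd (b + k * norm v) ((v - (\<Sum>w\<in>W. e w *\<^sub>R w)) - (v - (\<Sum>w\<in>W. d v w *\<^sub>R w)))"
      by (intro bnd_diff that d X_simps lincomb_in_X W)
    moreover have "(v - (\<Sum>w\<in>W. e w *\<^sub>R w)) - (v - (\<Sum>w\<in>W. d v w *\<^sub>R w)) = (\<Sum>w\<in>W. (d v w - e w) *\<^sub>R w)"
      by (simp add: scaleR_diff_left sum_subtractf)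
    ultimately have "d v w = e w" if "w \<in> W" for w
      using ind[of _ "\<lambda>w. d v w - e w" w] that by auto
    then show ?thesis unfolding Q_def by (intro sum.cong) auto
  qed
  have Q_lin: "Q (a *\<^sub>R u + b *\<^sub>R v) = a *\<^sub>R Q u + b *\<^sub>R Q v" if "u \<in> X" "v \<in> X" for u v a b
  proof -
    have eq: "(\<Sum>w\<in>W. (a * d u w + b * d v w) *\<^sub>R w) = a *\<^sub>R Q u + b *\<^sub>R Q v"
      by (simp add: Q_def scaleR_add_left sum.distrib scaleR_sum_right)
    have "bnd (\<bar>a\<bar> * (k * norm u) + \<bar>b\<bar> * (k * norm v)) (a *\<^sub>R (u - Q u) + b *\<^sub>R (v - Q v))"
      unfolding Q_def by (intro bnd_add bnd_scale d that X_simps lincomb_in_X W)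
    also have "a *\<^sub>R (u - Q u) + b *\<^sub>R (v - Q v) = (a *\<^sub>R u + b *\<^sub>R v) - (\<Sum>w\<in>W. (a * d u w + b * d v w) *\<^sub>R w)"
      unfolding eq by (simp add: algebra_simps)
    finally have "Q (a *\<^sub>R u + b *\<^sub>R v) = (\<Sum>w\<in>W. (a * d u w + b * d v w) *\<^sub>R w)"
      using that by (intro Q_unique X_simps)
    then show ?thesis unfolding eq .
  qed
  have Q0: "Q v = 0" if "v \<in> X" "bnd b v" for v b
    using Q_unique[of v b "\<lambda>_. 0"] that by simp
  define K where "K = k + k * (\<Sum>w\<in>W. norm w)"
  have K: "0 \<le> K" "k \<le> K" using W(3) by (auto simp: K_def sum_nonneg)
  have "norm (Q v) \<le> K * norm v" if "v \<in> X" for v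
  proof -
    have "norm (Q v) \<le> (\<Sum>w\<in>W. \<bar>d v w\<bar> * norm w)"
      unfolding Q_def by (rule order_trans[OF norm_sum]) simp
    also have "\<dots> \<le> (\<Sum>w\<in>W. (k * norm v) * norm w)"
      using d(1)[OF that] by (intro sum_mono mult_right_mono) auto
    also have "\<dots> \<le> K * norm v"
      using W(3) by (simp add: K_def algebra_simps sum_distrib_left)
    finally show ?thesis .
  qed
  moreover have "bnd (K * norm v) (v - Q v)" if "v \<in> X" for v
    unfolding Q_def by (rule bnd_mono[OF d(2)[OF that]]) (use K(2) in \<open>auto intro: mult_right_mono\<close>)
  ultimately show ?thesis
    using K(1) Q_lin Q0 QX by (intro exI[of _ Q] exI[of _ K]) blast
qed

end

section \<open>Slowly modulated solutions and their shadows\<close>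

text \<open>
  A \<open>C\<^sup>1\<close> function that rises from \<open>0\<close> (for \<open>t \<le> 0\<close>) to \<open>n\<close> (for \<open>t \<ge> n + 1\<close>) with slope at most \<open>1\<close>. It is
  continuously differentiable because its derivative \<open>ramp'\<close> is a trapezoid with edges on \<open>[0,1]\<close> and
  \<open>[n,n+1]\<close>; perturbations of solutions have to be \<open>C\<^sup>1\<close> to be shadowed.
\<close>

definition ramp :: "real \<Rightarrow> real \<Rightarrow> real" where
  "ramp n t = ((max 0 t)\<^sup>2 - (max 0 (t - 1))\<^sup>2 - (max 0 (t - n))\<^sup>2 + (max 0 (t - n - 1))\<^sup>2) / 2"

definition ramp' :: "real \<Rightarrow> real \<Rightarrow> real" where
  "ramp' n t = max 0 t - max 0 (t - 1) - max 0 (t - n) + max 0 (t - n - 1)"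

lemma DERIV_max0_square: "((\<lambda>x::real. (max 0 x)\<^sup>2 / 2) has_real_derivative max 0 x) (at x)"
proof -
  \<comment> \<open>the only delicate point is \<open>x = 0\<close>; a quadratic remainder estimate treats all points alike\<close>
  have bound: "\<bar>(max 0 y)\<^sup>2 / 2 - (max 0 x)\<^sup>2 / 2 - max 0 x * (y - x)\<bar> \<le> (y - x)\<^sup>2 / 2" for y
  proof -
    consider "0 \<le> x" "0 \<le> y" | "0 \<le> x" "y < 0" | "x < 0" "0 \<le> y" | "x < 0" "y < 0" by linarith
    then show ?thesis
    proof cases
      case 1
      then have eq: "(max 0 y)\<^sup>2 / 2 - (max 0 x)\<^sup>2 / 2 - max 0 x * (y - x) = (y - x)\<^sup>2 / 2"
        by (simp add: power2_eq_square field_simps)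
      show ?thesis unfolding eq by simp
    next
      case 2
      then have "x * y \<le> 0" by (simp add: mult_nonneg_nonpos)
      moreover have "(max 0 y)\<^sup>2 / 2 - (max 0 x)\<^sup>2 / 2 - max 0 x * (y - x) = x * x / 2 - x * y"
        "(y - x)\<^sup>2 / 2 = x * x / 2 - x * y + y * y / 2"
        using 2 by (simp_all add: power2_eq_square field_simps)
      ultimately show ?thesis using zero_le_square[of x] zero_le_square[of y] by linarith
    next
      case 3
      then have "x * y \<le> 0" by (simp add: mult_nonpos_nonneg)
      with 3 show ?thesis by (auto simp: power2_eq_square algebra_simps abs_le_iff)
    next
      case 4
      then show ?thesis by simp
    qed
  qed
  have "((\<lambda>y. ((max 0 y)\<^sup>2 / 2 - (max 0 x)\<^sup>2 / 2) / (y - x) - max 0 x) \<longlongrightarrow> 0) (at x)"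
  proof (rule Lim_null_comparison)
    show "\<forall>\<^sub>F y in at x. norm (((max 0 y)\<^sup>2 / 2 - (max 0 x)\<^sup>2 / 2) / (y - x) - max 0 x) \<le> \<bar>y - x\<bar> / 2"
      unfolding eventually_at_filter
    proof (intro always_eventually allI impI)
      fix y assume "y \<noteq> x"
      then have "((max 0 y)\<^sup>2 / 2 - (max 0 x)\<^sup>2 / 2) / (y - x) - max 0 x
        = ((max 0 y)\<^sup>2 / 2 - (max 0 x)\<^sup>2 / 2 - max 0 x * (y - x)) / (y - x)"
        by (simp add: field_simps)
      also have "\<bar>\<dots>\<bar> \<le> ((y - x)\<^sup>2 / 2) / \<bar>y - x\<bar>"
        unfolding abs_divide by (intro divide_right_mono bound) simp
      also have "\<dots> = \<bar>y - x\<bar> / 2"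
        using \<open>y \<noteq> x\<close> by (simp add: field_simps power2_eq_square abs_mult_self_eq)
      finally show "norm (((max 0 y)\<^sup>2 / 2 - (max 0 x)\<^sup>2 / 2) / (y - x) - max 0 x) \<le> \<bar>y - x\<bar> / 2"
        by simp
    qed
    have "((\<lambda>y. \<bar>y - x\<bar> / 2) \<longlongrightarrow> \<bar>x - x\<bar> / 2) (at x)" by (intro tendsto_intros) simp
    then show "((\<lambda>y. \<bar>y - x\<bar> / 2) \<longlongrightarrow> 0) (at x)" by simp
  qed
  then show ?thesis by (simp add: has_field_derivative_iff LIM_zero_iff)
qed

lemma DERIV_ramp: "((\<lambda>t. ramp n (t - a)) has_real_derivative ramp' n (t - a)) (at t)"
proof -
  have *: "((\<lambda>x. (max 0 (x - b))\<^sup>2 / 2) has_real_derivative max 0 (t - b)) (at t)" for b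
  proof -
    have "((\<lambda>x. x - b) has_real_derivative 1) (at t)" by (auto intro!: derivative_eq_intros)
    from DERIV_chain2[OF DERIV_max0_square this] show ?thesis by (simp only: mult_1_right)
  qed
  have "((\<lambda>x. (max 0 (x - a))\<^sup>2 / 2 - (max 0 (x - (a + 1)))\<^sup>2 / 2 - (max 0 (x - (a + n)))\<^sup>2 / 2 + (max 0 (x - (a + n + 1)))\<^sup>2 / 2)
      has_real_derivative max 0 (t - a) - max 0 (t - (a + 1)) - max 0 (t - (a + n)) + max 0 (t - (a + n + 1))) (at t)"
    by (intro DERIV_add DERIV_diff *)
  then show ?thesis
    by (simp add: ramp_def ramp'_def diff_divide_distrib add_divide_distrib diff_diff_eq)
qed

lemma continuous_on_ramp': "continuous_on A (ramp' n)"
  unfolding ramp'_def by (intro continuous_intros)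

lemma
  assumes "1 \<le> n"
  shows ramp'_bounds: "0 \<le> ramp' n t" "ramp' n t \<le> 1"
    and ramp'_eq_0: "t \<le> 0 \<or> n + 1 \<le> t \<Longrightarrow> ramp' n t = 0"
    and ramp_start: "t \<le> 0 \<Longrightarrow> ramp n t = 0"
    and ramp_end: "n + 1 \<le> t \<Longrightarrow> ramp n t = n"
  using assms by (auto simp: ramp'_def ramp_def max_def power2_eq_square field_simps)

lemma ramp_bounds:
  assumes "1 \<le> n"
  shows "0 \<le> ramp n t" "ramp n t \<le> n"
proof -
  have mono: "ramp n u \<le> ramp n v" if "u \<le> v" for u v
    using DERIV_nonneg_imp_nondecreasing[OF that, of "ramp n"] DERIV_ramp[of n 0] ramp'_bounds(1)[OF assms] by fastforce
  show "0 \<le> ramp n t" using mono[of "min 0 t" t] ramp_start[OF assms, of "min 0 t"] by simp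
  show "ramp n t \<le> n" using mono[of t "max (n + 1) t"] ramp_end[OF assms, of "max (n + 1) t"] by simp
qed

context dde
begin

lemma L_zero: "0 \<le> t \<Longrightarrow> L t 0 = 0"
  using L_scale[of t 0 0] by simp

definition pseudo_solution :: "(real \<Rightarrow> real^'d) \<Rightarrow> real \<Rightarrow> bool" where
  "pseudo_solution y c \<longleftrightarrow> (\<exists>y'. continuous_on {- r..} y \<and>
     (\<forall>t\<ge>0. (y has_vector_derivative y' t) (at t within {0..})) \<and> continuous_on {0..} y' \<and>
     (\<forall>t\<ge>0. norm (y' t - L t (seg r y t)) \<le> c))"

lemma pseudo_solution_continuous: "pseudo_solution y c \<Longrightarrow> 0 \<le> t \<Longrightarrow> continuous_on {t - r..t} y"
  unfolding pseudo_solution_def by (auto intro: continuous_on_subset)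

text \<open>
  The product of a scalar \<open>h\<close> and a solution \<open>u\<close> satisfies the equation up to
  \<open>h' t * u t + L t (h t * u\<^sub>t - (h * u)\<^sub>t)\<close>. Both terms are bounded by \<open>u\<^sub>t\<close> because \<open>h\<close> has slope at most \<open>1\<close>,
  and both vanish where \<open>h\<close> is constant on \<open>[t-r,t]\<close>. So a slow modulation of a solution is an
  approximate solution, with an error that does not depend on the size of \<open>h\<close>. If \<open>u\<close> starts at \<open>s > 0\<close>,
  then \<open>h\<close> has to vanish near \<open>s\<close> to extend the product by \<open>0\<close> to earlier times.
\<close>

lemma pseudo_solution_multiple:
  assumes u: "is_solution r L s u" and "0 \<le> s"
    and h: "\<And>t. (h has_real_derivative h' t) (at t)" "continuous_on UNIV h'" "\<And>t. \<bar>h' t\<bar> \<le> 1"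
      "\<And>t. t \<le> a \<or> b \<le> t \<Longrightarrow> h' t = 0"
    and start: "s = 0 \<or> s < a \<and> (\<forall>t\<le>a. h t = 0)"
    and B: "\<And>t. \<lbrakk>s \<le> t; a \<le> t; t \<le> b + r\<rbrakk> \<Longrightarrow> norm (seg r u t) \<le> B" "0 \<le> B"
  shows "pseudo_solution (\<lambda>t. h t *\<^sub>R u t) ((1 + M * r) * B)"
proof -
  define y where "y t = h t *\<^sub>R u t" for t
  define y' where "y' t = (if t < s then 0 else h' t *\<^sub>R u t + h t *\<^sub>R L t (seg r u t))" for t
  have h_cont: "continuous_on A h" for A
    using h(1) by (meson DERIV_continuous_on has_field_derivative_at_within)
  have h'_cont: "continuous_on A h'" for A
    by (rule continuous_on_subset[OF h(2)]) simp
  have u_cont: "continuous_on {s - r..} u" using u by (simp add: is_solution_def)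
  have L_cont: "continuous_on {s..} (\<lambda>t. L t (seg r u t))"
    by (rule continuous_on_L_seg[OF \<open>0 \<le> s\<close> u_cont])
  have *: "continuous_on A (\<lambda>t. h t *\<^sub>R u t)" if "A \<subseteq> {s - r..}" for A
    by (intro continuous_intros h_cont continuous_on_subset[OF u_cont] that)
  have **: "continuous_on A (\<lambda>t. h' t *\<^sub>R u t + h t *\<^sub>R L t (seg r u t))" if "A \<subseteq> {s..}" for A
    by (intro continuous_intros h_cont h'_cont continuous_on_subset[OF u_cont] continuous_on_subset[OF L_cont])
      (use that r in auto)
  have y_cont: "continuous_on {- r..} y"
  proof (cases "s = 0")
    case True
    then show ?thesis unfolding y_def using *[of "{- r..}"] by simp
  next
    case False
    have "continuous_on ({..<a} \<union> {s<..}) y"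
    proof (rule continuous_on_open_Un)
      show "continuous_on {..<a} y"
        by (rule continuous_on_eq[of _ "\<lambda>_. 0"]) (use False start in \<open>auto simp: y_def\<close>)
      show "continuous_on {s<..} y" unfolding y_def by (rule *) (use r in auto)
    qed auto
    then show ?thesis by (rule continuous_on_subset) (use False start in auto)
  qed
  moreover have y'_cont: "continuous_on {0..} y'"
  proof (cases "s = 0")
    case True
    have "continuous_on {0..} (\<lambda>t. h' t *\<^sub>R u t + h t *\<^sub>R L t (seg r u t))" by (rule **) (use True in auto)
    then show ?thesis by (rule continuous_on_eq) (use True in \<open>auto simp: y'_def\<close>)
  next
    case False
    have "continuous_on ({..<a} \<union> {s<..}) y'"
    proof (rule continuous_on_open_Un)
      show "continuous_on {..<a} y'"
        by (rule continuous_on_eq[of _ "\<lambda>_. 0"]) (use False start h(4) in \<open>auto simp: y'_def\<close>)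
      have "continuous_on {s<..} (\<lambda>t. h' t *\<^sub>R u t + h t *\<^sub>R L t (seg r u t))" by (rule **) auto
      then show "continuous_on {s<..} y'" by (rule continuous_on_eq) (auto simp: y'_def)
    qed auto
    then show ?thesis by (rule continuous_on_subset) (use False start in auto)
  qed
  moreover have "(y has_vector_derivative y' t) (at t within {0..})" if t: "0 \<le> t" for t
  proof (cases "s = 0")
    case True
    have "(u has_vector_derivative L t (seg r u t)) (at t within {0..})"
      using u t True by (simp add: is_solution_def)
    from has_vector_derivative_scaleR[OF has_field_derivative_at_within[OF h(1)[of t]] this]
    show ?thesis using True t by (simp add: y_def[abs_def] y'_def add.commute)
  next
    case False
    show ?thesis
    proof (cases "t < a")
      case True
      have "(y has_vector_derivative 0) (at t)"
        by (rule has_vector_derivative_transform_within_open[of "\<lambda>_. 0" _ _ "{..<a}"])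
          (use True False start in \<open>auto simp: y_def\<close>)
      moreover have "y' t = 0" using True False start h(4) by (auto simp: y'_def)
      ultimately show ?thesis by (simp add: has_vector_derivative_at_within)
    next
      case t': False
      then have "s < t" using False start by auto
      from has_vector_derivative_scaleR[OF h(1)[of t] is_solution_deriv_at[OF u this]] \<open>s < t\<close>
      have "(y has_vector_derivative y' t) (at t)" by (simp add: y_def[abs_def] y'_def add.commute)
      then show ?thesis by (rule has_vector_derivative_at_within)
    qed
  qed
  moreover have "norm (y' t - L t (seg r y t)) \<le> (1 + M * r) * B" if t: "0 \<le> t" for t
  proof (cases "t < s")
    case True
    then have "seg r y t = 0"
      using start t by (intro seg_eq_0[OF r]) (auto simp: y_def)
    then show ?thesis using True t M r B(2) by (simp add: y'_def L_zero)
  next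
    case False
    have uc: "continuous_on {t - r..t} u" by (rule continuous_on_subset[OF u_cont]) (use False in auto)
    have X: "seg r u t \<in> Cspace r" "seg r y t \<in> Cspace r"
      using uc h_cont by (auto intro!: seg_in_Cspace[OF r] continuous_intros simp: y_def[abs_def])
    have D: "h t *\<^sub>R seg r u t - seg r y t = seg r (\<lambda>\<tau>. (h t - h \<tau>) *\<^sub>R u \<tau>) t"
      using uc h_cont
      by (simp add: y_def[abs_def] seg_scaleR[OF r, symmetric] seg_diff[OF r, symmetric] continuous_intros scaleR_diff_left)
    have defect: "y' t - L t (seg r y t) = h' t *\<^sub>R u t + L t (seg r (\<lambda>\<tau>. (h t - h \<tau>) *\<^sub>R u \<tau>) t)"
      using False t X subspace_scale[OF subspace_Cspace, OF X(1)]
      by (simp add: y'_def D[symmetric] L_diff L_scale)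
    have DX: "seg r (\<lambda>\<tau>. (h t - h \<tau>) *\<^sub>R u \<tau>) t \<in> Cspace r"
      by (intro seg_in_Cspace[OF r] continuous_intros h_cont uc)
    have incr: "\<exists>z. \<tau> \<le> z \<and> z \<le> t \<and> h t - h \<tau> = (t - \<tau>) * h' z" if "\<tau> \<le> t" for \<tau>
    proof (cases "\<tau> = t")
      case False
      then show ?thesis using MVT2[of \<tau> t h h'] h(1) that by (metis less_eq_real_def)
    qed auto
    show ?thesis
    proof (cases "a \<le> t \<and> t \<le> b + r")
      case True
      have "norm (seg r (\<lambda>\<tau>. (h t - h \<tau>) *\<^sub>R u \<tau>) t) \<le> r * norm (seg r u t)"
      proof (rule seg_norm_le[OF r])
        show "continuous_on {t - r..t} (\<lambda>\<tau>. (h t - h \<tau>) *\<^sub>R u \<tau>)" by (intro continuous_intros h_cont uc)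
        fix \<tau> assume \<tau>: "\<tau> \<in> {t - r..t}"
        then obtain z where "h t - h \<tau> = (t - \<tau>) * h' z" using incr by force
        then have "\<bar>h t - h \<tau>\<bar> \<le> r * 1"
          unfolding abs_mult[of "t - \<tau>"] using \<tau> r h(3)[of z] by (simp only: abs_mult) (intro mult_mono, auto)
        then show "norm ((h t - h \<tau>) *\<^sub>R u \<tau>) \<le> r * norm (seg r u t)"
          unfolding norm_scaleR using norm_le_seg[OF r uc \<tau>] r by (intro mult_mono) auto
      qed
      then have "norm (L t (seg r (\<lambda>\<tau>. (h t - h \<tau>) *\<^sub>R u \<tau>) t)) \<le> M * (r * norm (seg r u t))"
        using order_trans[OF L_bound[OF t DX] mult_left_mono[OF _ M]] by blast
      moreover have "norm (h' t *\<^sub>R u t) \<le> 1 * norm (seg r u t)"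
        unfolding norm_scaleR using norm_le_seg[OF r uc, of t] r h(3) by (intro mult_mono) auto
      ultimately have "norm (y' t - L t (seg r y t)) \<le> (1 + M * r) * norm (seg r u t)"
        unfolding defect
        using norm_triangle_ineq[of "h' t *\<^sub>R u t" "L t (seg r (\<lambda>\<tau>. (h t - h \<tau>) *\<^sub>R u \<tau>) t)"]
        by (simp add: algebra_simps)
      also have "\<dots> \<le> (1 + M * r) * B"
        using B(1)[of t] True False M r by (intro mult_left_mono) auto
      finally show ?thesis .
    next
      case outside: False
      have "h' t = 0" using outside h(4)[of t] r by auto
      moreover have "h t - h \<tau> = 0" if "\<tau> \<in> {t - r..t}" for \<tau>
      proof -
        obtain z where "\<tau> \<le> z" "z \<le> t" "h t - h \<tau> = (t - \<tau>) * h' z" using incr \<open>\<tau> \<in> _\<close> by force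
        then show ?thesis using outside h(4)[of z] that by auto
      qed
      then have "seg r (\<lambda>\<tau>. (h t - h \<tau>) *\<^sub>R u \<tau>) t = 0"
        by (intro seg_eq_0[OF r]) simp
      ultimately show ?thesis using t M r B(2) unfolding defect by (simp add: L_zero)
    qed
  qed
  ultimately show ?thesis
    unfolding pseudo_solution_def y_def[abs_def, symmetric] by (intro exI[of _ y']) auto
qed

end

text \<open>
  By linearity the shadowing property scales: a defect of size \<open>c\<close> is shadowed at distance \<open>K * c\<close>.
\<close>

locale shadowing_dde = dde r M L
  for r M :: real and L :: "real \<Rightarrow> (real \<Rightarrow>\<^sub>C (real^'d)) \<Rightarrow> real^'d" +
  fixes K :: real
  assumes K: "0 \<le> K"
    and shadow: "\<And>y c. \<lbrakk>pseudo_solution y c; 0 < c\<rbrakk> \<Longrightarrow>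
      \<exists>\<xi>\<in>Cspace r. \<forall>t\<ge>0. norm (T t 0 \<xi> - seg r y t) \<le> K * c"
begin

lemma T_zero: "0 \<le> s \<Longrightarrow> s \<le> t \<Longrightarrow> T t s 0 = 0"
  using T_scale[of s t 0 0] by simp

text \<open>
  Switch a solution starting at time \<open>s\<close> on between \<open>s + 1\<close> and \<open>s + 3\<close>. The result vanishes up to
  time \<open>s\<close> and equals the solution later, and the solution through \<open>\<xi>\<close> that shadows it is bounded where it
  vanishes and differs from it by a bounded amount for large times. Hence every \<open>\<phi>\<close> at time \<open>s\<close> is the
  sum of a state reached from time \<open>0\<close> and a state with a bounded forward orbit, with bounds that do not
  depend on \<open>s\<close>.
\<close>

lemma splitting:
  "\<exists>K2\<ge>0. \<forall>s\<ge>0. \<forall>\<phi>\<in>Cspace r. \<exists>\<xi>\<in>Cspace r.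
     (\<forall>t. 0 \<le> t \<and> t \<le> s \<longrightarrow> norm (T t 0 \<xi>) \<le> K2 * norm \<phi>) \<and>
     (\<forall>t\<ge>s. norm (T t s (\<phi> - T s 0 \<xi>)) \<le> K2 * norm \<phi>)"
proof -
  define G where "G = growth (3 + r)"
  define K1 where "K1 = K * ((1 + M * r) * G)"
  define K2 where "K2 = K1 + G * (1 + K1)"
  have G: "0 < G" by (simp add: G_def growth_pos)
  have Mr: "0 < 1 + M * r" using M r by (simp add: add_pos_nonneg)
  have K1: "0 \<le> K1" using K G Mr by (simp add: K1_def)
  then have K2: "K1 \<le> K2" "G * (1 + K1) \<le> K2" "0 \<le> K2" using G by (auto simp: K2_def)
  have "\<exists>\<xi>\<in>Cspace r. (\<forall>t. 0 \<le> t \<and> t \<le> s \<longrightarrow> norm (T t 0 \<xi>) \<le> K2 * norm \<phi>) \<and>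
     (\<forall>t\<ge>s. norm (T t s (\<phi> - T s 0 \<xi>)) \<le> K2 * norm \<phi>)" if s: "0 \<le> s" and \<phi>: "\<phi> \<in> Cspace r" for s \<phi>
  proof (cases "\<phi> = 0")
    \<comment> \<open>a separate case, since only a positive defect can be scaled\<close>
    case True
    then show ?thesis using s by (intro bexI[of _ 0]) (auto simp: T_zero)
  next
    case False
    obtain u where u: "is_solution r L s u" "seg r u s = \<phi>" "\<And>t. s \<le> t \<Longrightarrow> T t s \<phi> = seg r u t"
      using solution_through[OF s \<phi>] by blast
    define h where "h t = ramp 1 (t - (s + 1))" for t
    define y where "y t = h t *\<^sub>R u t" for t
    define c where "c = (1 + M * r) * (G * norm \<phi>)"
    have early: "norm (T t s \<phi>) \<le> G * norm \<phi>" if "s \<le> t" "t \<le> s + 3 + r" for t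
    proof -
      have "growth (t - s) * norm \<phi> \<le> G * norm \<phi>"
        unfolding G_def using that(2) by (intro mult_right_mono growth_mono) auto
      then show ?thesis using T_bound[OF s that(1) \<phi>] by linarith
    qed
    have "pseudo_solution y c"
      unfolding y_def c_def
    proof (rule pseudo_solution_multiple[OF u(1) s, where h' = "\<lambda>t. ramp' 1 (t - (s + 1))" and a = "s + 1" and b = "s + 3"])
      show "(h has_real_derivative ramp' 1 (t - (s + 1))) (at t)" for t
        unfolding h_def by (rule DERIV_ramp)
      show "continuous_on UNIV (\<lambda>t. ramp' 1 (t - (s + 1)))"
        by (rule continuous_on_compose2[OF continuous_on_ramp'[of UNIV]]) (auto intro!: continuous_intros)
      show "\<bar>ramp' 1 (t - (s + 1))\<bar> \<le> 1" for t using ramp'_bounds[of 1 "t - (s + 1)"] by simp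
      show "ramp' 1 (t - (s + 1)) = 0" if "t \<le> s + 1 \<or> s + 3 \<le> t" for t
        using that by (intro ramp'_eq_0) auto
      show "s = 0 \<or> s < s + 1 \<and> (\<forall>t\<le>s + 1. h t = 0)" by (auto simp: h_def ramp_start)
      show "norm (seg r u t) \<le> G * norm \<phi>" if "s \<le> t" "s + 1 \<le> t" "t \<le> s + 3 + r" for t
        using early[of t] u(3)[of t] that by simp
    qed (use G in auto)
    moreover have "0 < c" using Mr G False by (simp add: c_def)
    ultimately obtain \<xi> where \<xi>: "\<xi> \<in> Cspace r" "\<And>t. 0 \<le> t \<Longrightarrow> norm (T t 0 \<xi> - seg r y t) \<le> K * c"
      using shadow by blast
    have Kc: "K * c = K1 * norm \<phi>" by (simp add: c_def K1_def)
    have before: "norm (T t 0 \<xi>) \<le> K1 * norm \<phi>" if "0 \<le> t" "t \<le> s" for t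
    proof -
      have "seg r y t = 0"
        using that by (intro seg_eq_0[OF r]) (auto simp: y_def h_def ramp_start)
      then show ?thesis using \<xi>(2)[of t] that Kc by simp
    qed
    have after: "norm (T t s (\<phi> - T s 0 \<xi>)) \<le> K2 * norm \<phi>" if t: "s \<le> t" for t
    proof -
      have X: "T s 0 \<xi> \<in> Cspace r" using \<xi> s by auto
      show ?thesis
      proof (cases "t \<le> s + 3 + r")
        case True
        have "norm (T t s (\<phi> - T s 0 \<xi>)) \<le> growth (t - s) * norm (\<phi> - T s 0 \<xi>)"
          using \<phi> X s t by (intro T_bound) auto
        also have "\<dots> \<le> G * ((1 + K1) * norm \<phi>)"
          using True before[of s] s norm_triangle_ineq4[of \<phi> "T s 0 \<xi>"] G
          unfolding G_def by (intro mult_mono growth_mono) (auto simp: algebra_simps)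
        also have "\<dots> \<le> K2 * norm \<phi>"
          using mult_right_mono[OF K2(2), of "norm \<phi>"] by (simp add: mult.assoc)
        finally show ?thesis .
      next
        case False
        have "seg r y t = seg r u t"
          using False r by (intro seg_cong[OF r]) (auto simp: y_def h_def ramp_end)
        then have "norm (T t 0 \<xi> - T t s \<phi>) \<le> K1 * norm \<phi>"
          using \<xi>(2)[of t] u(3)[OF t] Kc s t by simp
        moreover have "T t s (\<phi> - T s 0 \<xi>) = T t s \<phi> - T t 0 \<xi>"
          using T_diff[OF s t \<phi> X] T_comp[of 0 s t \<xi>] \<xi>(1) s t by simp
        ultimately show ?thesis
          using mult_right_mono[OF K2(1), of "norm \<phi>"] by (simp add: norm_minus_commute)
      qed
    qed
    show ?thesis
      using \<xi>(1) before after mult_right_mono[OF K2(1), of "norm \<phi>"] by (intro bexI[of _ \<xi>]) (auto intro: order_trans)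
  qed
  then show ?thesis using K2(3) by blast
qed

end

section \<open>Finite codimension of the bounded orbits\<close>

text \<open>
  This is the Arzela--Ascoli theorem, with the remark that uniform limits inherit the bounds.
\<close>

lemma seq_compact_Lipschitz_segments:
  assumes r: "0 \<le> r"
  shows "seq_compact {\<psi> \<in> Cspace r :: (real \<Rightarrow>\<^sub>C (real^'d)) set. (\<forall>\<theta>\<in>{- r..0}. norm (apply_bcontfun \<psi> \<theta>) \<le> B) \<and>
    (\<forall>\<theta>\<in>{- r..0}. \<forall>\<theta>'\<in>{- r..0}. norm (apply_bcontfun \<psi> \<theta> - apply_bcontfun \<psi> \<theta>') \<le> \<Lambda> * \<bar>\<theta> - \<theta>'\<bar>)}"
    (is "seq_compact ?S")
proof (rule seq_compactI)
  fix f :: "nat \<Rightarrow> real \<Rightarrow>\<^sub>C (real^'d)" assume f: "\<forall>n. f n \<in> ?S"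
  obtain g k where g: "continuous_on {- r..0} g" and k: "strict_mono (k :: nat \<Rightarrow> nat)"
    and lim: "\<And>e. 0 < e \<Longrightarrow> \<exists>N. \<forall>n x. n \<ge> N \<and> x \<in> {- r..0} \<longrightarrow> norm (apply_bcontfun (f (k n)) x - g x) < e"
  proof (rule Arzela_Ascoli[of "{- r..0}" "\<lambda>n. apply_bcontfun (f n)" B])
    fix x e :: real assume x: "x \<in> {- r..0}" and e: "0 < e"
    show "\<exists>d>0. \<forall>n y. y \<in> {- r..0} \<and> norm (x - y) < d \<longrightarrow> norm (apply_bcontfun (f n) x - apply_bcontfun (f n) y) < e"
    proof (intro exI[of _ "e / (\<bar>\<Lambda>\<bar> + 1)"] conjI allI impI)
      show "0 < e / (\<bar>\<Lambda>\<bar> + 1)" using e by (simp add: add_nonneg_pos)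
      fix n y assume y: "y \<in> {- r..0} \<and> norm (x - y) < e / (\<bar>\<Lambda>\<bar> + 1)"
      have "norm (apply_bcontfun (f n) x - apply_bcontfun (f n) y) \<le> \<Lambda> * \<bar>x - y\<bar>" using f x y by blast
      also have "\<dots> \<le> (\<bar>\<Lambda>\<bar> + 1) * \<bar>x - y\<bar>" by (intro mult_right_mono) auto
      also have "\<dots> < e" using y by (simp add: field_simps add_nonneg_pos)
      finally show "norm (apply_bcontfun (f n) x - apply_bcontfun (f n) y) < e" .
    qed
  qed (use f in auto)
  obtain \<psi> where \<psi>: "\<psi> \<in> Cspace r" "\<And>\<theta>. \<theta> \<in> {- r..0} \<Longrightarrow> apply_bcontfun \<psi> \<theta> = g \<theta>"
    using Cspace_ex1[OF r g] by blast
  have conv: "(f \<circ> k) \<longlonglongrightarrow> \<psi>"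
  proof (rule metric_LIMSEQ_I)
    fix e :: real assume "0 < e"
    then obtain N where N: "\<And>n x. n \<ge> N \<Longrightarrow> x \<in> {- r..0} \<Longrightarrow> norm (apply_bcontfun (f (k n)) x - g x) < e / 2"
      using lim[of "e / 2"] by auto
    have "dist ((f \<circ> k) n) \<psi> < e" if "n \<ge> N" for n
    proof -
      have "norm (f (k n) - \<psi>) \<le> e / 2"
        using f \<psi> N[OF that] by (intro Cspace_norm_le[OF r]) (auto intro: less_imp_le)
      then show ?thesis using \<open>0 < e\<close> by (simp add: dist_norm)
    qed
    then show "\<exists>N. \<forall>n\<ge>N. dist ((f \<circ> k) n) \<psi> < e" by blast
  qed
  have pt: "(\<lambda>n. apply_bcontfun ((f \<circ> k) n) \<theta>) \<longlonglongrightarrow> apply_bcontfun \<psi> \<theta>" for \<theta>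
    using tendsto_uniform_limitI[OF tendsto_bcontfun_uniform_limit[OF conv]] by blast
  have "norm (apply_bcontfun \<psi> \<theta>) \<le> B" if "\<theta> \<in> {- r..0}" for \<theta>
    by (rule tendsto_upperbound[OF tendsto_norm[OF pt]]) (use f that in auto)
  moreover have "norm (apply_bcontfun \<psi> \<theta> - apply_bcontfun \<psi> \<theta>') \<le> \<Lambda> * \<bar>\<theta> - \<theta>'\<bar>" if "\<theta> \<in> {- r..0}" "\<theta>' \<in> {- r..0}" for \<theta> \<theta>'
    by (rule tendsto_upperbound[OF tendsto_norm[OF tendsto_diff[OF pt pt]]]) (use f that in auto)
  ultimately have "\<psi> \<in> ?S" using \<psi>(1) by blast
  then show "\<exists>l\<in>?S. \<exists>k. strict_mono k \<and> (f \<circ> k) \<longlonglongrightarrow> l" using k conv by blast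
qed

context dde
begin

text \<open>
  The segment at time \<open>r\<close> consists of the values on \<open>[0,r]\<close>, where the solution satisfies the equation and
  is Lipschitz with a constant given by the bound of \<open>L\<close>. So \<open>T r 0\<close> maps the unit ball into a compact set; the
  points of the resulting net are chosen in the unit ball itself, that is, at time \<open>0\<close>.
\<close>

lemma T_net:
  assumes "0 < \<epsilon>"
  shows "\<exists>W. finite W \<and> W \<subseteq> {\<phi> \<in> Cspace r. norm \<phi> \<le> 1} \<and>
    (\<forall>\<phi>\<in>Cspace r. norm \<phi> \<le> 1 \<longrightarrow> (\<exists>w\<in>W. norm (T r 0 \<phi> - T r 0 w) \<le> \<epsilon>))"
proof -
  let ?B = "growth r" and ?\<Lambda> = "M * growth r"
  define S where "S = {\<psi> \<in> Cspace r :: (real \<Rightarrow>\<^sub>C (real^'d)) set. (\<forall>\<theta>\<in>{- r..0}. norm (apply_bcontfun \<psi> \<theta>) \<le> ?B) \<and>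
    (\<forall>\<theta>\<in>{- r..0}. \<forall>\<theta>'\<in>{- r..0}. norm (apply_bcontfun \<psi> \<theta> - apply_bcontfun \<psi> \<theta>') \<le> ?\<Lambda> * \<bar>\<theta> - \<theta>'\<bar>)}"
  have S: "T r 0 \<phi> \<in> S" if \<phi>: "\<phi> \<in> Cspace r" "norm \<phi> \<le> 1" for \<phi>
  proof -
    obtain x where x: "is_solution r L 0 x" "seg r x 0 = \<phi>" "\<And>t. 0 \<le> t \<Longrightarrow> T t 0 \<phi> = seg r x t"
      using solution_through[OF order_refl \<phi>(1)] by blast
    have xc: "continuous_on {r - r..r} x" by (rule is_solution_continuous[OF x(1)]) (use r in auto)
    have bound: "norm (seg r x t) \<le> ?B" if "0 \<le> t" "t \<le> r" for t
    proof -
      have "norm (seg r x t) \<le> growth (t - 0) * norm \<phi>"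
        using is_solution_growth[OF x(1) order_refl that(1)] x(2) by simp
      also have "\<dots> \<le> ?B * 1"
        using that \<phi>(2) growth_mono[of t r] growth_pos[of r] by (intro mult_mono) auto
      finally show ?thesis by simp
    qed
    have Lip: "norm (x v - x u) \<le> ?\<Lambda> * (v - u)" if "0 \<le> u" "u \<le> v" "v \<le> r" for u v
    proof (cases "u = v")
      case False
      have "norm (x v - x u) \<le> ?\<Lambda> * v - ?\<Lambda> * u"
      proof (rule differentiable_bound_general[where f' = "\<lambda>t. L t (seg r x t)" and \<phi>' = "\<lambda>_. ?\<Lambda>"])
        fix t assume t: "u < t" "t < v"
        show "(x has_vector_derivative L t (seg r x t)) (at t)"
          using is_solution_deriv_at[OF x(1)] t that by simp
        show "((*) ?\<Lambda> has_vector_derivative ?\<Lambda>) (at t)"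
          by (auto intro!: derivative_eq_intros simp: has_real_derivative_iff_has_vector_derivative[symmetric])
        show "norm (L t (seg r x t)) \<le> ?\<Lambda>"
          using L_bound[of t "seg r x t"] is_solution_seg_in[OF x(1), of t] mult_left_mono[OF bound[of t] M] t that
          by simp
      qed (use False that in \<open>auto intro!: continuous_intros continuous_on_subset[OF xc]\<close>)
      then show ?thesis by (simp add: right_diff_distrib)
    qed simp
    have ap: "apply_bcontfun (seg r x r) \<theta> = x (r + \<theta>)" if "\<theta> \<in> {- r..0}" for \<theta>
      using seg_apply[OF r xc that] .
    have "norm (apply_bcontfun (seg r x r) \<theta> - apply_bcontfun (seg r x r) \<theta>') \<le> ?\<Lambda> * \<bar>\<theta> - \<theta>'\<bar>"
      if "\<theta> \<in> {- r..0}" "\<theta>' \<in> {- r..0}" for \<theta> \<theta>'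
      using Lip[of "r + \<theta>'" "r + \<theta>"] Lip[of "r + \<theta>" "r + \<theta>'"] that
      by (cases "\<theta> \<le> \<theta>'") (auto simp: ap norm_minus_commute abs_if)
    moreover have "norm (apply_bcontfun (seg r x r) \<theta>) \<le> ?B" for \<theta>
      using norm_bounded[of "seg r x r" \<theta>] bound[of r] r by simp
    ultimately show ?thesis
      unfolding S_def using x(3)[OF r] is_solution_seg_in[OF x(1) r] by simp
  qed
  have "seq_compact S" unfolding S_def by (rule seq_compact_Lipschitz_segments[OF r])
  then obtain k where k: "finite k" "S \<subseteq> (\<Union>x\<in>k. ball x (\<epsilon> / 2))"
    using seq_compact_imp_totally_bounded assms half_gt_zero by metis
  define good where "good z \<phi> \<longleftrightarrow> \<phi> \<in> Cspace r \<and> norm \<phi> \<le> 1 \<and> T r 0 \<phi> \<in> ball z (\<epsilon> / 2)" for z \<phi>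
  define W where "W = (\<lambda>z. SOME \<phi>. good z \<phi>) ` {z \<in> k. \<exists>\<phi>. good z \<phi>}"
  have sel: "good z (SOME \<phi>. good z \<phi>)" if "\<exists>\<phi>. good z \<phi>" for z
    using that by (rule someI_ex)
  have "W \<subseteq> {\<phi> \<in> Cspace r. norm \<phi> \<le> 1}" using sel unfolding W_def good_def by blast
  moreover have "\<exists>w\<in>W. norm (T r 0 \<phi> - T r 0 w) \<le> \<epsilon>" if \<phi>: "\<phi> \<in> Cspace r" "norm \<phi> \<le> 1" for \<phi>
  proof -
    obtain z where z: "z \<in> k" "good z \<phi>" using k(2) S[OF \<phi>] \<phi> unfolding good_def by blast
    let ?w = "SOME \<phi>. good z \<phi>"
    have "?w \<in> W" using z unfolding W_def by blast
    moreover have "dist (T r 0 \<phi>) (T r 0 ?w) < \<epsilon>"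
      using sel[of z] z(2) dist_triangle_half_r[of z "T r 0 \<phi>" \<epsilon> "T r 0 ?w"] unfolding good_def by auto
    ultimately show ?thesis by (intro bexI[of _ ?w]) (auto simp: dist_norm)
  qed
  ultimately show ?thesis using k(1) unfolding W_def by (intro exI[of _ W]) (auto simp: W_def)
qed

sublocale operator_family "Cspace r" "\<lambda>t. T t 0" "{0..}"
proof
  show "subspace (Cspace r :: (real \<Rightarrow>\<^sub>C (real^'d)) set)" by (rule subspace_Cspace)
  show "\<exists>K. \<forall>v\<in>Cspace r. norm (T i 0 v) \<le> K * norm v" if "i \<in> {0..}" for i
    using T_bound[of 0 i] that by (intro exI[of _ "growth (i - 0)"] ballI) simp
qed (simp_all add: T_add T_scale)

end

context shadowing_dde
begin

text \<open>
  Let \<open>T r 0 w\<close> be close to \<open>T r 0 v\<close>. The splitting of the small difference at time \<open>r\<close> gives a small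
  \<open>\<xi>\<close> for which \<open>v - w - \<xi>\<close> has a bounded orbit, so that \<open>v\<close> agrees with \<open>w\<close> up to a small error and a
  vector with a bounded orbit. Finitely many \<open>w\<close> suffice because \<open>T r 0\<close> is compact. The kernel of the
  projection \<open>Q\<close> consists exactly of the initial states with a bounded orbit.
\<close>

lemma initial_projection:
  "\<exists>Q k. 0 \<le> k \<and> (\<forall>\<phi>\<in>Cspace r. Q \<phi> \<in> Cspace r \<and> norm (Q \<phi>) \<le> k * norm \<phi> \<and>
       (\<forall>t\<ge>0. norm (T t 0 (\<phi> - Q \<phi>)) \<le> k * norm \<phi>)) \<and>
     (\<forall>\<phi>\<in>Cspace r. \<forall>\<psi>\<in>Cspace r. \<forall>a b. Q (a *\<^sub>R \<phi> + b *\<^sub>R \<psi>) = a *\<^sub>R Q \<phi> + b *\<^sub>R Q \<psi>) \<and>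
     (\<forall>\<phi>\<in>Cspace r. \<forall>b. (\<forall>t\<ge>0. norm (T t 0 \<phi>) \<le> b) \<longrightarrow> Q \<phi> = 0)"
proof -
  obtain K2 where K2: "0 \<le> K2" and split: "\<And>s \<phi>. \<lbrakk>0 \<le> s; \<phi> \<in> Cspace r\<rbrakk> \<Longrightarrow> \<exists>\<xi>\<in>Cspace r.
     (\<forall>t. 0 \<le> t \<and> t \<le> s \<longrightarrow> norm (T t 0 \<xi>) \<le> K2 * norm \<phi>) \<and>
     (\<forall>t\<ge>s. norm (T t s (\<phi> - T s 0 \<xi>)) \<le> K2 * norm \<phi>)"
    using splitting by blast
  define \<epsilon> where "\<epsilon> = 1 / (2 * (K2 + 1))"
  have \<epsilon>: "0 < \<epsilon>" "K2 * \<epsilon> \<le> 1 / 2" using K2 by (auto simp: \<epsilon>_def field_simps)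
  obtain W where W: "finite W" "W \<subseteq> {\<phi> \<in> Cspace r :: (real \<Rightarrow>\<^sub>C (real^'d)) set. norm \<phi> \<le> 1}"
    and net: "\<forall>\<phi>\<in>Cspace r. norm \<phi> \<le> 1 \<longrightarrow> (\<exists>w\<in>W. norm (T r 0 \<phi> - T r 0 w) \<le> \<epsilon>)"
    using T_net[OF \<epsilon>(1)] by (elim exE conjE)
  define c where "c = growth r * 3 + 1"
  have c: "0 \<le> c" using growth_pos[of r] by (simp add: c_def)
  have "spanning W (2 * c + 2)"
  proof (rule spanning_of_net[OF W(1) _ c])
    show "W \<subseteq> Cspace r" using W(2) by blast
    fix v :: "real \<Rightarrow>\<^sub>C (real^'d)" assume v: "v \<in> Cspace r" "norm v \<le> 1"
    then obtain w where w: "w \<in> W" "norm (T r 0 v - T r 0 w) \<le> \<epsilon>" using net by blast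
    have wX: "w \<in> Cspace r" "norm w \<le> 1" using W(2) w(1) by auto
    have vw: "T r 0 (v - w) = T r 0 v - T r 0 w" using T_diff r v wX by simp
    have X: "v - w \<in> Cspace r" "T r 0 (v - w) \<in> Cspace r" using v wX r by auto
    obtain \<xi> where \<xi>: "\<xi> \<in> Cspace r" "\<And>t. \<lbrakk>0 \<le> t; t \<le> r\<rbrakk> \<Longrightarrow> norm (T t 0 \<xi>) \<le> K2 * norm (T r 0 (v - w))"
      "\<And>t. r \<le> t \<Longrightarrow> norm (T t r (T r 0 (v - w) - T r 0 \<xi>)) \<le> K2 * norm (T r 0 (v - w))"
      using split[OF r X(2)] by blast
    have small: "K2 * norm (T r 0 (v - w)) \<le> 1 / 2"
      using mult_left_mono[OF w(2) K2] \<epsilon>(2) vw by simp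
    define a where "a = v - w - \<xi>"
    have aX: "a \<in> Cspace r" using X \<xi>(1) by (auto simp: a_def)
    have \<xi>n: "norm \<xi> \<le> 1 / 2" using \<xi>(2)[of 0] T_refl[of 0 \<xi>] \<xi>(1) r small by simp
    have an: "norm a \<le> 3"
      using norm_triangle_ineq4[of "v - w" \<xi>] norm_triangle_ineq4[of v w] v wX \<xi>n by (simp add: a_def)
    have "norm (T t 0 a) \<le> c" if t: "0 \<le> t" for t
    proof (cases "t \<le> r")
      case True
      have "norm (T t 0 a) \<le> growth (t - 0) * norm a" by (rule T_bound) (use t aX in auto)
      also have "\<dots> \<le> growth r * 3"
        using True an growth_pos[of r] growth_mono[of t r] by (intro mult_mono) auto
      finally show ?thesis by (simp add: c_def)
    next
      case False
      have "T r 0 (v - w) - T r 0 \<xi> = T r 0 a" using T_diff[of 0 r "v - w" \<xi>] X \<xi>(1) r by (simp add: a_def)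
      then have "norm (T t 0 a) \<le> 1 / 2"
        using \<xi>(3)[of t] small False T_comp[of 0 r t a] aX r by simp
      then show ?thesis using growth_pos[of r] by (simp add: c_def)
    qed
    then have "bnd c a" by (simp add: bdd_orbit_def)
    moreover have "norm (v - w - a) \<le> 1 / 2" using \<xi>n by (simp add: a_def)
    ultimately show "\<exists>w\<in>W. \<exists>a\<in>Cspace r. bnd c a \<and> norm (v - w - a) \<le> 1 / 2" using w(1) aX by blast
  qed
  moreover have "(\<forall>t\<in>{0::real..}. R t) \<longleftrightarrow> (\<forall>t\<ge>0. R t)" for R by auto
  ultimately show ?thesis
    using complement_of_spanning[of W "2 * c + 2"] unfolding bdd_orbit_def by simp
qed

end

section \<open>Stable and unstable directions\<close>

text \<open>
  A quantity that never grows by more than the factor \<open>\<kappa>\<close> and is halved after each period of length \<open>\<tau>\<close>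
  decays with the rate \<open>ln 2 / \<tau>\<close>. Only the interval \<open>[0,l]\<close> is considered because in the unstable
  direction time runs backwards and ends at \<open>0\<close>.
\<close>

lemma halving_imp_exponential:
  fixes g :: "real \<Rightarrow> real"
  assumes \<tau>: "0 < \<tau>" and \<kappa>: "0 \<le> \<kappa>" and g0: "0 \<le> g 0"
    and bound: "\<And>a b. \<lbrakk>0 \<le> a; a \<le> b; b \<le> l\<rbrakk> \<Longrightarrow> g b \<le> \<kappa> * g a"
    and half: "\<And>a b. \<lbrakk>0 \<le> a; a + \<tau> \<le> b; b \<le> l\<rbrakk> \<Longrightarrow> g b \<le> g a / 2"
    and b: "0 \<le> b" "b \<le> l"
  shows "g b \<le> 2 * \<kappa> * exp (- (ln 2 / \<tau>) * b) * g 0"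
proof -
  have step: "g b \<le> \<kappa> * (1 / 2) ^ n * g 0" if "n * \<tau> \<le> b" "b \<le> l" for n :: nat and b
    using that
  proof (induction n arbitrary: b)
    case 0
    then show ?case using bound[of 0 b] by simp
  next
    case (Suc n)
    have 1: "0 \<le> n * \<tau>" using \<tau> by simp
    have 2: "n * \<tau> \<le> b - \<tau>" using Suc.prems by (simp add: algebra_simps)
    have "0 \<le> b - \<tau>" "b - \<tau> \<le> l" using 1 2 Suc.prems(2) \<tau> by linarith+
    with 2 show ?case using half[of "b - \<tau>" b] Suc.IH[of "b - \<tau>"] Suc.prems by simp
  qed
  define n where "n = nat \<lfloor>b / \<tau>\<rfloor>"
  have "real n = of_int \<lfloor>b / \<tau>\<rfloor>" using b \<tau> by (simp add: n_def)
  then have n: "n \<le> b / \<tau>" "b / \<tau> < n + 1" by linarith+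
  have "n * \<tau> \<le> b" using n(1) \<tau> by (simp add: field_simps)
  then have "g b \<le> \<kappa> * (1 / 2) ^ n * g 0" using step b by blast
  moreover have "(1 / 2 :: real) ^ n \<le> 2 * exp (- (ln 2 / \<tau>) * b)"
  proof -
    have "(1 / 2 :: real) ^ n = exp (- (n * ln 2))"
      by (simp add: exp_minus exp_of_nat_mult power_one_over inverse_eq_divide)
    also have "n * ln 2 \<ge> (b / \<tau> - 1) * ln 2" using n by (intro mult_right_mono) auto
    then have "exp (- (n * ln 2)) \<le> exp (ln 2 + - (ln 2 / \<tau>) * b)" by (simp add: algebra_simps)
    also have "\<dots> = 2 * exp (- (ln 2 / \<tau>) * b)" by (subst exp_add) simp
    finally show ?thesis .
  qed
  then have "\<kappa> * (1 / 2) ^ n * g 0 \<le> \<kappa> * (2 * exp (- (ln 2 / \<tau>) * b)) * g 0"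
    using \<kappa> g0 by (intro mult_right_mono mult_left_mono)
  ultimately show ?thesis by simp
qed

text \<open>
  A bounded projection \<open>Q\<close> at time \<open>0\<close> along the states with a bounded orbit. Its range is the unstable
  space at time \<open>0\<close>, which is then transported by the equation.
\<close>

locale projected_dde = shadowing_dde r M L K
  for r M :: real and L :: "real \<Rightarrow> (real \<Rightarrow>\<^sub>C (real^'d)) \<Rightarrow> real^'d" and K :: real +
  fixes Q :: "(real \<Rightarrow>\<^sub>C (real^'d)) \<Rightarrow> (real \<Rightarrow>\<^sub>C (real^'d))" and k :: real
  assumes k: "0 \<le> k"
    and Q_in: "\<And>\<phi>. \<phi> \<in> Cspace r \<Longrightarrow> Q \<phi> \<in> Cspace r"
    and Q_bound: "\<And>\<phi>. \<phi> \<in> Cspace r \<Longrightarrow> norm (Q \<phi>) \<le> k * norm \<phi>"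
    and Q_compl: "\<And>\<phi> t. \<lbrakk>\<phi> \<in> Cspace r; 0 \<le> t\<rbrakk> \<Longrightarrow> norm (T t 0 (\<phi> - Q \<phi>)) \<le> k * norm \<phi>"
    and Q_lincomb: "\<And>\<phi> \<psi> a b. \<lbrakk>\<phi> \<in> Cspace r; \<psi> \<in> Cspace r\<rbrakk> \<Longrightarrow> Q (a *\<^sub>R \<phi> + b *\<^sub>R \<psi>) = a *\<^sub>R Q \<phi> + b *\<^sub>R Q \<psi>"
    and Q_bounded_orbit: "\<And>\<phi> b. \<lbrakk>\<phi> \<in> Cspace r; \<And>t. 0 \<le> t \<Longrightarrow> norm (T t 0 \<phi>) \<le> b\<rbrakk> \<Longrightarrow> Q \<phi> = 0"
begin

lemma Q_diff: "\<phi> \<in> Cspace r \<Longrightarrow> \<psi> \<in> Cspace r \<Longrightarrow> Q (\<phi> - \<psi>) = Q \<phi> - Q \<psi>"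
  using Q_lincomb[of \<phi> \<psi> 1 "-1"] by simp

lemma Q_idem: "\<phi> \<in> Cspace r \<Longrightarrow> Q (Q \<phi>) = Q \<phi>"
  using Q_bounded_orbit[of "\<phi> - Q \<phi>" "k * norm \<phi>"] Q_compl[of \<phi>] Q_in[of \<phi>] Q_diff[of \<phi> "Q \<phi>"]
    subspace_diff[OF subspace_Cspace, of \<phi> r "Q \<phi>"] by simp

definition stable :: "real \<Rightarrow> (real \<Rightarrow>\<^sub>C (real^'d)) set" where
  "stable s = {\<phi> \<in> Cspace r. \<exists>b. \<forall>t\<ge>s. norm (T t s \<phi>) \<le> b}"

definition unstable0 :: "(real \<Rightarrow>\<^sub>C (real^'d)) set" where
  "unstable0 = {\<xi> \<in> Cspace r. Q \<xi> = \<xi>}"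

lemma stable_in: "\<phi> \<in> stable s \<Longrightarrow> \<phi> \<in> Cspace r"
  by (simp add: stable_def)

lemma unstable0_in: "\<xi> \<in> unstable0 \<Longrightarrow> \<xi> \<in> Cspace r"
  by (simp add: unstable0_def)

lemma stable_lincomb:
  assumes "0 \<le> s" "\<phi> \<in> stable s" "\<psi> \<in> stable s" shows "a *\<^sub>R \<phi> + b *\<^sub>R \<psi> \<in> stable s"
proof -
  obtain B1 B2 where B: "\<And>t. s \<le> t \<Longrightarrow> norm (T t s \<phi>) \<le> B1" "\<And>t. s \<le> t \<Longrightarrow> norm (T t s \<psi>) \<le> B2"
    using assms(2,3) unfolding stable_def by blast
  have X: "\<phi> \<in> Cspace r" "\<psi> \<in> Cspace r" using assms stable_in by auto
  have "norm (T t s (a *\<^sub>R \<phi> + b *\<^sub>R \<psi>)) \<le> \<bar>a\<bar> * B1 + \<bar>b\<bar> * B2" if t: "s \<le> t" for t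
    unfolding T_lincomb[OF assms(1) t X]
    by (intro norm_triangle_mono) (auto intro!: mult_left_mono B t)
  then show ?thesis using X unfolding stable_def by auto
qed

lemma unstable0_lincomb:
  "\<xi> \<in> unstable0 \<Longrightarrow> \<eta> \<in> unstable0 \<Longrightarrow> a *\<^sub>R \<xi> + b *\<^sub>R \<eta> \<in> unstable0"
  unfolding unstable0_def by (auto simp: Q_lincomb)

lemma stable_iff:
  assumes "0 \<le> s" "s \<le> t" "\<phi> \<in> Cspace r"
  shows "T t s \<phi> \<in> stable t \<longleftrightarrow> \<phi> \<in> stable s"
proof
  assume "T t s \<phi> \<in> stable t"
  then obtain b where b: "\<And>u. t \<le> u \<Longrightarrow> norm (T u t (T t s \<phi>)) \<le> b" unfolding stable_def by blast
  have "norm (T u s \<phi>) \<le> max b (growth (t - s) * norm \<phi>)" if u: "s \<le> u" for u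
  proof (cases "t \<le> u")
    case True
    then show ?thesis using b[of u] T_comp[of s t u \<phi>] assms by simp
  next
    case False
    have "growth (u - s) * norm \<phi> \<le> growth (t - s) * norm \<phi>"
      using False by (intro mult_right_mono growth_mono) auto
    then show ?thesis using T_bound[OF assms(1) u assms(3)] by simp
  qed
  then show "\<phi> \<in> stable s" using assms(3) unfolding stable_def by blast
next
  assume "\<phi> \<in> stable s"
  then obtain b where b: "\<And>u. s \<le> u \<Longrightarrow> norm (T u s \<phi>) \<le> b" unfolding stable_def by blast
  have "norm (T u t (T t s \<phi>)) \<le> b" if "t \<le> u" for u
    using b[of u] T_comp[of s t u \<phi>] assms that by simp
  then show "T t s \<phi> \<in> stable t" using assms unfolding stable_def by blast
qed

lemma unstable0_stable:
  assumes "0 \<le> s" "\<xi> \<in> unstable0" "T s 0 \<xi> \<in> stable s" shows "\<xi> = 0"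
proof -
  have "\<xi> \<in> stable 0" using stable_iff[of 0 s \<xi>] assms unstable0_in by simp
  then have "Q \<xi> = 0" using Q_bounded_orbit[of \<xi>] unfolding stable_def by blast
  then show ?thesis using assms(2) by (simp add: unstable0_def)
qed

text \<open>
  The key estimate. A bounded approximate solution \<open>y\<close> is shadowed by a solution through some \<open>\<xi>\<close> that
  is bounded as well, so \<open>Q \<xi> = 0\<close>. As \<open>y\<close> starts in the range of \<open>Q\<close>, the initial segment of \<open>y\<close> is \<open>- Q\<close>
  of the small initial distance, hence small. Thus the size of \<open>y\<close> is controlled by its defect alone.
\<close>

lemma pseudo_solution_bound:
  "\<exists>K3\<ge>0. \<forall>y c. pseudo_solution y c \<longrightarrow> 0 < c \<longrightarrow> seg r y 0 \<in> unstable0 \<longrightarrow>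
     (\<exists>B. \<forall>t\<ge>0. norm (seg r y t) \<le> B) \<longrightarrow> (\<forall>t\<ge>0. norm (seg r y t) \<le> K3 * c)"
proof (intro exI[of _ "K + k * (K + k * K)"] conjI allI impI)
  show "0 \<le> K + k * (K + k * K)" using K k by simp
  fix y c t
  assume y: "pseudo_solution y c" and c: "0 < c" and y0: "seg r y 0 \<in> unstable0"
    and B: "\<exists>B. \<forall>t\<ge>0. norm (seg r y t) \<le> B" and t: "(0::real) \<le> t"
  obtain \<xi> where \<xi>: "\<xi> \<in> Cspace r" "\<And>t. 0 \<le> t \<Longrightarrow> norm (T t 0 \<xi> - seg r y t) \<le> K * c"
    using shadow[OF y c] by blast
  obtain B where "\<And>t. 0 \<le> t \<Longrightarrow> norm (seg r y t) \<le> B" using B by blast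
  then have "norm (T t 0 \<xi>) \<le> K * c + B" if "0 \<le> t" for t
    using \<xi>(2)[OF that] that norm_triangle_sub[of "T t 0 \<xi>" "seg r y t"] by fastforce
  then have Q\<xi>: "Q \<xi> = 0" using Q_bounded_orbit[OF \<xi>(1)] by blast
  define \<psi> where "\<psi> = seg r y 0"
  have \<psi>: "\<psi> \<in> Cspace r" "Q \<psi> = \<psi>" using y0 by (auto simp: \<psi>_def unstable0_def)
  have d: "norm (\<xi> - \<psi>) \<le> K * c" using \<xi>(2)[of 0] T_refl[of 0 \<xi>] \<xi>(1) by (simp add: \<psi>_def)
  have "norm \<psi> \<le> k * norm (\<xi> - \<psi>)"
    using Q_bound[of "\<xi> - \<psi>"] Q_diff[OF \<xi>(1) \<psi>(1)] Q\<xi> \<psi> \<xi>(1) by auto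
  also have "\<dots> \<le> k * (K * c)" using d k by (intro mult_left_mono)
  finally have "norm \<xi> \<le> K * c + k * (K * c)" using d norm_triangle_sub[of \<xi> \<psi>] by linarith
  then have "k * norm \<xi> \<le> k * (K * c + k * (K * c))" using k by (intro mult_left_mono)
  moreover have "norm (T t 0 \<xi>) \<le> k * norm \<xi>" using Q_compl[OF \<xi>(1) t] Q\<xi> by simp
  moreover have "norm (seg r y t) \<le> norm (T t 0 \<xi>) + K * c"
    using \<xi>(2)[OF t] norm_triangle_sub[of "seg r y t" "T t 0 \<xi>"] by (simp add: norm_minus_commute)
  ultimately show "norm (seg r y t) \<le> (K + k * (K + k * K)) * c" by (simp add: algebra_simps)
qed

text \<open>
  The part \<open>\<zeta> - Q \<zeta>\<close> of the vector \<open>\<zeta>\<close> given by the splitting has a uniformly bounded orbit and can be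
  moved to the stable summand.
\<close>

lemma splitting_unstable0:
  "\<exists>K4>0. \<forall>s\<ge>0. \<forall>\<phi>\<in>Cspace r. \<exists>\<xi>\<in>unstable0.
     (\<forall>t. 0 \<le> t \<and> t \<le> s \<longrightarrow> norm (T t 0 \<xi>) \<le> K4 * norm \<phi>) \<and>
     (\<forall>t\<ge>s. norm (T t s (\<phi> - T s 0 \<xi>)) \<le> K4 * norm \<phi>)"
proof -
  obtain K2 where K2: "0 \<le> K2" and split: "\<And>s \<phi>. \<lbrakk>0 \<le> s; \<phi> \<in> Cspace r\<rbrakk> \<Longrightarrow> \<exists>\<xi>\<in>Cspace r.
     (\<forall>t. 0 \<le> t \<and> t \<le> s \<longrightarrow> norm (T t 0 \<xi>) \<le> K2 * norm \<phi>) \<and>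
     (\<forall>t\<ge>s. norm (T t s (\<phi> - T s 0 \<xi>)) \<le> K2 * norm \<phi>)"
    using splitting by blast
  have "\<exists>\<xi>\<in>unstable0.
     (\<forall>t. 0 \<le> t \<and> t \<le> s \<longrightarrow> norm (T t 0 \<xi>) \<le> (K2 + k * K2 + 1) * norm \<phi>) \<and>
     (\<forall>t\<ge>s. norm (T t s (\<phi> - T s 0 \<xi>)) \<le> (K2 + k * K2 + 1) * norm \<phi>)"
    if s: "0 \<le> s" and \<phi>: "\<phi> \<in> Cspace r" for s \<phi>
  proof -
    obtain \<zeta> where \<zeta>: "\<zeta> \<in> Cspace r" "\<And>t. \<lbrakk>0 \<le> t; t \<le> s\<rbrakk> \<Longrightarrow> norm (T t 0 \<zeta>) \<le> K2 * norm \<phi>"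
      "\<And>t. s \<le> t \<Longrightarrow> norm (T t s (\<phi> - T s 0 \<zeta>)) \<le> K2 * norm \<phi>"
      using split[OF s \<phi>] by blast
    have U: "Q \<zeta> \<in> unstable0" using Q_idem Q_in \<zeta>(1) by (simp add: unstable0_def)
    have QX: "Q \<zeta> \<in> Cspace r" "\<zeta> - Q \<zeta> \<in> Cspace r" using Q_in \<zeta>(1) by auto
    have "norm \<zeta> \<le> K2 * norm \<phi>" using \<zeta>(2)[of 0] T_refl[of 0 \<zeta>] \<zeta>(1) s by simp
    then have "k * norm \<zeta> \<le> k * (K2 * norm \<phi>)" using k by (intro mult_left_mono)
    then have diff: "norm (T t 0 (\<zeta> - Q \<zeta>)) \<le> k * (K2 * norm \<phi>)" if "0 \<le> t" for t
      using Q_compl[OF \<zeta>(1) that] by linarith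
    have eq: "T t 0 (Q \<zeta>) = T t 0 \<zeta> - T t 0 (\<zeta> - Q \<zeta>)" if "0 \<le> t" for t
      using T_diff[of 0 t \<zeta> "Q \<zeta>"] that \<zeta>(1) QX by simp
    have "norm (T t 0 (Q \<zeta>)) \<le> (K2 + k * K2 + 1) * norm \<phi>" if "0 \<le> t" "t \<le> s" for t
      using \<zeta>(2)[OF that] diff[OF that(1)]
        norm_triangle_ineq4[of "T t 0 \<zeta>" "T t 0 (\<zeta> - Q \<zeta>)"] norm_ge_zero[of \<phi>]
      unfolding eq[OF that(1)] distrib_right mult.assoc by linarith
    moreover have "norm (T t s (\<phi> - T s 0 (Q \<zeta>))) \<le> (K2 + k * K2 + 1) * norm \<phi>" if t: "s \<le> t" for t
    proof -
      have X: "T s 0 \<zeta> \<in> Cspace r" "T s 0 (\<zeta> - Q \<zeta>) \<in> Cspace r" using s \<zeta>(1) QX by auto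
      have "\<phi> - T s 0 \<zeta> \<in> Cspace r" using \<phi> X by auto
      then have "T t s ((\<phi> - T s 0 \<zeta>) + T s 0 (\<zeta> - Q \<zeta>)) = T t s (\<phi> - T s 0 \<zeta>) + T t 0 (\<zeta> - Q \<zeta>)"
        using T_add[OF s t _ X(2)] T_comp[of 0 s t "\<zeta> - Q \<zeta>"] QX s t by simp
      moreover have "(\<phi> - T s 0 \<zeta>) + T s 0 (\<zeta> - Q \<zeta>) = \<phi> - T s 0 (Q \<zeta>)"
        unfolding eq[OF s] by simp
      ultimately have eqn: "T t s (\<phi> - T s 0 (Q \<zeta>)) = T t s (\<phi> - T s 0 \<zeta>) + T t 0 (\<zeta> - Q \<zeta>)" by simp
      show ?thesis
        using \<zeta>(3)[OF t] diff[OF order_trans[OF s t]] norm_ge_zero[of \<phi>]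
          norm_triangle_ineq[of "T t s (\<phi> - T s 0 \<zeta>)" "T t 0 (\<zeta> - Q \<zeta>)"]
        unfolding eqn distrib_right mult.assoc by linarith
    qed
    ultimately show ?thesis using U by blast
  qed
  moreover have "0 < K2 + k * K2 + 1" using K2 k by (simp add: add_nonneg_pos)
  ultimately show ?thesis by blast
qed

text \<open>
  \<open>R s \<phi>\<close> is the initial state at time \<open>0\<close>, taken in the unstable space, of the unstable component of
  \<open>\<phi>\<close> at time \<open>s\<close>. Going back to time \<open>0\<close> makes it independent of \<open>s\<close> along solutions.
\<close>

definition R :: "real \<Rightarrow> (real \<Rightarrow>\<^sub>C (real^'d)) \<Rightarrow> (real \<Rightarrow>\<^sub>C (real^'d))" where
  "R s \<phi> = (THE \<xi>. \<xi> \<in> unstable0 \<and> \<phi> - T s 0 \<xi> \<in> stable s)"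

lemma R_eqI:
  assumes "0 \<le> s" "\<phi> \<in> Cspace r" "\<xi> \<in> unstable0" "\<phi> - T s 0 \<xi> \<in> stable s"
  shows "R s \<phi> = \<xi>"
  unfolding R_def
proof (rule the_equality)
  fix \<eta> assume \<eta>: "\<eta> \<in> unstable0 \<and> \<phi> - T s 0 \<eta> \<in> stable s"
  have X: "\<xi> \<in> Cspace r" "\<eta> \<in> Cspace r" using assms \<eta> unstable0_in by auto
  have "T s 0 (\<eta> - \<xi>) = (\<phi> - T s 0 \<xi>) - (\<phi> - T s 0 \<eta>)"
    using T_diff[of 0 s \<eta> \<xi>] X assms(1) by simp
  also have "\<dots> \<in> stable s"
    using stable_lincomb[OF assms(1,4) conjunct2[OF \<eta>], of 1 "-1"] by simp
  finally have "\<eta> - \<xi> = 0"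
    using unstable0_lincomb[of \<eta> \<xi> 1 "-1"] \<eta> assms unstable0_stable[of s "\<eta> - \<xi>"] by simp
  then show "\<eta> = \<xi>" by simp
qed (use assms in auto)

definition P :: "real \<Rightarrow> (real \<Rightarrow>\<^sub>C (real^'d)) \<Rightarrow> (real \<Rightarrow>\<^sub>C (real^'d))" where
  "P s \<phi> = \<phi> - T s 0 (R s \<phi>)"

lemma R_P_bounds:
  obtains K4 where "0 < K4"
    and "\<And>s \<phi>. \<lbrakk>0 \<le> s; \<phi> \<in> Cspace r\<rbrakk> \<Longrightarrow> R s \<phi> \<in> unstable0"
    and "\<And>s \<phi>. \<lbrakk>0 \<le> s; \<phi> \<in> Cspace r\<rbrakk> \<Longrightarrow> P s \<phi> \<in> stable s"
    and "\<And>s \<phi> t. \<lbrakk>0 \<le> s; \<phi> \<in> Cspace r; 0 \<le> t; t \<le> s\<rbrakk> \<Longrightarrow> norm (T t 0 (R s \<phi>)) \<le> K4 * norm \<phi>"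
    and "\<And>s \<phi> t. \<lbrakk>0 \<le> s; \<phi> \<in> Cspace r; s \<le> t\<rbrakk> \<Longrightarrow> norm (T t s (P s \<phi>)) \<le> K4 * norm \<phi>"
proof -
  obtain K4 where K4: "0 < K4" and split: "\<And>s \<phi>. \<lbrakk>0 \<le> s; \<phi> \<in> Cspace r\<rbrakk> \<Longrightarrow> \<exists>\<xi>\<in>unstable0.
     (\<forall>t. 0 \<le> t \<and> t \<le> s \<longrightarrow> norm (T t 0 \<xi>) \<le> K4 * norm \<phi>) \<and>
     (\<forall>t\<ge>s. norm (T t s (\<phi> - T s 0 \<xi>)) \<le> K4 * norm \<phi>)"
    using splitting_unstable0 by blast
  have main: "R s \<phi> \<in> unstable0 \<and> P s \<phi> \<in> stable s \<and>
     (\<forall>t. 0 \<le> t \<and> t \<le> s \<longrightarrow> norm (T t 0 (R s \<phi>)) \<le> K4 * norm \<phi>) \<and>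
     (\<forall>t\<ge>s. norm (T t s (P s \<phi>)) \<le> K4 * norm \<phi>)" if s: "0 \<le> s" and \<phi>: "\<phi> \<in> Cspace r" for s \<phi>
  proof -
    obtain \<xi> where \<xi>: "\<xi> \<in> unstable0" "\<forall>t. 0 \<le> t \<and> t \<le> s \<longrightarrow> norm (T t 0 \<xi>) \<le> K4 * norm \<phi>"
      "\<forall>t\<ge>s. norm (T t s (\<phi> - T s 0 \<xi>)) \<le> K4 * norm \<phi>"
      using split[OF s \<phi>] by blast
    have "\<phi> - T s 0 \<xi> \<in> stable s"
      using \<phi> \<xi> s unstable0_in[OF \<xi>(1)] unfolding stable_def by auto
    moreover from this have "R s \<phi> = \<xi>" by (rule R_eqI[OF s \<phi> \<xi>(1)])
    ultimately show ?thesis using \<xi> unfolding P_def by simp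
  qed
  show thesis by (rule that[OF K4]) (simp_all add: main)
qed

lemma R_in: "0 \<le> s \<Longrightarrow> \<phi> \<in> Cspace r \<Longrightarrow> R s \<phi> \<in> unstable0"
  by (rule R_P_bounds)

lemma P_stable: "0 \<le> s \<Longrightarrow> \<phi> \<in> Cspace r \<Longrightarrow> P s \<phi> \<in> stable s"
  by (rule R_P_bounds)

lemma P_in: "0 \<le> s \<Longrightarrow> \<phi> \<in> Cspace r \<Longrightarrow> P s \<phi> \<in> Cspace r"
  using P_stable stable_in by blast

lemma R_stable: "0 \<le> s \<Longrightarrow> \<phi> \<in> stable s \<Longrightarrow> R s \<phi> = 0"
  using R_eqI[of s \<phi> 0] stable_in[of \<phi> s] Q_lincomb[of 0 0 0 0] by (simp add: T_zero unstable0_def)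

lemma P_stable_eq: "0 \<le> s \<Longrightarrow> \<phi> \<in> stable s \<Longrightarrow> P s \<phi> = \<phi>"
  by (simp add: P_def R_stable T_zero)

lemma R_unstable: "0 \<le> s \<Longrightarrow> \<xi> \<in> unstable0 \<Longrightarrow> R s (T s 0 \<xi>) = \<xi>"
  using unstable0_in[of \<xi>] by (intro R_eqI) (auto simp: stable_def T_zero)

lemma R_lincomb:
  assumes s: "0 \<le> s" and X: "\<phi> \<in> Cspace r" "\<psi> \<in> Cspace r"
  shows "R s (a *\<^sub>R \<phi> + b *\<^sub>R \<psi>) = a *\<^sub>R R s \<phi> + b *\<^sub>R R s \<psi>"
proof (rule R_eqI[OF s])
  have R: "R s \<phi> \<in> unstable0" "R s \<psi> \<in> unstable0" using R_in s X by auto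
  show "a *\<^sub>R \<phi> + b *\<^sub>R \<psi> \<in> Cspace r" using X by auto
  show "a *\<^sub>R R s \<phi> + b *\<^sub>R R s \<psi> \<in> unstable0" using unstable0_lincomb R by blast
  have "a *\<^sub>R \<phi> + b *\<^sub>R \<psi> - T s 0 (a *\<^sub>R R s \<phi> + b *\<^sub>R R s \<psi>) = a *\<^sub>R P s \<phi> + b *\<^sub>R P s \<psi>"
    using T_lincomb[of 0 s "R s \<phi>" "R s \<psi>" a b] unstable0_in[OF R(1)] unstable0_in[OF R(2)] s
    by (simp add: P_def algebra_simps)
  then show "a *\<^sub>R \<phi> + b *\<^sub>R \<psi> - T s 0 (a *\<^sub>R R s \<phi> + b *\<^sub>R R s \<psi>) \<in> stable s"
    using stable_lincomb[OF s P_stable[OF s X(1)] P_stable[OF s X(2)]] by simp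
qed

lemma P_lincomb:
  assumes s: "0 \<le> s" and X: "\<phi> \<in> Cspace r" "\<psi> \<in> Cspace r"
  shows "P s (a *\<^sub>R \<phi> + b *\<^sub>R \<psi>) = a *\<^sub>R P s \<phi> + b *\<^sub>R P s \<psi>"
  using T_lincomb[of 0 s "R s \<phi>" "R s \<psi>" a b] unstable0_in[OF R_in[OF s X(1)]] unstable0_in[OF R_in[OF s X(2)]] s
  by (simp add: P_def R_lincomb[OF s X] algebra_simps)

text \<open>
  A solution that starts in the unstable space at time \<open>0\<close> and one that is bounded keep these properties
  when restarted at a later time, so the decomposition is invariant.
\<close>

lemma P_T:
  assumes s: "0 \<le> s" "s \<le> t" and \<phi>: "\<phi> \<in> Cspace r"
  shows "P t (T t s \<phi>) = T t s (P s \<phi>)"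
proof -
  have R: "R s \<phi> \<in> unstable0" "R s \<phi> \<in> Cspace r" using R_in unstable0_in s \<phi> by auto
  have eq: "T t s (P s \<phi>) = T t s \<phi> - T t 0 (R s \<phi>)"
    using T_diff[of s t \<phi> "T s 0 (R s \<phi>)"] T_comp[of 0 s t "R s \<phi>"] R s \<phi> by (auto simp: P_def)
  moreover have "T t s (P s \<phi>) \<in> stable t"
    using stable_iff[OF s P_in[OF s(1) \<phi>]] P_stable[OF s(1) \<phi>] by simp
  ultimately have "R t (T t s \<phi>) = R s \<phi>" using R s \<phi> by (intro R_eqI) auto
  then show ?thesis using eq by (simp add: P_def)
qed

lemma Cker_P:
  assumes s: "0 \<le> s" shows "Cker r (P s) = T s 0 ` unstable0"
proof (intro equalityI subsetI)
  fix \<phi> assume "\<phi> \<in> Cker r (P s)"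
  then have "\<phi> = T s 0 (R s \<phi>)" "\<phi> \<in> Cspace r" by (auto simp: Cker_def P_def)
  then show "\<phi> \<in> T s 0 ` unstable0" using R_in[OF s] by blast
next
  fix \<phi> assume "\<phi> \<in> T s 0 ` unstable0"
  then obtain \<xi> where \<xi>: "\<xi> \<in> unstable0" "\<phi> = T s 0 \<xi>" by blast
  then show "\<phi> \<in> Cker r (P s)"
    using R_unstable[OF s \<xi>(1)] unstable0_in[OF \<xi>(1)] s by (auto simp: Cker_def P_def)
qed

lemma bij_betw_Cker:
  assumes s: "0 \<le> s" "s \<le> t" shows "bij_betw (T t s) (Cker r (P s)) (Cker r (P t))"
proof (rule bij_betw_imageI)
  have comp: "T t s (T s 0 \<xi>) = T t 0 \<xi>" if "\<xi> \<in> unstable0" for \<xi>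
    using T_comp[of 0 s t \<xi>] s unstable0_in[OF that] by simp
  show "inj_on (T t s) (Cker r (P s))"
    unfolding Cker_P[OF s(1)]
  proof (rule inj_onI, elim imageE)
    fix \<phi> \<psi> \<xi> \<eta> assume *: "T t s \<phi> = T t s \<psi>" "\<phi> = T s 0 \<xi>" "\<psi> = T s 0 \<eta>" "\<xi> \<in> unstable0" "\<eta> \<in> unstable0"
    then have "T t 0 \<xi> = T t 0 \<eta>" using comp by simp
    then have "R t (T t 0 \<xi>) = R t (T t 0 \<eta>)" by simp
    then have "\<xi> = \<eta>" using R_unstable[of t] * s by simp
    then show "\<phi> = \<psi>" using * by simp
  qed
  show "T t s ` Cker r (P s) = Cker r (P t)"
    using s comp by (simp add: Cker_P image_image)
qed

text \<open>
  Multiply a bounded solution \<open>u\<close> on \<open>[s,\<infinity>)\<close> by a ramp of height \<open>n\<close>. The product is bounded, vanishes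
  at time \<open>0\<close>, and its defect is controlled by \<open>norm \<phi>\<close> independently of \<open>n\<close>. The key estimate bounds
  \<open>n * u\<close> after the ramp by the same constant, so for large \<open>n\<close> the solution has been halved.
\<close>

lemma stable_decay:
  "\<exists>D \<mu>. 0 < D \<and> 0 < \<mu> \<and> (\<forall>s\<ge>0. \<forall>\<phi>\<in>stable s. \<forall>t\<ge>s. norm (T t s \<phi>) \<le> D * exp (- \<mu> * (t - s)) * norm \<phi>)"
proof -
  obtain K4 where K4: "0 < K4" and K4_bound: "\<And>s \<phi> t. \<lbrakk>0 \<le> s; \<phi> \<in> Cspace r; s \<le> t\<rbrakk> \<Longrightarrow> norm (T t s (P s \<phi>)) \<le> K4 * norm \<phi>"
    by (rule R_P_bounds) (rule that; assumption)
  obtain K3 where K3: "0 \<le> K3" and K3_bound: "\<And>y c t B. \<lbrakk>pseudo_solution y c; 0 < c; seg r y 0 \<in> unstable0;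
      \<And>t. 0 \<le> t \<Longrightarrow> norm (seg r y t) \<le> B; 0 \<le> t\<rbrakk> \<Longrightarrow> norm (seg r y t) \<le> K3 * c"
    using pseudo_solution_bound by metis
  have stab: "norm (T t s \<phi>) \<le> K4 * norm \<phi>" if "0 \<le> s" "\<phi> \<in> stable s" "s \<le> t" for s \<phi> t
    using K4_bound[of s \<phi> t] P_stable_eq[of s \<phi>] stable_in that by simp
  have Mr: "0 < 1 + M * r" using M r by (simp add: add_pos_nonneg)
  \<comment> \<open>the height of the ramp: at least twice the constant that will bound \<open>n * u\<close>\<close>
  define n where "n = max 1 (2 * (K3 * ((1 + M * r) * K4)))"
  have n: "1 \<le> n" "2 * (K3 * ((1 + M * r) * K4)) \<le> n" by (auto simp: n_def)
  define \<tau> where "\<tau> = n + 2 + r"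
  have \<tau>: "0 < \<tau>" using n r by (simp add: \<tau>_def)
  have half: "norm (T t s \<phi>) \<le> norm \<phi> / 2" if s: "0 \<le> s" and \<phi>: "\<phi> \<in> stable s" and t: "s + \<tau> \<le> t" for s \<phi> t
  proof (cases "\<phi> = 0")
    case True
    then show ?thesis using T_zero[of s t] s t \<tau> by simp
  next
    case False
    obtain u where u: "is_solution r L s u" "seg r u s = \<phi>" "\<And>t. s \<le> t \<Longrightarrow> T t s \<phi> = seg r u t"
      using solution_through[OF s stable_in[OF \<phi>]] by blast
    define h where "h t = ramp n (t - (s + 1))" for t
    define y where "y t = h t *\<^sub>R u t" for t
    define c where "c = (1 + M * r) * (K4 * norm \<phi>)"
    have ub: "norm (seg r u t) \<le> K4 * norm \<phi>" if "s \<le> t" for t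
      using stab[OF s \<phi> that] u(3)[OF that] by simp
    have pseudo: "pseudo_solution y c"
      unfolding y_def c_def
    proof (rule pseudo_solution_multiple[OF u(1) s, where h' = "\<lambda>t. ramp' n (t - (s + 1))" and a = "s + 1" and b = "s + n + 2"])
      show "(h has_real_derivative ramp' n (t - (s + 1))) (at t)" for t
        unfolding h_def by (rule DERIV_ramp)
      show "continuous_on UNIV (\<lambda>t. ramp' n (t - (s + 1)))"
        by (rule continuous_on_compose2[OF continuous_on_ramp'[of UNIV]]) (auto intro!: continuous_intros)
      show "\<bar>ramp' n (t - (s + 1))\<bar> \<le> 1" for t using ramp'_bounds[OF n(1), of "t - (s + 1)"] by simp
      show "ramp' n (t - (s + 1)) = 0" if "t \<le> s + 1 \<or> s + n + 2 \<le> t" for t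
        using that n by (intro ramp'_eq_0) auto
      show "s = 0 \<or> s < s + 1 \<and> (\<forall>t\<le>s + 1. h t = 0)" using n by (auto simp: h_def ramp_start)
    qed (use K4 ub in auto)
    have c: "0 < c" using Mr K4 False by (simp add: c_def)
    have zero: "seg r y t = 0" if "t \<le> s + 1" for t
    proof -
      show ?thesis
        using that n by (intro seg_eq_0[OF r]) (auto simp: y_def h_def ramp_start)
    qed
    have y0: "seg r y 0 \<in> unstable0"
      using zero[of 0] s Q_lincomb[of 0 0 0 0] by (simp add: unstable0_def)
    have yb: "norm (seg r y t) \<le> n * (K4 * norm \<phi>)" if t: "0 \<le> t" for t
    proof (cases "t \<le> s + 1")
      case True
      then show ?thesis using zero n K4 by simp
    next
      case False
      show ?thesis
      proof (rule seg_norm_le[OF r pseudo_solution_continuous[OF pseudo t]])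
        fix \<sigma> assume \<sigma>: "\<sigma> \<in> {t - r..t}"
        have "norm (u \<sigma>) \<le> norm (seg r u t)"
          using False \<sigma> by (intro norm_le_seg[OF r is_solution_continuous[OF u(1)]]) auto
        also have "\<dots> \<le> K4 * norm \<phi>" using ub False by simp
        finally show "norm (y \<sigma>) \<le> n * (K4 * norm \<phi>)"
          unfolding y_def norm_scaleR h_def using ramp_bounds[OF n(1), of "\<sigma> - (s + 1)"] n
          by (intro mult_mono) auto
      qed
    qed
    have "0 \<le> t" using t s \<tau> by simp
    then have "norm (seg r y t) \<le> K3 * c" by (intro K3_bound[OF pseudo c y0]) (erule yb)
    moreover have "seg r y t = seg r (\<lambda>\<tau>. n *\<^sub>R u \<tau>) t"
      using t n by (intro seg_cong[OF r]) (auto simp: y_def h_def \<tau>_def ramp_end)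
    then have "seg r y t = n *\<^sub>R T t s \<phi>"
      using u(3)[of t] t \<tau> seg_scaleR[OF r is_solution_continuous[OF u(1), of t t]] by simp
    ultimately have "n * norm (T t s \<phi>) \<le> (K3 * ((1 + M * r) * K4)) * norm \<phi>"
      using n by (simp add: c_def mult.assoc)
    also have "\<dots> \<le> n / 2 * norm \<phi>" using n(2) by (intro mult_right_mono) auto
    finally show ?thesis using n(1) by (simp add: field_simps)
  qed
  have "norm (T t s \<phi>) \<le> (2 * K4) * exp (- (ln 2 / \<tau>) * (t - s)) * norm \<phi>"
    if s: "0 \<le> s" and \<phi>: "\<phi> \<in> stable s" and t: "s \<le> t" for s \<phi> t
  proof -
    define g where "g a = norm (T (s + a) s \<phi>)" for a
    have X: "\<phi> \<in> Cspace r" by (rule stable_in[OF \<phi>])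
    have orbit: "T (s + a) s \<phi> \<in> stable (s + a)" "T (s + b) (s + a) (T (s + a) s \<phi>) = T (s + b) s \<phi>"
      if "0 \<le> a" "a \<le> b" for a b
      using stable_iff[of s "s + a" \<phi>] T_comp[of s "s + a" "s + b" \<phi>] that s \<phi> X by auto
    have "g (t - s) \<le> 2 * K4 * exp (- (ln 2 / \<tau>) * (t - s)) * g 0"
    proof (rule halving_imp_exponential[OF \<tau>, where l = "t - s"])
      fix a b :: real assume a: "0 \<le> a"
      show "g b \<le> K4 * g a" if "a \<le> b"
        using stab[OF _ orbit(1)[OF a that], of "s + b"] orbit(2)[OF a that] a s that by (simp add: g_def)
      show "g b \<le> g a / 2" if "a + \<tau> \<le> b"
        using half[OF _ orbit(1)[OF a], of b "s + b"] orbit(2)[OF a, of b] a s that \<tau> by (simp add: g_def)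
    qed (use K4 t in \<open>auto simp: g_def\<close>)
    then show ?thesis using T_refl[OF s X] by (simp add: g_def)
  qed
  moreover have "0 < 2 * K4" "0 < ln 2 / \<tau>" using K4 \<tau> by auto
  ultimately show ?thesis by blast
qed

text \<open>
  The same idea with a descending ramp, which multiplies a solution in the unstable direction by \<open>n\<close> up
  to time \<open>s - n - 1\<close> and by \<open>0\<close> from time \<open>s\<close> on: the product is bounded although \<open>u\<close> need not be, and it
  starts in the unstable space. On the range of the ramp \<open>u\<close> is controlled by \<open>u\<^sub>s\<close>, and on \<open>[s,s+r]\<close>, where
  the delay still sees the ramp, by the growth bound.
\<close>

lemma unstable_decay:
  "\<exists>D \<mu>. 0 < D \<and> 0 < \<mu> \<and> (\<forall>\<xi>\<in>unstable0. \<forall>t\<ge>0. \<forall>s\<ge>t. norm (T t 0 \<xi>) \<le> D * exp (- \<mu> * (s - t)) * norm (T s 0 \<xi>))"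
proof -
  obtain K4 where K4: "0 < K4" and K4_bound: "\<And>s \<phi> t. \<lbrakk>0 \<le> s; \<phi> \<in> Cspace r; 0 \<le> t; t \<le> s\<rbrakk> \<Longrightarrow> norm (T t 0 (R s \<phi>)) \<le> K4 * norm \<phi>"
    by (rule R_P_bounds) (rule that; assumption)
  obtain K3 where K3: "0 \<le> K3" and K3_bound: "\<And>y c t B. \<lbrakk>pseudo_solution y c; 0 < c; seg r y 0 \<in> unstable0;
      \<And>t. 0 \<le> t \<Longrightarrow> norm (seg r y t) \<le> B; 0 \<le> t\<rbrakk> \<Longrightarrow> norm (seg r y t) \<le> K3 * c"
    using pseudo_solution_bound by metis
  have unst: "norm (T t 0 \<xi>) \<le> K4 * norm (T s 0 \<xi>)" if "\<xi> \<in> unstable0" "0 \<le> t" "t \<le> s" for s \<xi> t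
    using K4_bound[of s "T s 0 \<xi>" t] R_unstable[of s \<xi>] T_in[of 0 s \<xi>] unstable0_in[OF that(1)] that by simp
  have Mr: "0 < 1 + M * r" using M r by (simp add: add_pos_nonneg)
  define H where "H = K4 + growth r"
  have H: "K4 \<le> H" "growth r \<le> H" "0 < H" using K4 growth_pos[of r] by (auto simp: H_def)
  \<comment> \<open>the height of the ramp: at least twice the constant that will bound \<open>n * u\<close>\<close>
  define n where "n = max 1 (2 * (K3 * ((1 + M * r) * H)))"
  have n: "1 \<le> n" "2 * (K3 * ((1 + M * r) * H)) \<le> n" by (auto simp: n_def)
  define \<tau> where "\<tau> = n + 1"
  have \<tau>: "0 < \<tau>" using n by (simp add: \<tau>_def)
  have half: "norm (T t 0 \<xi>) \<le> norm (T s 0 \<xi>) / 2" if \<xi>: "\<xi> \<in> unstable0" and t: "0 \<le> t" "t + \<tau> \<le> s" for s \<xi> t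
  proof (cases "T s 0 \<xi> = 0")
    case True
    then show ?thesis using unst[OF \<xi> t(1), of s] t \<tau> by simp
  next
    case False
    have X: "\<xi> \<in> Cspace r" by (rule unstable0_in[OF \<xi>])
    obtain u where u: "is_solution r L 0 u" "seg r u 0 = \<xi>" "\<And>t. 0 \<le> t \<Longrightarrow> T t 0 \<xi> = seg r u t"
      using solution_through[OF order_refl X] by blast
    define a where "a = s - n - 1"
    have a: "t \<le> a" "0 \<le> a" "a \<le> s" using t n by (auto simp: a_def \<tau>_def)
    define h where "h t = n - ramp n (t - a)" for t
    define y where "y t = h t *\<^sub>R u t" for t
    define c where "c = (1 + M * r) * (H * norm (T s 0 \<xi>))"
    have ub: "norm (seg r u v) \<le> H * norm (T s 0 \<xi>)" if v: "0 \<le> v" "v \<le> s + r" for v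
    proof (cases "v \<le> s")
      case True
      then have "norm (seg r u v) \<le> K4 * norm (T s 0 \<xi>)" using unst[OF \<xi> v(1), of s] u(3)[OF v(1)] by simp
      also have "\<dots> \<le> H * norm (T s 0 \<xi>)" using H by (intro mult_right_mono) auto
      finally show ?thesis .
    next
      case sv: False
      have "norm (T v s (T s 0 \<xi>)) \<le> growth (v - s) * norm (T s 0 \<xi>)"
        using sv t \<tau> X by (intro T_bound) auto
      also have "\<dots> \<le> H * norm (T s 0 \<xi>)"
        using v growth_mono[of "v - s" r] H by (intro mult_right_mono) auto
      finally show ?thesis using T_comp[of 0 s v \<xi>] u(3)[OF v(1)] sv t \<tau> X by simp
    qed
    have pseudo: "pseudo_solution y c"
      unfolding y_def c_def
    proof (rule pseudo_solution_multiple[OF u(1) order_refl, where h' = "\<lambda>t. - ramp' n (t - a)" and a = a and b = s])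
      show "(h has_real_derivative - ramp' n (t - a)) (at t)" for t
        unfolding h_def using DERIV_diff[OF DERIV_const DERIV_ramp] by fastforce
      show "continuous_on UNIV (\<lambda>t. - ramp' n (t - a))"
        by (intro continuous_intros continuous_on_compose2[OF continuous_on_ramp'[of UNIV]]) auto
      show "\<bar>- ramp' n (t - a)\<bar> \<le> 1" for t using ramp'_bounds[OF n(1), of "t - a"] by simp
      show "- ramp' n (t - a) = 0" if "t \<le> a \<or> s \<le> t" for t
        using ramp'_eq_0[OF n(1), of "t - a"] that by (auto simp: a_def)
    qed (use H ub a in auto)
    have start: "seg r y v = n *\<^sub>R T v 0 \<xi>" if v: "0 \<le> v" "v \<le> a" for v
    proof -
      have "seg r y v = seg r (\<lambda>\<tau>. n *\<^sub>R u \<tau>) v"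
        using v n by (intro seg_cong[OF r]) (auto simp: y_def h_def ramp_start)
      then show ?thesis using u(3)[OF v(1)] seg_scaleR[OF r is_solution_continuous[OF u(1), of v v]] v by simp
    qed
    have c: "0 < c" using Mr H False by (simp add: c_def)
    have y0: "seg r y 0 \<in> unstable0"
      using start[of 0] a T_refl[of 0 \<xi>] X unstable0_lincomb[OF \<xi> \<xi>, of n 0] by simp
    have yb: "norm (seg r y v) \<le> n * (H * norm (T s 0 \<xi>))" if v: "0 \<le> v" for v
    proof (rule seg_norm_le[OF r pseudo_solution_continuous[OF pseudo v]])
      fix \<sigma> assume \<sigma>: "\<sigma> \<in> {v - r..v}"
      show "norm (y \<sigma>) \<le> n * (H * norm (T s 0 \<xi>))"
      proof (cases "s \<le> \<sigma>")
        case True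
        then have "ramp n (\<sigma> - a) = n" using n by (intro ramp_end) (auto simp: a_def)
        then show ?thesis using n H by (simp add: y_def h_def)
      next
        case sv: False
        have "norm (u \<sigma>) \<le> norm (seg r u v)"
          using v \<sigma> by (intro norm_le_seg[OF r is_solution_continuous[OF u(1)]]) auto
        also have "\<dots> \<le> H * norm (T s 0 \<xi>)" using ub v \<sigma> sv by simp
        finally show ?thesis
          unfolding y_def norm_scaleR h_def using ramp_bounds[OF n(1), of "\<sigma> - a"] n
          by (intro mult_mono) auto
      qed
    qed
    have "norm (seg r y t) \<le> K3 * c" using t(1) by (intro K3_bound[OF pseudo c y0]) (erule yb)
    then have "n * norm (T t 0 \<xi>) \<le> (K3 * ((1 + M * r) * H)) * norm (T s 0 \<xi>)"
      using n start[OF t(1) a(1)] by (simp add: c_def mult.assoc)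
    also have "\<dots> \<le> n / 2 * norm (T s 0 \<xi>)" using n(2) by (intro mult_right_mono) auto
    finally show ?thesis using n(1) by (simp add: field_simps)
  qed
  have "norm (T t 0 \<xi>) \<le> (2 * K4) * exp (- (ln 2 / \<tau>) * (s - t)) * norm (T s 0 \<xi>)"
    if \<xi>: "\<xi> \<in> unstable0" and t: "0 \<le> t" "t \<le> s" for s \<xi> t
  proof -
    define g where "g a = norm (T (s - a) 0 \<xi>)" for a
    have "g (s - t) \<le> 2 * K4 * exp (- (ln 2 / \<tau>) * (s - t)) * g 0"
    proof (rule halving_imp_exponential[OF \<tau>, where l = "s - t"])
      fix a b :: real assume a: "0 \<le> a" and b: "b \<le> s - t"
      show "g b \<le> K4 * g a" if "a \<le> b"
        using unst[OF \<xi>, of "s - b" "s - a"] a b t that by (simp add: g_def)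
      show "g b \<le> g a / 2" if "a + \<tau> \<le> b"
        using half[OF \<xi>, of "s - b" "s - a"] a b t that by (simp add: g_def)
    qed (use K4 t in \<open>auto simp: g_def\<close>)
    then show ?thesis by (simp add: g_def)
  qed
  moreover have "0 < 2 * K4" "0 < ln 2 / \<tau>" using K4 \<tau> by auto
  ultimately show ?thesis by blast
qed

text \<open>
  For \<open>t \<le> s\<close> the backward operator applied to the unstable component of \<open>\<phi>\<close> is \<open>T t 0 (R s \<phi>)\<close>, to
  which the decay in the unstable direction applies.
\<close>

theorem dichotomy_estimates:
  "\<exists>D \<mu>. 0 < D \<and> 0 < \<mu> \<and>
     (\<forall>s\<ge>0. \<forall>\<phi>\<in>Cspace r. \<forall>t\<ge>s. norm (T t s (P s \<phi>)) \<le> D * exp (- \<mu> * (t - s)) * norm \<phi>) \<and>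
     (\<forall>s\<ge>0. \<forall>\<phi>\<in>Cspace r. \<forall>t\<ge>0. t \<le> s \<longrightarrow>
        inv_into (Cker r (P t)) (T s t) (\<phi> - P s \<phi>) \<in> Cspace r \<and>
        norm (inv_into (Cker r (P t)) (T s t) (\<phi> - P s \<phi>)) \<le> D * exp (- \<mu> * (s - t)) * norm \<phi>)"
proof -
  obtain K4 where K4: "0 < K4"
    and R4: "\<And>s \<phi> t. \<lbrakk>0 \<le> s; \<phi> \<in> Cspace r; 0 \<le> t; t \<le> s\<rbrakk> \<Longrightarrow> norm (T t 0 (R s \<phi>)) \<le> K4 * norm \<phi>"
    and P4: "\<And>s \<phi> t. \<lbrakk>0 \<le> s; \<phi> \<in> Cspace r; s \<le> t\<rbrakk> \<Longrightarrow> norm (T t s (P s \<phi>)) \<le> K4 * norm \<phi>"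
    by (rule R_P_bounds) (rule that; assumption)
  obtain D1 \<mu>1 where D1: "0 < D1" "0 < \<mu>1"
    and dec1: "\<And>s \<phi> t. \<lbrakk>0 \<le> s; \<phi> \<in> stable s; s \<le> t\<rbrakk> \<Longrightarrow> norm (T t s \<phi>) \<le> D1 * exp (- \<mu>1 * (t - s)) * norm \<phi>"
    using stable_decay by blast
  obtain D2 \<mu>2 where D2: "0 < D2" "0 < \<mu>2"
    and dec2: "\<And>s \<xi> t. \<lbrakk>\<xi> \<in> unstable0; 0 \<le> t; t \<le> s\<rbrakk> \<Longrightarrow> norm (T t 0 \<xi>) \<le> D2 * exp (- \<mu>2 * (s - t)) * norm (T s 0 \<xi>)"
    using unstable_decay by blast
  define D where "D = max D1 D2 * K4"
  define \<mu> where "\<mu> = min \<mu>1 \<mu>2"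
  have weaken: "D' * exp (- \<mu>' * v) * x \<le> D * exp (- \<mu> * v) * norm \<phi>"
    if "0 \<le> v" "0 < D'" "D' \<le> max D1 D2" "\<mu> \<le> \<mu>'" "x \<le> K4 * norm \<phi>" "0 \<le> x" for D' \<mu>' v x and \<phi> :: "real \<Rightarrow>\<^sub>C (real^'d)"
  proof -
    have "D' * exp (- \<mu>' * v) * x \<le> max D1 D2 * exp (- \<mu> * v) * (K4 * norm \<phi>)"
      using that by (intro mult_mono) (auto intro: mult_right_mono)
    then show ?thesis by (simp add: D_def mult_ac)
  qed
  have est1: "norm (T t s (P s \<phi>)) \<le> D * exp (- \<mu> * (t - s)) * norm \<phi>" if "0 \<le> s" "\<phi> \<in> Cspace r" "s \<le> t" for s \<phi> t
    using dec1[OF that(1) P_stable[OF that(1,2)] that(3)]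
      weaken[of "t - s" D1 \<mu>1 "norm (P s \<phi>)" \<phi>] D1 that P4[OF that(1,2) order_refl] T_refl[OF that(1) P_in[OF that(1,2)]]
    by (simp add: \<mu>_def)
  have est2: "inv_into (Cker r (P t)) (T s t) (\<phi> - P s \<phi>) \<in> Cspace r \<and>
      norm (inv_into (Cker r (P t)) (T s t) (\<phi> - P s \<phi>)) \<le> D * exp (- \<mu> * (s - t)) * norm \<phi>"
    if s: "0 \<le> s" "\<phi> \<in> Cspace r" and t: "0 \<le> t" "t \<le> s" for s \<phi> t
  proof -
    have R: "R s \<phi> \<in> unstable0" "R s \<phi> \<in> Cspace r" using R_in unstable0_in s by auto
    have "\<phi> - P s \<phi> = T s t (T t 0 (R s \<phi>))"
      using T_comp[of 0 t s "R s \<phi>"] R t by (simp add: P_def)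
    moreover have "T t 0 (R s \<phi>) \<in> Cker r (P t)" using R Cker_P[OF t(1)] by blast
    ultimately have inv: "inv_into (Cker r (P t)) (T s t) (\<phi> - P s \<phi>) = T t 0 (R s \<phi>)"
      using inv_into_f_f[OF bij_betw_imp_inj_on[OF bij_betw_Cker[OF t]]] by simp
    have "norm (T t 0 (R s \<phi>)) \<le> D * exp (- \<mu> * (s - t)) * norm \<phi>"
      using dec2[OF R(1) t] weaken[of "s - t" D2 \<mu>2 "norm (T s 0 (R s \<phi>))" \<phi>] D2 t R4[OF s s(1) order_refl]
      by (simp add: \<mu>_def)
    then show ?thesis unfolding inv using R t by auto
  qed
  have "0 < D" "0 < \<mu>" using K4 D1 D2 by (auto simp: D_def \<mu>_def less_max_iff_disj)
  then show ?thesis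
    by (intro exI[of _ D] exI[of _ \<mu>] conjI allI ballI impI) (simp_all only: est1 est2)
qed

end

section \<open>From the Euclidean norm to an arbitrary norm\<close>

text \<open>
  The upper bound comes from expanding in the standard basis. It makes \<open>N\<close> continuous, and the lower
  bound is the minimum of \<open>N\<close> on the compact unit sphere.
\<close>

lemma is_norm_equivalent:
  fixes N :: "real^'d \<Rightarrow> real"
  assumes N: "is_norm N"
  obtains \<alpha> \<beta> where "0 < \<alpha>" "0 < \<beta>" "\<And>x. \<alpha> * norm x \<le> N x" "\<And>x. N x \<le> \<beta> * norm x"
proof -
  have N_simps: "\<And>x. 0 \<le> N x" "\<And>x. N x = 0 \<longleftrightarrow> x = 0" "\<And>x y. N (x + y) \<le> N x + N y" "\<And>c x. N (c *\<^sub>R x) = \<bar>c\<bar> * N x"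
    using N unfolding is_norm_def by blast+
  have N_sum: "N (\<Sum>i\<in>I. f i) \<le> (\<Sum>i\<in>I. N (f i))" if "finite I" for I :: "'d set" and f
    using that
  proof (induction I rule: finite_induct)
    case empty
    then show ?case using N_simps(2)[of 0] by simp
  next
    case (insert i I)
    then show ?case using N_simps(3)[of "f i" "sum f I"] by simp
  qed
  define \<beta> where "\<beta> = (\<Sum>i\<in>UNIV. N (axis i (1::real))) + 1"
  have upper: "N x \<le> \<beta> * norm x" for x
  proof -
    have "x = (\<Sum>i\<in>UNIV. (x $ i) *\<^sub>R axis i 1)" by (simp add: vec_eq_iff axis_def if_distrib cong: if_cong)
    then have "N x \<le> (\<Sum>i\<in>UNIV. \<bar>x $ i\<bar> * N (axis i 1))"
      using N_sum[of UNIV "\<lambda>i. (x $ i) *\<^sub>R axis i 1"] by (simp add: N_simps(4))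
    also have "\<dots> \<le> (\<Sum>i\<in>UNIV. norm x * N (axis i 1))"
      by (intro sum_mono mult_right_mono component_le_norm_cart N_simps)
    also have "\<dots> \<le> \<beta> * norm x" by (simp add: \<beta>_def sum_distrib_left[symmetric] algebra_simps)
    finally show ?thesis .
  qed
  have \<beta>: "0 < \<beta>" unfolding \<beta>_def using N_simps(1) by (intro add_nonneg_pos sum_nonneg) auto
  have "continuous_on (sphere 0 1) N"
  proof (rule lipschitz_on_continuous_on)
    have "\<bar>N x - N y\<bar> \<le> \<beta> * norm (x - y)" for x y
      using N_simps(3)[of "x - y" y] N_simps(3)[of "y - x" x] upper[of "x - y"] upper[of "y - x"]
      by (simp add: norm_minus_commute abs_le_iff)
    then show "\<beta>-lipschitz_on (sphere 0 1) N"
      using \<beta> by (intro lipschitz_onI) (auto simp: dist_norm)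
  qed
  moreover have "axis (undefined :: 'd) (1::real) \<in> sphere 0 1" by simp
  ultimately obtain z where z: "z \<in> sphere 0 1" "\<And>x. x \<in> sphere 0 1 \<Longrightarrow> N z \<le> N x"
    using continuous_attains_inf[of "sphere 0 1 :: (real^'d) set" N] by auto
  have "N z \<noteq> 0" using z(1) N_simps(2) by force
  then have pos: "0 < N z" using N_simps(1)[of z] by linarith
  have "N z * norm x \<le> N x" for x
  proof (cases "x = 0")
    case False
    then have "N z \<le> N (x /\<^sub>R norm x)" by (intro z) simp
    then show ?thesis using False by (simp add: N_simps(4) field_simps)
  qed (use N_simps in simp)
  then show thesis using that pos \<beta> upper by blast
qed

lemma opnorm_leD:
  assumes "opnorm V nV nW A \<le> ennreal c" "0 \<le> c" "u \<in> V" "nV u \<le> 1"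
  shows "nW (A u) \<le> c"
proof -
  have "ennreal (nW (A u)) \<le> opnorm V nV nW A"
    unfolding opnorm_def using assms(3,4) by (intro SUP_upper) auto
  then show ?thesis using assms(1,2) by (metis ennreal_le_iff order_trans)
qed

lemma opnorm_leI:
  assumes "\<And>u. u \<in> V \<Longrightarrow> nV u \<le> 1 \<Longrightarrow> nW (A u) \<le> c"
  shows "opnorm V nV nW A \<le> ennreal c"
  unfolding opnorm_def using assms by (auto intro!: SUP_least ennreal_leI)

context
  fixes N :: "real^'d \<Rightarrow> real" and r \<alpha> \<beta> :: real
  assumes r: "0 \<le> r" and \<alpha>: "0 < \<alpha>" and \<beta>: "0 < \<beta>"
    and N_lower: "\<And>x. \<alpha> * norm x \<le> N x" and N_upper: "\<And>x. N x \<le> \<beta> * norm x"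
begin

lemma Cnorm_upper: "Cnorm N r \<phi> \<le> \<beta> * norm \<phi>"
  unfolding Cnorm_def
proof (rule cSUP_least)
  show "N (apply_bcontfun \<phi> \<theta>) \<le> \<beta> * norm \<phi>" for \<theta>
    using N_upper[of "apply_bcontfun \<phi> \<theta>"] mult_left_mono[OF norm_bounded[of \<phi> \<theta>], of \<beta>] \<beta> by linarith
qed (use r in simp)

lemma N_le_Cnorm:
  assumes "\<theta> \<in> {- r..0}" shows "N (apply_bcontfun \<phi> \<theta>) \<le> Cnorm N r \<phi>"
  unfolding Cnorm_def
proof (rule cSUP_upper[OF assms], rule bdd_aboveI2)
  show "N (apply_bcontfun \<phi> \<theta>) \<le> \<beta> * norm \<phi>" for \<theta>
    using N_upper[of "apply_bcontfun \<phi> \<theta>"] mult_left_mono[OF norm_bounded[of \<phi> \<theta>], of \<beta>] \<beta> by linarith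
qed

lemma Cnorm_lower:
  assumes "\<phi> \<in> Cspace r" shows "\<alpha> * norm \<phi> \<le> Cnorm N r \<phi>"
proof -
  have "norm \<phi> \<le> Cnorm N r \<phi> / \<alpha>"
  proof (rule Cspace_norm_le[OF r assms])
    fix \<theta> assume "\<theta> \<in> {- r..0}"
    then have "\<alpha> * norm (apply_bcontfun \<phi> \<theta>) \<le> Cnorm N r \<phi>"
      using N_le_Cnorm[of \<theta> \<phi>] N_lower[of "apply_bcontfun \<phi> \<theta>"] by linarith
    then show "norm (apply_bcontfun \<phi> \<theta>) \<le> Cnorm N r \<phi> / \<alpha>" using \<alpha> by (simp add: field_simps)
  qed
  then show ?thesis using \<alpha> by (simp add: field_simps)
qed

lemma norm_le_of_opnorm:
  assumes B: "opnorm (Cspace r) (Cnorm N r) N B \<le> ennreal c"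
    and hom: "\<And>a \<phi>. \<phi> \<in> Cspace r \<Longrightarrow> B (a *\<^sub>R \<phi>) = a *\<^sub>R B \<phi>" and c: "0 \<le> c" and \<phi>: "\<phi> \<in> Cspace r"
  shows "norm (B \<phi>) \<le> c * \<beta> / \<alpha> * norm \<phi>"
proof (cases "\<phi> = 0")
  case True
  then show ?thesis using hom[of 0 0] by simp
next
  case False
  define a where "a = 1 / (\<beta> * norm \<phi>)"
  have a: "0 < a" using False \<beta> by (simp add: a_def)
  have "Cnorm N r (a *\<^sub>R \<phi>) \<le> 1"
    using Cnorm_upper[of "a *\<^sub>R \<phi>"] False \<beta> by (simp add: a_def)
  then have "N (B (a *\<^sub>R \<phi>)) \<le> c"
    using \<phi> by (intro opnorm_leD[OF B c]) auto
  then have "\<alpha> * (a * norm (B \<phi>)) \<le> c"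
    using N_lower[of "B (a *\<^sub>R \<phi>)"] hom[OF \<phi>, of a] a by simp
  then show ?thesis using False \<alpha> \<beta> by (simp add: a_def field_simps)
qed

lemma opnorm_le_of_norm:
  assumes "\<And>\<phi>. \<phi> \<in> Cspace r \<Longrightarrow> norm (A \<phi>) \<le> c * norm \<phi>" "0 \<le> c"
  shows "opnorm (Cspace r) (Cnorm N r) (Cnorm N r) A \<le> ennreal (\<beta> / \<alpha> * c)"
proof (rule opnorm_leI)
  fix \<phi> :: "real \<Rightarrow>\<^sub>C (real^'d)" assume \<phi>: "\<phi> \<in> Cspace r" "Cnorm N r \<phi> \<le> 1"
  have "norm \<phi> \<le> 1 / \<alpha>" using Cnorm_lower[OF \<phi>(1)] \<phi>(2) \<alpha> by (simp add: field_simps)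
  then have "c * norm \<phi> \<le> c * (1 / \<alpha>)" using assms(2) by (rule mult_left_mono)
  then have "norm (A \<phi>) \<le> c * (1 / \<alpha>)" using assms(1)[OF \<phi>(1)] by linarith
  then have "\<beta> * norm (A \<phi>) \<le> \<beta> * (c * (1 / \<alpha>))" using \<beta> by (intro mult_left_mono) auto
  then show "Cnorm N r (A \<phi>) \<le> \<beta> / \<alpha> * c" using Cnorm_upper[of "A \<phi>"] by simp
qed

lemma dde_of_opnorm:
  fixes L :: "real \<Rightarrow> (real \<Rightarrow>\<^sub>C (real^'d)) \<Rightarrow> real^'d"
  assumes L: "\<forall>t\<ge>0. bounded_linear_between (Cspace r) (Cnorm N r) UNIV N (L t)"
    and cont: "opnorm_continuous_on {0..} (Cspace r) (Cnorm N r) N L"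
    and fin: "(SUP t\<in>{0..}. opnorm (Cspace r) (Cnorm N r) N (L t)) < \<infinity>"
  obtains M where "dde r M L"
proof -
  have L_add: "L t (\<phi> + \<psi>) = L t \<phi> + L t \<psi>" if "0 \<le> t" "\<phi> \<in> Cspace r" "\<psi> \<in> Cspace r" for t \<phi> \<psi>
    using L that unfolding bounded_linear_between_def by blast
  have L_scale: "L t (a *\<^sub>R \<phi>) = a *\<^sub>R L t \<phi>" if "0 \<le> t" "\<phi> \<in> Cspace r" for t a \<phi>
    using L that unfolding bounded_linear_between_def by blast
  obtain c where c: "0 \<le> c" "(SUP t\<in>{0..}. opnorm (Cspace r) (Cnorm N r) N (L t)) = ennreal c"
    using fin by (cases "SUP t\<in>{0..}. opnorm (Cspace r) (Cnorm N r) N (L t)") auto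
  have bound: "norm (L t \<phi>) \<le> c * \<beta> / \<alpha> * norm \<phi>" if t: "0 \<le> t" and \<phi>: "\<phi> \<in> Cspace r" for t \<phi>
  proof (rule norm_le_of_opnorm[OF _ _ c(1) \<phi>])
    show "opnorm (Cspace r) (Cnorm N r) N (L t) \<le> ennreal c"
      unfolding c(2)[symmetric] using t by (intro SUP_upper) auto
  qed (use L_scale t in auto)
  have "dde r (c * \<beta> / \<alpha>) L"
  proof
    show "\<exists>\<delta>>0. \<forall>s\<ge>0. \<bar>s - t\<bar> < \<delta> \<longrightarrow> (\<forall>\<phi>\<in>Cspace r. norm (L s \<phi> - L t \<phi>) \<le> \<epsilon> * norm \<phi>)"
      if t: "0 \<le> t" and \<epsilon>: "0 < \<epsilon>" for t \<epsilon>
    proof -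
      have "0 < \<epsilon> * \<alpha> / \<beta>" using \<epsilon> \<alpha> \<beta> by simp
      then obtain \<delta> where \<delta>: "0 < \<delta>" "\<And>s. \<lbrakk>0 \<le> s; \<bar>s - t\<bar> < \<delta>\<rbrakk> \<Longrightarrow>
          opnorm (Cspace r) (Cnorm N r) N (\<lambda>u. L s u - L t u) < ennreal (\<epsilon> * \<alpha> / \<beta>)"
        using cont t unfolding opnorm_continuous_on_def by force
      have "norm (L s \<phi> - L t \<phi>) \<le> \<epsilon> * norm \<phi>" if s: "0 \<le> s" "\<bar>s - t\<bar> < \<delta>" and \<phi>: "\<phi> \<in> Cspace r" for s \<phi>
      proof -
        have "norm (L s \<phi> - L t \<phi>) \<le> (\<epsilon> * \<alpha> / \<beta>) * \<beta> / \<alpha> * norm \<phi>"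
        proof (rule norm_le_of_opnorm[where B = "\<lambda>u. L s u - L t u", OF _ _ _ \<phi>])
          show "opnorm (Cspace r) (Cnorm N r) N (\<lambda>u. L s u - L t u) \<le> ennreal (\<epsilon> * \<alpha> / \<beta>)"
            using \<delta>(2)[OF s] by simp
        qed (use L_scale t s \<epsilon> \<alpha> \<beta> in \<open>auto simp: scaleR_diff_right\<close>)
        then show ?thesis using \<alpha> \<beta> by simp
      qed
      then show ?thesis using \<delta>(1) by blast
    qed
    show "0 \<le> c * \<beta> / \<alpha>" using c(1) \<alpha> \<beta> by simp
  qed (use r L_add L_scale bound in auto)
  then show thesis by (rule that)
qed

text \<open>
  An approximate solution with defect \<open>c\<close> is scaled so that its defect becomes the \<open>\<delta>\<close> that belongs to
  the distance \<open>\<epsilon> = 1\<close>, and the shadowing solution is scaled back; so the distance is proportional to \<open>c\<close>.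
\<close>

lemma shadowing_dde_of_shadowable:
  fixes L :: "real \<Rightarrow> (real \<Rightarrow>\<^sub>C (real^'d)) \<Rightarrow> real^'d"
  assumes "dde r M L" and sh: "shadowable N r L"
  obtains K where "shadowing_dde r M L K"
proof -
  interpret dde r M L by fact
  obtain \<delta> where \<delta>: "0 < \<delta>" and
    "\<forall>y y'. continuous_on {- r..} y \<and> (\<forall>t\<ge>0. (y has_vector_derivative y' t) (at t within {0..})) \<and>
      continuous_on {0..} y' \<and> (\<forall>t\<ge>0. N (y' t - L t (seg r y t)) \<le> \<delta>) \<longrightarrow>
      (\<exists>x. is_solution r L 0 x \<and> (\<forall>t\<ge>0. Cnorm N r (seg r x t - seg r y t) \<le> 1))"
    using sh[unfolded shadowable_def, THEN spec, of 1] zero_less_one by (elim impE exE conjE)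
  note shadow = this(2)[THEN spec, THEN spec, THEN mp]
  define K where "K = \<beta> / (\<alpha> * \<delta>)"
  have "shadowing_dde r M L K"
  proof
    show "0 \<le> K" using \<alpha> \<beta> \<delta> by (simp add: K_def)
    fix y c assume y: "pseudo_solution y c" and c: "0 < c"
    obtain y' where y': "continuous_on {- r..} y" "\<And>t. 0 \<le> t \<Longrightarrow> (y has_vector_derivative y' t) (at t within {0..})"
      "continuous_on {0..} y'" "\<And>t. 0 \<le> t \<Longrightarrow> norm (y' t - L t (seg r y t)) \<le> c"
      using y unfolding pseudo_solution_def by blast
    define \<rho> where "\<rho> = \<delta> / (\<beta> * c)"
    have \<rho>: "0 < \<rho>" using \<delta> \<beta> c by (simp add: \<rho>_def)
    have yX: "continuous_on {t - r..t} y" "seg r y t \<in> Cspace r" if "0 \<le> t" for t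
      using pseudo_solution_continuous[OF y that] seg_in_Cspace[OF r] by auto
    have seg\<rho>: "seg r (\<lambda>t. \<rho> *\<^sub>R y t) t = \<rho> *\<^sub>R seg r y t" if "0 \<le> t" for t
      using seg_scaleR[OF r yX(1)[OF that]] .
    have "\<exists>x. is_solution r L 0 x \<and> (\<forall>t\<ge>0. Cnorm N r (seg r x t - seg r (\<lambda>t. \<rho> *\<^sub>R y t) t) \<le> 1)"
    proof (rule shadow[of _ "\<lambda>t. \<rho> *\<^sub>R y' t"], intro conjI allI impI)
      fix t :: real assume t: "0 \<le> t"
      show "((\<lambda>t. \<rho> *\<^sub>R y t) has_vector_derivative \<rho> *\<^sub>R y' t) (at t within {0..})"
        using y'(2)[OF t] by (auto intro!: derivative_eq_intros)
      have "N (\<rho> *\<^sub>R y' t - L t (seg r (\<lambda>t. \<rho> *\<^sub>R y t) t)) \<le> \<beta> * norm (\<rho> *\<^sub>R (y' t - L t (seg r y t)))"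
        using N_upper[of "\<rho> *\<^sub>R (y' t - L t (seg r y t))"] seg\<rho>[OF t] L_scale[OF t yX(2)[OF t]]
        by (simp add: scaleR_diff_right)
      also have "\<dots> \<le> \<beta> * (\<rho> * c)"
        using y'(4)[OF t] \<rho> \<beta> by (simp add: mult_left_mono)
      also have "\<dots> = \<delta>" using \<beta> c by (simp add: \<rho>_def)
      finally show "N (\<rho> *\<^sub>R y' t - L t (seg r (\<lambda>t. \<rho> *\<^sub>R y t) t)) \<le> \<delta>" .
    qed (use y' in \<open>auto intro!: continuous_intros\<close>)
    then obtain x where x: "is_solution r L 0 x"
      "\<And>t. 0 \<le> t \<Longrightarrow> Cnorm N r (seg r x t - seg r (\<lambda>t. \<rho> *\<^sub>R y t) t) \<le> 1" by blast
    define \<xi> where "\<xi> = (1 / \<rho>) *\<^sub>R seg r x 0"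
    have xX: "seg r x t \<in> Cspace r" if "0 \<le> t" for t using is_solution_seg_in[OF x(1) that] .
    have "norm (T t 0 \<xi> - seg r y t) \<le> K * c" if t: "0 \<le> t" for t
    proof -
      have T\<xi>: "T t 0 \<xi> = (1 / \<rho>) *\<^sub>R seg r x t"
        using T_scale[of 0 t "seg r x 0" "1 / \<rho>"] T_eq[OF x(1) order_refl t] xX t by (simp add: \<xi>_def)
      have "\<rho> *\<^sub>R (T t 0 \<xi> - seg r y t) = seg r x t - seg r (\<lambda>t. \<rho> *\<^sub>R y t) t"
        using \<rho> by (simp add: T\<xi> seg\<rho>[OF t] scaleR_diff_right)
      moreover have "seg r x t - seg r (\<lambda>t. \<rho> *\<^sub>R y t) t \<in> Cspace r"
        unfolding seg\<rho>[OF t]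
        by (intro subspace_diff[OF subspace_Cspace xX[OF t]] subspace_scale[OF subspace_Cspace yX(2)[OF t]])
      ultimately have "\<alpha> * norm (\<rho> *\<^sub>R (T t 0 \<xi> - seg r y t)) \<le> 1"
        using Cnorm_lower[of "seg r x t - seg r (\<lambda>t. \<rho> *\<^sub>R y t) t"] x(2)[OF t] by simp
      then have "\<alpha> * \<rho> * norm (T t 0 \<xi> - seg r y t) \<le> 1" using \<rho> by simp
      then have "norm (T t 0 \<xi> - seg r y t) \<le> 1 / (\<alpha> * \<rho>)" using \<alpha> \<rho> by (simp add: field_simps)
      also have "\<dots> = K * c" using \<alpha> \<beta> \<delta> c by (simp add: K_def \<rho>_def field_simps)
      finally show ?thesis .
    qed
    moreover have "\<xi> \<in> Cspace r" using xX by (auto simp: \<xi>_def)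
    ultimately show "\<exists>\<xi>\<in>Cspace r. \<forall>t\<ge>0. norm (T t 0 \<xi> - seg r y t) \<le> K * c" by blast
  qed
  then show thesis by (rule that)
qed

lemma exponential_dichotomy_of_projected_dde:
  fixes L :: "real \<Rightarrow> (real \<Rightarrow>\<^sub>C (real^'d)) \<Rightarrow> real^'d"
  assumes "projected_dde r M L K Q k"
  shows "exponential_dichotomy N r L"
proof -
  interpret projected_dde r M L K Q k by fact
  obtain D \<mu> where D: "0 < D" "0 < \<mu>"
    and est: "\<forall>s\<ge>0. \<forall>\<phi>\<in>Cspace r. \<forall>t\<ge>s. norm (T t s (P s \<phi>)) \<le> D * exp (- \<mu> * (t - s)) * norm \<phi>"
      "\<forall>s\<ge>0. \<forall>\<phi>\<in>Cspace r. \<forall>t\<ge>0. t \<le> s \<longrightarrow>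
        inv_into (Cker r (P t)) (T s t) (\<phi> - P s \<phi>) \<in> Cspace r \<and>
        norm (inv_into (Cker r (P t)) (T s t) (\<phi> - P s \<phi>)) \<le> D * exp (- \<mu> * (s - t)) * norm \<phi>"
    using dichotomy_estimates by (elim exE conjE)
  have P_bounded: "bounded_linear_between (Cspace r) (Cnorm N r) (Cspace r) (Cnorm N r) (P t)" if t: "0 \<le> t" for t
  proof -
    have "Cnorm N r (P t \<phi>) \<le> (\<beta> * D / \<alpha>) * Cnorm N r \<phi>" if \<phi>: "\<phi> \<in> Cspace r" for \<phi>
    proof -
      have "norm (P t \<phi>) \<le> D * norm \<phi>"
        using est(1)[rule_format, OF t \<phi> order_refl] T_refl[OF t P_in[OF t \<phi>]] by simp
      also have "\<dots> \<le> D * (Cnorm N r \<phi> / \<alpha>)"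
        using Cnorm_lower[OF \<phi>] \<alpha> D by (intro mult_left_mono) (auto simp: field_simps)
      finally have "\<beta> * norm (P t \<phi>) \<le> \<beta> * (D * (Cnorm N r \<phi> / \<alpha>))" using \<beta> by (intro mult_left_mono) auto
      then show ?thesis using Cnorm_upper[of "P t \<phi>"] by simp
    qed
    moreover have "P t (\<phi> + \<psi>) = P t \<phi> + P t \<psi>" if "\<phi> \<in> Cspace r" "\<psi> \<in> Cspace r" for \<phi> \<psi>
      using P_lincomb[OF t that, of 1 1] by simp
    moreover have "P t (a *\<^sub>R \<phi>) = a *\<^sub>R P t \<phi>" if "\<phi> \<in> Cspace r" for a \<phi>
      using P_lincomb[OF t that that, of a 0] by simp
    ultimately show ?thesis unfolding bounded_linear_between_def using P_in[OF t] by blast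
  qed
  have est1: "opnorm (Cspace r) (Cnorm N r) (Cnorm N r) (\<lambda>\<phi>. T t s (P s \<phi>)) \<le> ennreal (\<beta> / \<alpha> * D * exp (- \<mu> * (t - s)))"
    if "0 \<le> s" "s \<le> t" for s t
    unfolding mult.assoc by (rule opnorm_le_of_norm) (use est(1) that D in auto)
  have est2: "opnorm (Cspace r) (Cnorm N r) (Cnorm N r) (\<lambda>\<phi>. inv_into (Cker r (P t)) (T s t) (\<phi> - P s \<phi>))
      \<le> ennreal (\<beta> / \<alpha> * D * exp (- \<mu> * (s - t)))" if "0 \<le> t" "t \<le> s" for s t
    unfolding mult.assoc by (rule opnorm_le_of_norm) (use est(2) that D in auto)
  have pos: "0 < \<beta> / \<alpha> * D" using \<alpha> \<beta> D by simp
  show ?thesis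
    unfolding exponential_dichotomy_def
    by (rule exI[of _ P], rule exI[of _ "\<beta> / \<alpha> * D"], rule exI[of _ \<mu>])
      (intro conjI allI ballI impI; (rule est1 est2; simp)?; simp add: pos D P_bounded P_stable_eq P_stable P_T bij_betw_Cker est1 est2 del: times_divide_eq_left)
qed

end

theorem theorem2:
  fixes N :: "real^'d \<Rightarrow> real"
    and r :: real
    and L :: "real \<Rightarrow> (real \<Rightarrow>\<^sub>C (real^'d)) \<Rightarrow> real^'d"
  assumes "is_norm N"
    and "0 \<le> r"
    and "\<forall>t\<ge>0. bounded_linear_between (Cspace r) (Cnorm N r) UNIV N (L t)"
    and "opnorm_continuous_on {0..} (Cspace r) (Cnorm N r) N L"
    and "(SUP t\<in>{0..}. opnorm (Cspace r) (Cnorm N r) N (L t)) < \<infinity>"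
    and "shadowable N r L"
  shows "exponential_dichotomy N r L"
proof -
  obtain \<alpha> \<beta> where N: "0 < \<alpha>" "0 < \<beta>" "\<And>x. \<alpha> * norm x \<le> N x" "\<And>x. N x \<le> \<beta> * norm x"
    using is_norm_equivalent[OF assms(1)] by blast
  obtain M where "dde r M L"
    using dde_of_opnorm[OF assms(2) N assms(3-5)] .
  then obtain K where "shadowing_dde r M L K"
    using shadowing_dde_of_shadowable[OF assms(2) N _ assms(6)] by blast
  then interpret shadowing_dde r M L K .
  obtain Q k where "projected_dde r M L K Q k"
  proof -
    obtain Q k where Q: "0 \<le> k" "\<forall>\<phi>\<in>Cspace r. Q \<phi> \<in> Cspace r \<and> norm (Q \<phi>) \<le> k * norm \<phi> \<and>
         (\<forall>t\<ge>0. norm (T t 0 (\<phi> - Q \<phi>)) \<le> k * norm \<phi>)"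
       "\<forall>\<phi>\<in>Cspace r. \<forall>\<psi>\<in>Cspace r. \<forall>a b. Q (a *\<^sub>R \<phi> + b *\<^sub>R \<psi>) = a *\<^sub>R Q \<phi> + b *\<^sub>R Q \<psi>"
       "\<forall>\<phi>\<in>Cspace r. \<forall>b. (\<forall>t\<ge>0. norm (T t 0 \<phi>) \<le> b) \<longrightarrow> Q \<phi> = 0"
      using initial_projection by (elim exE conjE)
    have "projected_dde r M L K Q k"
      by unfold_locales (use Q in blast)+
    then show thesis by (rule that)
  qed
  then show ?thesis by (rule exponential_dichotomy_of_projected_dde[OF assms(2) N])
qed

end
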